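(* Let $\boldsymbol{d}=\boldsymbol{d}(n)=(d_1(n),\dots,d_n(n))$, $n\ge1$, be degree sequences with $n_0=0$, and suppose that Conditions (a)–(b) below hold for a probability distribution $\boldsymbol{p}=(p_i)_{i\ge1}$ satisfying $p_1>0$ and $\sum_{i\ge1} ip_i>2$. Then, as $n\to\infty$, \[ |\mathscr{G}^{c}_{\boldsymbol{d}}| = \mathrm{e}^{-K(\boldsymbol{p})n+o(n)}\,|\mathscr{G}_{\boldsymbol{d}}| = \mathrm{e}^{-K(\boldsymbol{p})n+o(n)}\,\frac{(\ell_n-1)!!}{\prod_{i=1}^n d_i!}. \]
   Context: A degree sequence is a vector $\boldsymbol{d}=(d_1,\dots,d_n)$ of nonnegative integers with even sum. For $i\ge0$ let $n_i=n_i(n)=\#\{j\le n: d_j(n)=i\}$ (standing assumption: $n_0=0$), and $\ell_n=\sum_{i\ge1} i n_i=\sum_j d_j$. Conditions: (a) $n_i/n\to p_i$ for every $i\ge1$, where $\sum_{i\ge1}p_i=1$; (b) $\ell_n/n\to\sum_{i\ge1} ip_i<\infty$. Let $\beta=\beta(\boldsymbol{p})\in(0,1)$ be the unique solution in $(0,1)$ of $\sum_{k\ge1}kp_k=(1-\beta^2)\sum_{k\ge1}\frac{kp_k}{1-\beta^k}$, and \[K(\boldsymbol{p})=\Big(\tfrac12\sum_{k\ge1}kp_k\Big)\log(1-\beta(\boldsymbol{p})^2)-\sum_{k\ge1}p_k\log(1-\beta(\boldsymbol{p})^k).\] $\mathscr{G}_{\boldsymbol{d}}$ is the set of simple graphs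 (no self-loops, no multiple edges) on vertex set $[n]=\{1,\dots,n\}$ in which vertex $i$ has degree $d_i$ for all $i$, and $\mathscr{G}^c_{\boldsymbol{d}}$ is the subset of connected graphs in $\mathscr{G}_{\boldsymbol{d}}$. For $m$ odd, $m!!=m(m-2)\cdots 1$. A statement $a_n=\mathrm{e}^{-Kn+o(n)}b_n$ means $a_n=\mathrm{e}^{-Kn+\varepsilon_n n}b_n$ for some sequence $\varepsilon_n\to0$. *)

theory Defs
  imports "HOL-Analysis.Analysis"
begin

text \<open>A degree sequence of length \<open>n\<close> is a function \<open>d :: nat \<Rightarrow> nat\<close> of which only the
  values on \<open>{1..n}\<close> matter.\<close>

definition degree_count :: "nat \<Rightarrow> (nat \<Rightarrow> nat) \<Rightarrow> nat \<Rightarrow> nat" where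
  "degree_count n d i = card {j \<in> {1..n}. d j = i}"

definition total_degree :: "nat \<Rightarrow> (nat \<Rightarrow> nat) \<Rightarrow> nat" where
  "total_degree n d = (\<Sum>j=1..n. d j)"

definition degree_sequence :: "nat \<Rightarrow> (nat \<Rightarrow> nat) \<Rightarrow> bool" where
  "degree_sequence n d \<longleftrightarrow> even (total_degree n d)"

text \<open>A simple graph on a given vertex set is represented by its set of edges, each edge being
  a two-element set of vertices; this excludes self-loops and multiple edges.\<close>

definition simple_graph_on :: "'a set \<Rightarrow> 'a set set \<Rightarrow> bool" where
  "simple_graph_on V E \<longleftrightarrow> (\<forall>e\<in>E. e \<subseteq> V \<and> card e = 2)"

definition vertex_degree :: "'a set set \<Rightarrow> 'a \<Rightarrow> nat" where
  "vertex_degree E v = card {e \<in> E. v \<in> e}"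

definition connected_graph_on :: "'a set \<Rightarrow> 'a set set \<Rightarrow> bool" where
  "connected_graph_on V E \<longleftrightarrow> V \<noteq> {} \<and> (\<forall>u\<in>V. \<forall>v\<in>V. (u, v) \<in> {(x, y). {x, y} \<in> E}\<^sup>*)"

definition graphs_with_degrees :: "nat \<Rightarrow> (nat \<Rightarrow> nat) \<Rightarrow> nat set set set" where
  "graphs_with_degrees n d =
     {E. simple_graph_on {1..n} E \<and> (\<forall>i\<in>{1..n}. vertex_degree E i = d i)}"

definition connected_graphs_with_degrees :: "nat \<Rightarrow> (nat \<Rightarrow> nat) \<Rightarrow> nat set set set" where
  "connected_graphs_with_degrees n d =
     {E \<in> graphs_with_degrees n d. connected_graph_on {1..n} E}"

fun double_fact :: "nat \<Rightarrow> nat" where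
  "double_fact 0 = 1"
| "double_fact (Suc 0) = 1"
| "double_fact (Suc (Suc m)) = Suc (Suc m) * double_fact m"

text \<open>A distribution \<open>p\<close> on the positive integers is a function on \<open>nat\<close> whose value
  at \<open>0\<close> is never used.\<close>

definition prob_dist_pos :: "(nat \<Rightarrow> real) \<Rightarrow> bool" where
  "prob_dist_pos p \<longleftrightarrow> (\<forall>i\<ge>1. p i \<ge> 0) \<and> (p has_sum 1) {1..}"

definition mean_pos :: "(nat \<Rightarrow> real) \<Rightarrow> real" where
  "mean_pos p = (\<Sum>\<^sub>\<infinity>k\<in>{1..}. real k * p k)"

definition beta :: "(nat \<Rightarrow> real) \<Rightarrow> real" where
  "beta p = (THE b. 0 < b \<and> b < 1 \<and>
     mean_pos p = (1 - b\<^sup>2) * (\<Sum>\<^sub>\<infinity>k\<in>{1..}. real k * p k / (1 - b ^ k)))"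

definition K_rate :: "(nat \<Rightarrow> real) \<Rightarrow> real" where
  "K_rate p = (1/2 * mean_pos p) * ln (1 - (beta p)\<^sup>2)
     - (\<Sum>\<^sub>\<infinity>k\<in>{1..}. p k * ln (1 - beta p ^ k))"

text \<open>The relation \<open>a\<^sub>n = exp (- K n + o(n)) b\<^sub>n\<close> as \<open>n \<rightarrow> \<infinity>\<close>. It is required for all large \<open>n\<close>
  only: for small \<open>n\<close> there may be no graph at all with the given degrees.\<close>

definition exp_equiv :: "real \<Rightarrow> (nat \<Rightarrow> real) \<Rightarrow> (nat \<Rightarrow> real) \<Rightarrow> bool" where
  "exp_equiv K a b \<longleftrightarrow> (\<exists>\<epsilon> :: nat \<Rightarrow> real. \<epsilon> \<longlonglongrightarrow> 0 \<and>
     (\<forall>\<^sub>F n in sequentially. a n = exp (- K * real n + \<epsilon> n * real n) * b n))"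

end

(* The number of graphs with given degrees times the product of the d_i! counts simple pairings of
   half-edges, and it satisfies the recursion of an exploration: take a half-edge of a discovered
   vertex and sum over its possible partners.  No pairings are needed beyond this recursion.

   Upper bound: add about n_k b^k / (1 - b^k) vertices of each degree k <= M, where b is the tilting
   parameter.  In the configuration model on the enlarged degree sequence the probability that an
   exploration discovers exactly the original vertices is at most 1, and this bounds the connected
   count by exp (- K n + o(n)) times the number of pairings, as M tends to infinity.

   Lower bound: the total weight of all orders in which the exploration may discover vertices and close
   cycles is bounded below by the orders that follow, block by block, the trajectory of the tilted
   model.  The entropies of the blocks sum up, by Abel summation, to the same constant.  Vertices of
   degree above M are joined to fresh vertices of bounded degree at the start and a positive fraction
   of the leaves is kept for the end; so loops and multiple edges exclude only boundedly many choices
   in each step while linearly many half-edges are active, which makes simplicity free of charge.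
   The same device gives exp (o(n)) for the loss in passing from pairings to simple graphs. *)

theory Submission
  imports Defs
begin

section \<open>Explorations of graphs with given degrees\<close>

text \<open>Why \<open>beta\<close> is the right tilt: take
  \<open>xw k = p k / (1 - beta p ^ k)\<close> as the density of degree k. When a half-edge survives
  with probability z, the active ones have density \<open>total_xw\<close> z^2 - sum k
  \<open>xw k\<close> z^k. This vanishes at z = 1, and the equation for \<open>beta\<close> says
  that it vanishes again at z = \<open>beta p\<close>, where exactly \<open>p k\<close> of the
  vertices of degree k have been discovered. Discovering just the original vertices is thus typical
  behaviour in the enlarged model, and the upper bound loses only exp (o(n)).

  The obstacle for the lower bound is that this trajectory has no active half-edges at either end,
  while avoiding loops and multiple edges needs more than \<open>C\<close> of them. The blocks are
  therefore run at scale 1 - eta. Out of the surplus, about delta n vertices of one degree k0 >= 3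
  are discovered at the start, each adding k0 - 2 >= 1 active half-edges, and the surplus leaves end
  the exploration. The parameters are fixed in the order eta, M, J before n grows.\<close>

lemma simple_graph_on_finite:
  assumes "finite U" "simple_graph_on U E"
  shows "finite E"
proof -
  have "E \<subseteq> Pow U" using assms(2) by (auto simp: simple_graph_on_def)
  thus ?thesis using assms(1) by (meson finite_Pow_iff finite_subset)
qed

lemma simple_graph_on_mono:
  "simple_graph_on V E \<Longrightarrow> V \<subseteq> U \<Longrightarrow> simple_graph_on U E"
  by (auto simp: simple_graph_on_def)

lemma vertex_degree_mono:
  "finite E \<Longrightarrow> F \<subseteq> E \<Longrightarrow> vertex_degree F x \<le> vertex_degree E x"
  unfolding vertex_degree_def by (rule card_mono) auto

lemma vertex_degree_insert:
  assumes "finite F" "{v, w} \<notin> F"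
  shows "vertex_degree (insert {v, w} F) x = vertex_degree F x + (if x = v \<or> x = w then 1 else 0)"
proof (cases "x = v \<or> x = w")
  case True
  then have "{e \<in> insert {v, w} F. x \<in> e} = insert {v, w} {e \<in> F. x \<in> e}" by auto
  with True assms show ?thesis by (simp add: vertex_degree_def)
next
  case False
  then have "{e \<in> insert {v, w} F. x \<in> e} = {e \<in> F. x \<in> e}" by auto
  with False show ?thesis by (simp add: vertex_degree_def)
qed

lemma handshake:
  assumes "finite U" "simple_graph_on U F"
  shows "(\<Sum>v\<in>U. vertex_degree F v) = 2 * card F"
proof -
  have fF: "finite F" using assms simple_graph_on_finite by blast
  have "(\<Sum>v\<in>U. vertex_degree F v) = (\<Sum>v\<in>U. \<Sum>e\<in>F. if v \<in> e then 1 else 0)"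
    unfolding vertex_degree_def using fF by (simp add: sum.If_cases Int_def)
  also have "\<dots> = (\<Sum>e\<in>F. \<Sum>v\<in>U. if v \<in> e then 1 else 0)" by (rule sum.swap)
  also have "\<dots> = (\<Sum>e\<in>F. 2)"
  proof (rule sum.cong)
    fix e assume "e \<in> F"
    then have "e \<subseteq> U" "card e = 2" using assms(2) by (auto simp: simple_graph_on_def)
    moreover from this have "U \<inter> e = e" by auto
    moreover have "{x \<in> U. x \<in> e} = U \<inter> e" by auto
    ultimately show "(\<Sum>v\<in>U. if v \<in> e then 1 else 0) = (2::nat)"
      using assms(1) by (simp add: sum.If_cases)
  qed simp
  finally show ?thesis by simp
qed

text \<open>In a pair \<open>(D, F)\<close> the set \<open>D\<close> collects the vertices already discovered by an exploration and
  \<open>F\<close> the edges already revealed.\<close>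

locale exploration =
  fixes U :: "'a set" and d :: "'a \<Rightarrow> nat"
  assumes fin: "finite U"
begin

text \<open>Connectivity enters only as reachability from \<open>D\<close>. Without revealed edges,
  \<open>D = {x}\<close> gives the connected graphs and \<open>D = U\<close> gives all graphs, so
  one recursion serves both counts.\<close>

definition extensions :: "'a set \<Rightarrow> 'a set set \<Rightarrow> 'a set set set" where
  "extensions D F = {E. simple_graph_on U E \<and> (\<forall>v\<in>U. vertex_degree E v = d v) \<and> F \<subseteq> E \<and>
     (\<forall>x\<in>U. \<exists>y\<in>D. (x, y) \<in> {(x, y). {x, y} \<in> E}\<^sup>*)}"

definition res :: "'a set set \<Rightarrow> 'a \<Rightarrow> nat" where
  "res F v = d v - vertex_degree F v"

text \<open>The weight counts the ways to complete \<open>F\<close> to a pairing of half-edges, so that no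
  pairings have to be formalised.\<close>

definition weight :: "'a set \<Rightarrow> 'a set set \<Rightarrow> nat" where
  "weight D F = card (extensions D F) * (\<Prod>v\<in>U. fact (res F v))"

definition state :: "'a set \<Rightarrow> 'a set set \<Rightarrow> bool" where
  "state D F \<longleftrightarrow> D \<subseteq> U \<and> simple_graph_on D F \<and> (\<forall>v\<in>U. vertex_degree F v \<le> d v)"

definition partners :: "'a set set \<Rightarrow> 'a \<Rightarrow> 'a set" where
  "partners F v = {w \<in> U. w \<noteq> v \<and> {v, w} \<notin> F}"

definition active :: "'a set \<Rightarrow> 'a set set \<Rightarrow> nat" where
  "active D F = (\<Sum>v\<in>D. res F v)"

definition undisc :: "'a set \<Rightarrow> nat \<Rightarrow> nat" where
  "undisc D k = card {v \<in> U - D. d v = k}"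

lemma finite_partners [simp]: "finite (partners F v)"
  using fin by (simp add: partners_def)

lemma finite_extensions: "finite (extensions D F)"
proof -
  have "extensions D F \<subseteq> Pow (Pow U)" by (auto simp: extensions_def simple_graph_on_def)
  thus ?thesis using fin by (meson finite_Pow_iff finite_subset)
qed

lemma state_finite:
  assumes "state D F" shows "finite F" "finite D"
proof -
  have "simple_graph_on D F" "D \<subseteq> U" using assms by (auto simp: state_def)
  thus "finite F" "finite D" using fin simple_graph_on_finite finite_subset by blast+
qed

lemma state_undiscovered:
  assumes "state D F" "v \<notin> D" shows "vertex_degree F v = 0" "res F v = d v"
proof -
  have "{e \<in> F. v \<in> e} = {}" using assms by (auto simp: state_def simple_graph_on_def)
  thus "vertex_degree F v = 0" unfolding vertex_degree_def by (metis card.empty)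
  thus "res F v = d v" by (simp add: res_def)
qed

lemma sum_res:
  assumes "state D F"
  shows "(\<Sum>v\<in>U. res F v) + 2 * card F = (\<Sum>v\<in>U. d v)"
proof -
  have "2 * card F = (\<Sum>v\<in>U. vertex_degree F v)"
    using assms handshake[OF fin, of F] simple_graph_on_mono unfolding state_def by metis
  then have "(\<Sum>v\<in>U. res F v) + 2 * card F = (\<Sum>v\<in>U. res F v + vertex_degree F v)"
    by (simp add: sum.distrib)
  also have "\<dots> = (\<Sum>v\<in>U. d v)"
    using assms by (intro sum.cong) (auto simp: res_def state_def)
  finally show ?thesis .
qed

lemma active_eq:
  assumes "state D F"
  shows "active D F + (\<Sum>v\<in>U-D. d v) + 2 * card F = (\<Sum>v\<in>U. d v)"
proof -
  have D: "D \<subseteq> U" using assms by (simp add: state_def)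
  have "(\<Sum>v\<in>U. res F v) = active D F + (\<Sum>v\<in>U-D. res F v)"
    unfolding active_def using sum.subset_diff[OF D fin] by (simp add: add.commute)
  moreover have "(\<Sum>v\<in>U-D. res F v) = (\<Sum>v\<in>U-D. d v)"
    using state_undiscovered(2)[OF assms] by (intro sum.cong) auto
  ultimately show ?thesis using sum_res[OF assms] by simp
qed

lemma state_step:
  assumes "state D F" "v \<in> D" "w \<in> partners F v" "res F v > 0" "res F w > 0"
  shows "state (insert w D) (insert {v, w} F)"
  using assms fin state_finite[OF assms(1)]
  by (auto simp: state_def partners_def simple_graph_on_def res_def vertex_degree_insert)

lemma res_insert:
  assumes "state D F" "w \<in> partners F v"
  shows "res (insert {v, w} F) x = res F x - (if x = v \<or> x = w then 1 else 0)"
  using assms state_finite[OF assms(1)] by (simp add: partners_def res_def vertex_degree_insert)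

text \<open>The edges of \<open>E\<close> at \<open>v\<close> outside \<open>F\<close> correspond to
  their other endpoints. The count is the same for every extension, which turns the double count in
  \<open>weight_rec\<close> into an identity.\<close>

lemma card_partners_extension:
  assumes st: "state D F" and v: "v \<in> U" and E: "E \<in> extensions D F"
  shows "card {w \<in> partners F v. {v, w} \<in> E} = res F v"
proof -
  have sg: "simple_graph_on U E" and FE: "F \<subseteq> E" and deg: "vertex_degree E v = d v"
    using E v by (auto simp: extensions_def)
  have fE: "finite E" using sg fin simple_graph_on_finite by blast
  have bij: "bij_betw (\<lambda>w. {v, w}) {w \<in> partners F v. {v, w} \<in> E} {e \<in> E - F. v \<in> e}"
  proof (rule bij_betw_imageI)
    show "inj_on (\<lambda>w. {v, w}) {w \<in> partners F v. {v, w} \<in> E}"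
      by (auto simp: inj_on_def doubleton_eq_iff)
    show "(\<lambda>w. {v, w}) ` {w \<in> partners F v. {v, w} \<in> E} = {e \<in> E - F. v \<in> e}"
    proof (intro equalityI subsetI)
      fix e assume e: "e \<in> {e \<in> E - F. v \<in> e}"
      then have "card e = 2" "e \<subseteq> U" using sg by (auto simp: simple_graph_on_def)
      then obtain w where "e = {v, w}" "w \<noteq> v" using e
        by (metis (no_types, lifting) card_2_iff doubleton_eq_iff insertE mem_Collect_eq singletonD)
      then show "e \<in> (\<lambda>w. {v, w}) ` {w \<in> partners F v. {v, w} \<in> E}"
        using e \<open>e \<subseteq> U\<close> by (auto simp: partners_def)
    qed (auto simp: partners_def)
  qed
  have "{e \<in> E - F. v \<in> e} = {e \<in> E. v \<in> e} - {e \<in> F. v \<in> e}" by auto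
  then have "card {e \<in> E - F. v \<in> e} = vertex_degree E v - vertex_degree F v"
    unfolding vertex_degree_def using FE fE
    by (metis (no_types, lifting) Collect_mono_iff card_Diff_subset finite_subset mem_Collect_eq subsetD subsetI)
  then show ?thesis using bij_betw_same_card[OF bij] deg by (simp add: res_def)
qed

text \<open>Once \<open>{v, w}\<close> is an edge, reaching \<open>w\<close> means reaching
  \<open>v\<close> in \<open>D\<close>, so moving \<open>w\<close> into \<open>D\<close> does not
  relax the reachability condition.\<close>

lemma extensions_step:
  assumes "v \<in> D" "w \<in> partners F v"
  shows "{E \<in> extensions D F. {v, w} \<in> E} = extensions (insert w D) (insert {v, w} F)"
proof -
  have "\<exists>y\<in>D. (x, y) \<in> {(x, y). {x, y} \<in> E}\<^sup>*"
    if "(x, w) \<in> {(x, y). {x, y} \<in> E}\<^sup>*" "{v, w} \<in> E" for x E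
  proof -
    have "(w, v) \<in> {(x, y). {x, y} \<in> E}" using that(2) by (auto simp: insert_commute)
    with that(1) have "(x, v) \<in> {(x, y). {x, y} \<in> E}\<^sup>*" by (rule rtrancl_into_rtrancl)
    with assms(1) show ?thesis by blast
  qed
  then show ?thesis by (auto simp: extensions_def; blast)
qed

text \<open>A further edge at \<open>w\<close> would exceed its prescribed degree. This lets
  \<open>weight_rec\<close> carry the factor \<open>res F w\<close> also where it vanishes.\<close>

lemma extensions_empty:
  assumes st: "state D F" and w: "w \<in> partners F v" and z: "res F w = 0"
  shows "extensions D' (insert {v, w} F) = {}"
proof (rule ccontr)
  assume "extensions D' (insert {v, w} F) \<noteq> {}"
  then obtain E where sg: "simple_graph_on U E" and FE: "insert {v, w} F \<subseteq> E"
    and deg: "vertex_degree E w = d w"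
    using w by (auto simp: extensions_def partners_def)
  have "vertex_degree (insert {v, w} F) w \<le> vertex_degree E w"
    by (rule vertex_degree_mono[OF simple_graph_on_finite[OF fin sg] FE])
  moreover have "vertex_degree (insert {v, w} F) w = vertex_degree F w + 1"
    using w state_finite[OF st] by (simp add: partners_def vertex_degree_insert)
  ultimately show False using deg z by (simp add: res_def)
qed

text \<open>Count the pairs of an extension and a hidden neighbour of \<open>v\<close> in two ways.
  Revealing \<open>{v, w}\<close> divides the product of factorials by
  \<open>res F v * res F w\<close>; the first factor cancels against the count, the second is the
  number of half-edges of \<open>w\<close> that may be chosen.\<close>

lemma weight_rec:
  assumes st: "state D F" and v: "v \<in> D" and pos: "res F v > 0"
  shows "weight D F =
    (\<Sum>w\<in>partners F v. res F w * weight (insert w D) (insert {v, w} F))"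
proof -
  have vU: "v \<in> U" using st v by (auto simp: state_def)
  let ?P = "\<lambda>F. \<Prod>v\<in>U. fact (res F v) :: nat"
  have "res F v * card (extensions D F) =
      (\<Sum>E\<in>extensions D F. card {w \<in> partners F v. {v, w} \<in> E})"
    using card_partners_extension[OF st vU] by simp
  also have "\<dots> = (\<Sum>w\<in>partners F v. card {E \<in> extensions D F. {v, w} \<in> E})"
    using finite_extensions
    by (intro sum_multicount_gen) auto
  finally have count: "res F v * card (extensions D F) =
      (\<Sum>w\<in>partners F v. card (extensions (insert w D) (insert {v, w} F)))"
    using extensions_step[OF v] by simp
  have prod: "res F v * (res F w * ?P (insert {v, w} F)) = ?P F"
    if w: "w \<in> partners F v" and rw: "res F w > 0" for w
  proof -
    have wU: "w \<in> U - {v}" using w by (auto simp: partners_def)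
    have *: "?P G = fact (res G v) * (fact (res G w) * (\<Prod>x\<in>U-{v}-{w}. fact (res G x)))" for G
      using prod.remove[OF fin vU, of "\<lambda>v. fact (res G v) :: nat"]
        prod.remove[of "U - {v}" w "\<lambda>v. fact (res G v) :: nat"] fin wU by simp
    have "(\<Prod>x\<in>U-{v}-{w}. fact (res (insert {v, w} F) x)) = (\<Prod>x\<in>U-{v}-{w}. fact (res F x) :: nat)"
      using res_insert[OF st w] by (intro prod.cong) auto
    moreover have "fact (res F v) = res F v * fact (res (insert {v, w} F) v)"
      "fact (res F w) = res F w * fact (res (insert {v, w} F) w)"
      using res_insert[OF st w] pos rw by (auto simp: fact_reduce)
    ultimately show ?thesis unfolding * by (simp add: mult_ac)
  qed
  have "res F v * weight D F = (\<Sum>w\<in>partners F v. card (extensions (insert w D) (insert {v, w} F)) * ?P F)"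
    unfolding weight_def using count by (simp add: mult.assoc[symmetric] sum_distrib_right)
  also have "\<dots> = (\<Sum>w\<in>partners F v. res F v * (res F w * weight (insert w D) (insert {v, w} F)))"
  proof (rule sum.cong)
    fix w assume w: "w \<in> partners F v"
    show "card (extensions (insert w D) (insert {v, w} F)) * ?P F =
        res F v * (res F w * weight (insert w D) (insert {v, w} F))"
    proof (cases "res F w > 0")
      case True
      show ?thesis unfolding prod[OF w True, symmetric] weight_def by (simp add: mult_ac)
    next
      case False
      then show ?thesis using extensions_empty[OF st w] by simp
    qed
  qed simp
  finally show ?thesis using pos by (simp add: sum_distrib_left[symmetric])
qed

end

text \<open>This is (2s - 1)!!, the number of pairings of 2s half-edges. Indexing by pairs makes one
  unfolding match one exploration step.\<close>

fun odd_fact :: "nat \<Rightarrow> nat" where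
  "odd_fact 0 = 1"
| "odd_fact (Suc s) = (2 * s + 1) * odd_fact s"

text \<open>Only the numbers \<open>A\<close> of active half-edges and \<open>u k\<close> of undiscovered vertices of degree \<open>k\<close> matter
  for the lower bound; \<open>C\<close> bounds the number of active half-edges that would create a loop or a
  multiple edge. The factors \<open>k * u k\<close> are left out, as their product does not depend on the order.\<close>

fun path_weight :: "nat \<Rightarrow> nat \<Rightarrow> nat \<Rightarrow> nat \<Rightarrow> (nat \<Rightarrow> nat) \<Rightarrow> nat" where
  "path_weight M C 0 A u = (if A = 0 \<and> (\<forall>k\<in>{1..M}. u k = 0) then 1 else 0)"
| "path_weight M C (Suc s) A u = (if A = 0 then 0 else
     (\<Sum>k\<in>{k\<in>{1..M}. u k > 0}. path_weight M C s (A + k - 2) (u(k := u k - 1)))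
     + (A - C) * path_weight M C s (A - 2) u)"

section \<open>Comparison of weights with pairings and with weighted paths\<close>

context exploration
begin

text \<open>Every edge of an extension at a vertex of \<open>D\<close> is already revealed, so no
  path leaves \<open>D\<close>; reachability then forces \<open>U = D\<close>.\<close>

lemma no_active_extension:
  assumes st: "state D F" and z: "\<forall>v\<in>D. res F v = 0" and E: "E \<in> extensions D F"
  shows "U = D" "E = F"
proof -
  have sg: "simple_graph_on U E" and FE: "F \<subseteq> E" and DU: "D \<subseteq> U"
    using E st by (auto simp: extensions_def state_def)
  have fE: "finite E" using sg fin simple_graph_on_finite by blast
  have noE: "{b, a} \<in> F" if b: "b \<in> D" and e: "{b, a} \<in> E" for a b
  proof (rule ccontr)
    assume "{b, a} \<notin> F"
    moreover have "card {b, a} = 2" "{b, a} \<subseteq> U" using sg e by (auto simp: simple_graph_on_def)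
    ultimately have "a \<in> {w \<in> partners F b. {b, w} \<in> E}" using e by (auto simp: partners_def)
    moreover have "card {w \<in> partners F b. {b, w} \<in> E} = 0"
      using card_partners_extension[OF st _ E, of b] b z DU by auto
    moreover have "finite {w \<in> partners F b. {b, w} \<in> E}" by simp
    ultimately show False by (metis (no_types, lifting) card_0_eq empty_iff)
  qed
  have reach: "x \<in> D" if "(x, y) \<in> {(x, y). {x, y} \<in> E}\<^sup>*" "y \<in> D" for x y
    using that(1,1)
  proof (induction rule: converse_rtrancl_induct)
    case base then show ?case using that(2) by simp
  next
    case (step a b)
    then have "{b, a} \<in> F" using noE[of b a] by (auto simp: insert_commute)
    then show ?case using st by (auto simp: state_def simple_graph_on_def)
  qed
  show UD: "U = D" using E reach DU by (auto simp: extensions_def)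
  have "e \<in> F" if "e \<in> E" for e
  proof -
    have "card e = 2" "e \<subseteq> U" using that sg by (auto simp: simple_graph_on_def)
    then obtain a b where "e = {a, b}" by (meson card_2_iff)
    then show ?thesis using noE[of a b] that \<open>e \<subseteq> U\<close> UD by auto
  qed
  then show "E = F" using FE by auto
qed

lemma weight_complete:
  assumes st: "state U F" and z: "\<forall>v\<in>U. res F v = 0"
  shows "weight U F = 1"
proof -
  have "F \<in> extensions U F"
    using st z by (force simp: extensions_def state_def res_def)
  then have "extensions U F = {F}" using no_active_extension[OF st z] by auto
  then show ?thesis using z by (simp add: weight_def)
qed

lemma undisc_all [simp]: "undisc U k = 0"
  by (simp add: undisc_def)

lemma undisc_insert:
  assumes "w \<in> U - D"
  shows "undisc (insert w D) = (undisc D)(d w := undisc D (d w) - 1)"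
proof
  fix k
  have eq: "{v \<in> U - insert w D. d v = k} = {v \<in> U - D. d v = k} - {w}" by auto
  show "undisc (insert w D) k = ((undisc D)(d w := undisc D (d w) - 1)) k"
    unfolding undisc_def eq using assms fin by (auto simp: card_Diff_singleton_if)
qed

lemma undisc_pos:
  assumes "w \<in> U - D" shows "undisc D (d w) > 0"
  unfolding undisc_def using assms fin by (auto simp: card_gt_0_iff)

lemma partners_split:
  assumes "state D F" "v \<in> D"
  shows "partners F v = (U - D) \<union> {w \<in> D. w \<noteq> v \<and> {v, w} \<notin> F}"
    "(U - D) \<inter> {w \<in> D. w \<noteq> v \<and> {v, w} \<notin> F} = {}"
  using assms by (auto simp: partners_def state_def simple_graph_on_def)

lemma weight_rec_split:
  assumes st: "state D F" and v: "v \<in> D" and pos: "res F v > 0"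
  shows "weight D F =
    (\<Sum>w\<in>U-D. d w * weight (insert w D) (insert {v, w} F)) +
    (\<Sum>w\<in>{w \<in> D. w \<noteq> v \<and> {v, w} \<notin> F}. res F w * weight D (insert {v, w} F))"
proof -
  have "finite (U - D)" "finite {w \<in> D. w \<noteq> v \<and> {v, w} \<notin> F}"
    using fin state_finite[OF st] by auto
  then have "weight D F = (\<Sum>w\<in>U-D. res F w * weight (insert w D) (insert {v, w} F)) +
    (\<Sum>w\<in>{w \<in> D. w \<noteq> v \<and> {v, w} \<notin> F}. res F w * weight (insert w D) (insert {v, w} F))"
    unfolding weight_rec[OF st v pos] partners_split(1)[OF st v]
    using partners_split(2)[OF st v] by (rule sum.union_disjoint)
  also have "(\<Sum>w\<in>U-D. res F w * weight (insert w D) (insert {v, w} F)) =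
    (\<Sum>w\<in>U-D. d w * weight (insert w D) (insert {v, w} F))"
    using state_undiscovered(2)[OF st] by (intro sum.cong) auto
  also have "(\<Sum>w\<in>{w \<in> D. w \<noteq> v \<and> {v, w} \<notin> F}. res F w * weight (insert w D) (insert {v, w} F)) =
    (\<Sum>w\<in>{w \<in> D. w \<noteq> v \<and> {v, w} \<notin> F}. res F w * weight D (insert {v, w} F))"
    by (intro sum.cong) (auto simp: insert_absorb)
  finally show ?thesis .
qed

lemma card_step:
  assumes "state D F" "w \<in> partners F v"
  shows "card (insert {v, w} F) = Suc (card F)"
  using assms state_finite[OF assms(1)] by (auto simp: partners_def)

lemma sum_res_step:
  assumes "state D F" "v \<in> D" "w \<in> partners F v" "res F v > 0" "res F w > 0"
  shows "(\<Sum>v\<in>U. res F v) = (\<Sum>x\<in>U. res (insert {v, w} F) x) + 2"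
  using sum_res[OF assms(1)] sum_res[OF state_step[OF assms]] card_step[OF assms(1,3)] by simp

lemma active_step_new:
  assumes "state D F" "v \<in> D" "w \<in> U - D" "res F v > 0" "d w > 0"
  shows "active (insert w D) (insert {v, w} F) + 2 = active D F + d w"
proof -
  have w: "w \<in> partners F v" using partners_split[OF assms(1,2)] assms(3) by auto
  have rw: "res F w > 0" using state_undiscovered(2)[OF assms(1)] assms(3,5) by auto
  have "(\<Sum>v\<in>U-D. d v) = d w + (\<Sum>v\<in>U-insert w D. d v)"
    using sum.remove[of "U - D" w d] assms(3) fin by (simp add: Diff_insert[symmetric])
  then show ?thesis
    using active_eq[OF assms(1)] active_eq[OF state_step[OF assms(1,2) w assms(4) rw]]
      card_step[OF assms(1) w] by simp
qed

lemma active_step_old: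
  assumes "state D F" "v \<in> D" "w \<in> D" "w \<in> partners F v" "res F v > 0" "res F w > 0"
  shows "active D (insert {v, w} F) + 2 = active D F"
  using active_eq[OF assms(1)] active_eq[OF state_step[OF assms(1,2,4,5,6)]]
    card_step[OF assms(1,4)] assms(3) by (simp add: insert_absorb)

text \<open>The tilted model with \<open>e k\<close> additional vertices of degree \<open>k\<close>: an exploration of the
  enlarged configuration model that discovers none of the additional vertices has probability
  at most 1.\<close>

lemma weight_upper:
  assumes K: "finite K" and Y: "(\<Sum>k\<in>K. k * e k) = 2 * Y"
    and st: "state D F" and s: "(\<Sum>v\<in>U. res F v) = 2 * s"
  shows "weight D F * (\<Prod>k\<in>K. (e k + undisc D k) choose undisc D k) * odd_fact Y
    \<le> odd_fact (Y + s)"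
  using st s
proof (induction s arbitrary: D F rule: less_induct)
  case (less s)
  note st = less.prems(1)
  let ?Bin = "\<lambda>D. \<Prod>k\<in>K. (e k + undisc D k) choose undisc D k"
  show ?case
  proof (cases "\<exists>v\<in>D. res F v > 0")
    case False
    then have z: "\<forall>v\<in>D. res F v = 0" by simp
    show ?thesis
    proof (cases "U = D")
      case True
      have "weight D F = 1" using weight_complete[of F] st z True by simp
      moreover have "s = 0" using less.prems(2) z True by simp
      moreover have "?Bin D = 1" unfolding True[symmetric] by simp
      ultimately show ?thesis by simp
    next
      case F2: False
      then have "extensions D F = {}" using no_active_extension(1)[OF st z] by auto
      then show ?thesis by (simp add: weight_def)
    qed
  next
    case True
    then obtain v where v: "v \<in> D" and pos: "res F v > 0" by auto
    have DU: "D \<subseteq> U" using st by (simp add: state_def)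
    have sumU: "(\<Sum>v\<in>U. res F v) = active D F + (\<Sum>v\<in>U-D. d v)"
      using sum_res[OF st] active_eq[OF st] by simp
    have act: "active D F = res F v + (\<Sum>w\<in>D-{v}. res F w)"
      unfolding active_def using v state_finite(2)[OF st] by (rule sum.remove[rotated])
    have "s > 0" using less.prems(2) sumU act pos by simp
    then obtain s' where s': "s = Suc s'" by (cases s) auto
    have IH: "weight (insert w D) (insert {v, w} F) * ?Bin (insert w D) * odd_fact Y \<le> odd_fact (Y + s')"
      if "w \<in> partners F v" "res F w > 0" for w
      using less.IH[of s' "insert w D" "insert {v, w} F"] state_step[OF st v that(1) pos that(2)]
        sum_res_step[OF st v that(1) pos that(2)] less.prems(2) s' by simp
    let ?N = "{w \<in> D. w \<noteq> v \<and> {v, w} \<notin> F}"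
    define o1 where "o1 = real (odd_fact (Y + s'))"
    have scale: "a * (x * b * y) = c * (x * b' * y)" if "a * b = c * b'" for a b c b' x y :: nat
    proof -
      have "a * (x * b * y) = x * (a * b) * y" by simp
      also have "\<dots> = x * (c * b') * y" using that by simp
      finally show ?thesis by simp
    qed
    have old: "real (\<Sum>w\<in>?N. res F w * weight D (insert {v, w} F)) * real (?Bin D) * real (odd_fact Y)
        \<le> (real (active D F) - 1) * o1"
    proof -
      have "(\<Sum>w\<in>?N. res F w * weight D (insert {v, w} F)) * ?Bin D * odd_fact Y =
          (\<Sum>w\<in>?N. res F w * (weight D (insert {v, w} F) * ?Bin D * odd_fact Y))"
        by (simp only: sum_distrib_right mult.assoc)
      also have "\<dots> \<le> (\<Sum>w\<in>?N. res F w * odd_fact (Y + s'))"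
      proof (rule sum_mono)
        fix w assume w: "w \<in> ?N"
        then have wp: "w \<in> partners F v" using partners_split[OF st v] by auto
        show "res F w * (weight D (insert {v, w} F) * ?Bin D * odd_fact Y) \<le> res F w * odd_fact (Y + s')"
        proof (cases "res F w > 0")
          case True
          then show ?thesis using IH[OF wp True] w by (simp add: insert_absorb)
        qed simp
      qed
      also have "\<dots> = (\<Sum>w\<in>?N. res F w) * odd_fact (Y + s')" by (simp add: sum_distrib_right)
      also have "(\<Sum>w\<in>?N. res F w) \<le> (\<Sum>w\<in>D-{v}. res F w)"
        using state_finite(2)[OF st] by (intro sum_mono2) auto
      finally have "(\<Sum>w\<in>?N. res F w * weight D (insert {v, w} F)) * ?Bin D * odd_fact Y
        \<le> (active D F - res F v) * odd_fact (Y + s')" using act by simp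
      then have "real ((\<Sum>w\<in>?N. res F w * weight D (insert {v, w} F)) * ?Bin D * odd_fact Y)
        \<le> real ((active D F - res F v) * odd_fact (Y + s'))" by (rule of_nat_mono)
      also have "\<dots> \<le> (real (active D F) - 1) * o1"
        using act pos unfolding o1_def of_nat_mult by (intro mult_right_mono) auto
      finally show ?thesis by (simp only: of_nat_mult)
    qed
    have new1: "real (weight (insert w D) (insert {v, w} F)) * real (?Bin D) * real (odd_fact Y)
        \<le> (1 + (if d w \<in> K then real (e (d w)) / real (undisc D (d w)) else 0)) * o1"
      if w: "w \<in> U - D" and dw: "d w > 0" for w
    proof -
      let ?W = "weight (insert w D) (insert {v, w} F)"
      have wp: "w \<in> partners F v" using w partners_split[OF st v] by auto
      have rw: "res F w > 0" using state_undiscovered(2)[OF st] w dw by auto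
      note ih = IH[OF wp rw]
      show ?thesis
      proof (cases "d w \<in> K")
        case False
        then have "?Bin (insert w D) = ?Bin D"
          unfolding undisc_insert[OF w] by (intro prod.cong) auto
        with ih have "?W * ?Bin D * odd_fact Y \<le> odd_fact (Y + s')" by simp
        then have "real (?W * ?Bin D * odd_fact Y) \<le> o1" unfolding o1_def by (rule of_nat_mono)
        with False show ?thesis by simp
      next
        case True
        define u where "u = undisc D (d w)"
        have u: "u > 0" using undisc_pos[OF w] by (simp add: u_def)
        define R where "R = (\<Prod>k\<in>K-{d w}. (e k + undisc D k) choose undisc D k)"
        have 1: "?Bin D = ((e (d w) + u) choose u) * R"
          unfolding u_def R_def using prod.remove[OF K True] by simp
        have 2: "?Bin (insert w D) = ((e (d w) + (u - 1)) choose (u - 1)) * R"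
          unfolding prod.remove[OF K True] undisc_insert[OF w] u_def R_def by simp
        \<comment> \<open>Passing from u - 1 to u undiscovered vertices multiplies the binomial by
          (e + u) / u = 1 + e / u; the second term stands for the additional vertices of the same
          degree.\<close>
        have "u * ((e (d w) + u) choose u) = (e (d w) + u) * ((e (d w) + (u - 1)) choose (u - 1))"
          using binomial_absorption[of "u - 1" "e (d w) + u"] u by simp
        then have "u * ?Bin D = (e (d w) + u) * ?Bin (insert w D)"
          unfolding 1 2 by (simp only: mult.assoc[symmetric])
        then have "u * (?W * ?Bin D * odd_fact Y) = (e (d w) + u) * (?W * ?Bin (insert w D) * odd_fact Y)"
          by (rule scale)
        also have "\<dots> \<le> (e (d w) + u) * odd_fact (Y + s')" using ih by (intro mult_left_mono) auto
        finally have "real (u * (?W * ?Bin D * odd_fact Y)) \<le> real ((e (d w) + u) * odd_fact (Y + s'))"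
          by (rule of_nat_mono)
        then have "real (?W * ?Bin D * odd_fact Y) \<le> (real (e (d w)) + real u) * o1 / real u"
        proof -
          define X where "X = ?W * ?Bin D * odd_fact Y"
          assume "real (u * (?W * ?Bin D * odd_fact Y)) \<le> real ((e (d w) + u) * odd_fact (Y + s'))"
          then have "real u * real X \<le> (real (e (d w)) + real u) * o1"
            unfolding X_def[symmetric] o1_def of_nat_mult of_nat_add .
          then show ?thesis using u unfolding X_def[symmetric]
            by (simp add: pos_le_divide_eq mult.commute)
        qed
        also have "\<dots> = (1 + real (e (d w)) / real u) * o1" using u
          by (simp add: add_divide_distrib distrib_right)
        finally show ?thesis using True by (simp add: u_def)
      qed
    qed
    have new: "real (\<Sum>w\<in>U-D. d w * weight (insert w D) (insert {v, w} F)) * real (?Bin D) * real (odd_fact Y)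
        \<le> (real (\<Sum>w\<in>U-D. d w) + 2 * real Y) * o1"
    proof -
      have "real (\<Sum>w\<in>U-D. d w * weight (insert w D) (insert {v, w} F)) * real (?Bin D) * real (odd_fact Y)
        = (\<Sum>w\<in>U-D. real (d w) * (real (weight (insert w D) (insert {v, w} F)) * real (?Bin D) * real (odd_fact Y)))"
        by (simp only: of_nat_sum of_nat_mult sum_distrib_right mult.assoc)
      also have "\<dots> \<le> (\<Sum>w\<in>U-D. real (d w) * ((1 + (if d w \<in> K then real (e (d w)) / real (undisc D (d w)) else 0)) * o1))"
      proof (rule sum_mono)
        fix w assume "w \<in> U - D"
        then show "real (d w) * (real (weight (insert w D) (insert {v, w} F)) * real (?Bin D) * real (odd_fact Y))
          \<le> real (d w) * ((1 + (if d w \<in> K then real (e (d w)) / real (undisc D (d w)) else 0)) * o1)"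
          using new1[of w] by (cases "d w = 0") (auto intro!: mult_left_mono)
      qed
      also have "\<dots> = (real (\<Sum>w\<in>U-D. d w) +
          (\<Sum>w\<in>U-D. if d w \<in> K then real (d w) * (real (e (d w)) / real (undisc D (d w))) else 0)) * o1"
        unfolding sum_distrib_right of_nat_sum sum.distrib[symmetric]
        by (intro sum.cong) (auto simp: algebra_simps)
      also have "(\<Sum>w\<in>U-D. if d w \<in> K then real (d w) * (real (e (d w)) / real (undisc D (d w))) else 0)
          = (\<Sum>w\<in>{w\<in>U-D. d w \<in> K}. real (d w) * (real (e (d w)) / real (undisc D (d w))))"
        using fin by (intro sum.inter_filter[symmetric]) auto
      also have "\<dots> = (\<Sum>k\<in>K. \<Sum>w\<in>{w\<in>{w\<in>U-D. d w \<in> K}. d w = k}. real (d w) * (real (e (d w)) / real (undisc D (d w))))"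
        using fin K by (intro sum.group[symmetric]) auto
      \<comment> \<open>The terms e / u are summed over the u undiscovered vertices of degree k,
        which restores at most the k e half-edges of the additional ones.\<close>
      also have "\<dots> \<le> (\<Sum>k\<in>K. real (k * e k))"
      proof (rule sum_mono)
        fix k assume "k \<in> K"
        then have eq: "{w\<in>{w\<in>U-D. d w \<in> K}. d w = k} = {w\<in>U-D. d w = k}" by auto
        have "(\<Sum>w\<in>{w\<in>{w\<in>U-D. d w \<in> K}. d w = k}. real (d w) * (real (e (d w)) / real (undisc D (d w))))
          = (\<Sum>w\<in>{w\<in>U-D. d w = k}. real k * (real (e k) / real (undisc D k)))"
          unfolding eq by (rule sum.cong) auto
        also have "\<dots> \<le> real (k * e k)"
          by (simp add: undisc_def field_simps)
        finally show "(\<Sum>w\<in>{w\<in>{w\<in>U-D. d w \<in> K}. d w = k}. real (d w) * (real (e (d w)) / real (undisc D (d w)))) \<le> real (k * e k)" .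
      qed
      also have "\<dots> = 2 * real Y" using Y by (metis of_nat_mult of_nat_numeral of_nat_sum)
      finally show ?thesis by (auto simp: o1_def mult_right_mono)
    qed
    have "real (weight D F * ?Bin D * odd_fact Y) \<le> (real (active D F) - 1) * o1 + (real (\<Sum>w\<in>U-D. d w) + 2 * real Y) * o1"
      using add_mono[OF new old] unfolding weight_rec_split[OF st v pos]
      by (simp only: of_nat_mult of_nat_add distrib_right add.commute)
    also have "\<dots> = (real (active D F + (\<Sum>w\<in>U-D. d w)) - 1 + 2 * real Y) * o1" by (simp add: algebra_simps)
    also have "active D F + (\<Sum>w\<in>U-D. d w) = 2 * s" using sumU less.prems(2) by simp
    \<comment> \<open>The factor is 2 (Y + s) - 1, the number of partners of one half-edge among the
      2 (Y + s) half-edges of the enlarged model.\<close>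
    also have "(real (2 * s) - 1 + 2 * real Y) * o1 = real (odd_fact (Y + s))"
      by (simp add: s' o1_def algebra_simps)
    finally show ?thesis by (simp only: of_nat_le_iff)
  qed
qed

text \<open>A half-edge of \<open>v\<close> must avoid the at most \<open>M\<close> remaining
  half-edges of \<open>v\<close> and those of the at most \<open>M\<close> vertices already joined
  to \<open>v\<close>, each with at most \<open>M\<close>: hence \<open>C = M + M * M\<close>. The
  product collects the factors \<open>k * u k\<close> left out of \<open>path_weight\<close>; over a
  complete exploration they multiply to \<open>k ^ u k * fact (u k)\<close>, whatever the
  order.\<close>

lemma weight_lower:
  assumes "C = M + M * M"
    and "state D F" and "(\<Sum>v\<in>U. res F v) = 2 * s"
    and "\<forall>v\<in>D. res F v > 0 \<longrightarrow> d v \<le> M" and "\<forall>v\<in>U-D. 1 \<le> d v \<and> d v \<le> M"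
  shows "(\<Prod>k=1..M. k ^ undisc D k * fact (undisc D k)) * path_weight M C s (active D F) (undisc D)
    \<le> weight D F"
  using assms(2-)
proof (induction s arbitrary: D F)
  case 0
  note st = 0(1)
  have z: "\<forall>v\<in>U. res F v = 0" using 0(2) fin by simp
  show ?case
  proof (cases "U = D")
    case True
    then have "weight D F = 1" using weight_complete st z by simp
    moreover have "undisc D = (\<lambda>_. 0)" unfolding True[symmetric] by auto
    ultimately show ?thesis by simp
  next
    case False
    then obtain w where w: "w \<in> U - D" using st by (auto simp: state_def)
    then have "undisc D (d w) > 0" "d w \<in> {1..M}" using undisc_pos 0(4) by auto
    then have "path_weight M C 0 (active D F) (undisc D) = 0" by auto
    then show ?thesis by simp
  qed
next
  case (Suc s)
  note st = Suc.prems(1)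
  let ?P = "\<lambda>D. \<Prod>k=1..M. k ^ undisc D k * fact (undisc D k) :: nat"
  show ?case
  proof (cases "active D F = 0")
    case False
    then obtain v where v: "v \<in> D" and pos: "res F v > 0"
      unfolding active_def by (metis gr0I sum.neutral)
    have dvM: "d v \<le> M" using Suc.prems(3) v pos by simp
    have fD: "finite D" using state_finite(2)[OF st] .
    have DU: "D \<subseteq> U" using st by (simp add: state_def)
    have old: "?P D * ((active D F - C) * path_weight M C s (active D F - 2) (undisc D))
      \<le> (\<Sum>w\<in>{w \<in> D. w \<noteq> v \<and> {v, w} \<notin> F}. res F w * weight D (insert {v, w} F))" (is "_ \<le> sum _ ?N")
    proof -
      let ?X = "{w \<in> D. w \<noteq> v \<and> {v, w} \<in> F}"
      have "card ?X \<le> card {e \<in> F. v \<in> e}"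
      proof (rule card_inj_on_le[of "\<lambda>w. {v, w}"])
        show "inj_on (\<lambda>w. {v, w}) ?X" by (auto simp: inj_on_def doubleton_eq_iff)
      qed (use state_finite(1)[OF st] in auto)
      also have "\<dots> \<le> d v" using st v DU by (auto simp: state_def vertex_degree_def)
      finally have cX: "card ?X \<le> M" using dvM by simp
      have resM: "res F w \<le> M" if "w \<in> D" for w
      proof (cases "res F w > 0")
        case True
        then have "d w \<le> M" using Suc.prems(3) that by simp
        moreover have "res F w \<le> d w" by (simp add: res_def)
        ultimately show ?thesis by simp
      qed simp
      have "D = insert v (?N \<union> ?X)" using v by auto
      then have "active D F = (\<Sum>w\<in>insert v (?N \<union> ?X). res F w)" unfolding active_def by simp
      also have "\<dots> = res F v + (\<Sum>w\<in>?N \<union> ?X. res F w)" using fD by (subst sum.insert) auto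
      also have "(\<Sum>w\<in>?N \<union> ?X. res F w) = (\<Sum>w\<in>?N. res F w) + (\<Sum>w\<in>?X. res F w)"
        using fD by (intro sum.union_disjoint) auto
      also have "(\<Sum>w\<in>?X. res F w) \<le> card ?X * M"
        using sum_bounded_above[of ?X "res F" M] resM by simp
      also have "card ?X * M \<le> M * M" using cX by simp
      finally have le: "active D F - C \<le> (\<Sum>w\<in>?N. res F w)" using resM[OF v] by (simp add: assms(1))
      have "?P D * ((active D F - C) * path_weight M C s (active D F - 2) (undisc D)) =
          (active D F - C) * (?P D * path_weight M C s (active D F - 2) (undisc D))" by (simp add: mult_ac)
      also have "\<dots> \<le> (\<Sum>w\<in>?N. res F w) * (?P D * path_weight M C s (active D F - 2) (undisc D))"
        using le by (rule mult_right_mono) simp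
      also have "\<dots> = (\<Sum>w\<in>?N. res F w * (?P D * path_weight M C s (active D F - 2) (undisc D)))"
        by (simp add: sum_distrib_right)
      also have "\<dots> \<le> (\<Sum>w\<in>?N. res F w * weight D (insert {v, w} F))"
      proof (rule sum_mono)
        fix w assume w: "w \<in> ?N"
        then have wp: "w \<in> partners F v" using partners_split[OF st v] by auto
        show "res F w * (?P D * path_weight M C s (active D F - 2) (undisc D)) \<le> res F w * weight D (insert {v, w} F)"
        proof (cases "res F w > 0")
          case True
          have wD: "insert w D = D" using w by auto
          have "?P D * path_weight M C s (active D (insert {v, w} F)) (undisc D) \<le> weight D (insert {v, w} F)"
          proof (rule Suc.IH)
            show "state D (insert {v, w} F)" using state_step[OF st v wp pos True] wD by simp
            show "(\<Sum>x\<in>U. res (insert {v, w} F) x) = 2 * s"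
              using sum_res_step[OF st v wp pos True] Suc.prems(2) by simp
            show "\<forall>x\<in>D. 0 < res (insert {v, w} F) x \<longrightarrow> d x \<le> M"
              using Suc.prems(3) res_insert[OF st wp] by auto
          qed (use Suc.prems(4) in auto)
          moreover have "active D (insert {v, w} F) = active D F - 2"
            using active_step_old[OF st v _ wp pos True] w by simp
          ultimately show ?thesis by simp
        qed simp
      qed
      finally show ?thesis .
    qed
    have new: "?P D * (\<Sum>k\<in>{k\<in>{1..M}. undisc D k > 0}. path_weight M C s (active D F + k - 2) ((undisc D)(k := undisc D k - 1)))
      \<le> (\<Sum>w\<in>U-D. d w * weight (insert w D) (insert {v, w} F))"
    proof -
      let ?K = "{k\<in>{1..M}. undisc D k > 0}"
      let ?pw = "\<lambda>k. path_weight M C s (active D F + k - 2) ((undisc D)(k := undisc D k - 1))"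
      have each: "?P D * ?pw (d w) \<le> undisc D (d w) * (d w * weight (insert w D) (insert {v, w} F))"
        if w: "w \<in> U - D" for w
      proof -
        have wp: "w \<in> partners F v" using w partners_split[OF st v] by auto
        have dw: "1 \<le> d w" "d w \<le> M" using Suc.prems(4) w by auto
        have rw: "res F w > 0" using state_undiscovered(2)[OF st] w dw by auto
        have ih: "?P (insert w D) * path_weight M C s (active (insert w D) (insert {v, w} F)) (undisc (insert w D))
            \<le> weight (insert w D) (insert {v, w} F)"
        proof (rule Suc.IH)
          show "state (insert w D) (insert {v, w} F)" using state_step[OF st v wp pos rw] .
          show "(\<Sum>x\<in>U. res (insert {v, w} F) x) = 2 * s"
            using sum_res_step[OF st v wp pos rw] Suc.prems(2) by simp
          show "\<forall>x\<in>insert w D. 0 < res (insert {v, w} F) x \<longrightarrow> d x \<le> M"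
            using Suc.prems(3) res_insert[OF st wp] dw by auto
        qed (use Suc.prems(4) in auto)
        have act: "active (insert w D) (insert {v, w} F) = active D F + d w - 2"
          using active_step_new[OF st v w pos] dw by simp
        define u where "u = undisc D (d w)"
        have u: "u > 0" using undisc_pos[OF w] by (simp add: u_def)
        define R where "R = (\<Prod>k\<in>{1..M}-{d w}. k ^ undisc D k * fact (undisc D k) :: nat)"
        have dwM: "d w \<in> {1..M}" using dw by simp
        have 1: "?P D = (d w ^ u * fact u) * R"
          unfolding u_def R_def using prod.remove[OF _ dwM] by simp
        have 2: "?P (insert w D) = (d w ^ (u - 1) * fact (u - 1)) * R"
          unfolding prod.remove[OF finite_atLeastAtMost dwM] undisc_insert[OF w] u_def R_def by simp
        have "d w ^ u * fact u = u * d w * (d w ^ (u - 1) * fact (u - 1))"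
          using u by (simp add: power_eq_if[of "d w" u] fact_reduce[of u])
        then have "?P D = u * d w * ?P (insert w D)" unfolding 1 2 by (simp add: mult_ac)
        then have "?P D * ?pw (d w) = u * d w * (?P (insert w D) * ?pw (d w))" by (simp add: mult_ac)
        also have "\<dots> \<le> u * d w * weight (insert w D) (insert {v, w} F)"
          using ih unfolding act undisc_insert[OF w] by (intro mult_left_mono) auto
        finally show ?thesis by (simp add: u_def mult_ac)
      qed
      \<comment> \<open>The left side of \<open>each\<close> depends on \<open>w\<close> only
        through its degree; summing over the class of degree k and cancelling the class size leaves
        one term per degree.\<close>
      have "?P D * ?pw k \<le> (\<Sum>w\<in>{w\<in>U-D. d w = k}. d w * weight (insert w D) (insert {v, w} F))"
        if k: "k \<in> ?K" for k
      proof -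
        let ?V = "{w\<in>U-D. d w = k}"
        have "(\<Sum>w\<in>?V. ?P D * ?pw (d w)) = (\<Sum>w\<in>?V. ?P D * ?pw k)"
          by (rule sum.cong) auto
        then have "undisc D k * (?P D * ?pw k) = (\<Sum>w\<in>?V. ?P D * ?pw (d w))"
          using undisc_def[of D k] by (simp only: sum_constant of_nat_id)
        also have "\<dots> \<le> (\<Sum>w\<in>?V. undisc D (d w) * (d w * weight (insert w D) (insert {v, w} F)))"
          using each by (intro sum_mono) auto
        also have "\<dots> = undisc D k * (\<Sum>w\<in>?V. d w * weight (insert w D) (insert {v, w} F))"
          unfolding sum_distrib_left by (rule sum.cong) auto
        finally show ?thesis using k by simp
      qed
      then have "?P D * (\<Sum>k\<in>?K. ?pw k) \<le>
          (\<Sum>k\<in>?K. \<Sum>w\<in>{w\<in>U-D. d w = k}. d w * weight (insert w D) (insert {v, w} F))"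
        unfolding sum_distrib_left by (rule sum_mono)
      also have "\<dots> = (\<Sum>w\<in>U-D. d w * weight (insert w D) (insert {v, w} F))"
        using fin Suc.prems(4) undisc_pos by (intro sum.group) auto
      finally show ?thesis .
    qed
    show ?thesis
      using add_mono[OF new old] False unfolding weight_rec_split[OF st v pos]
      by (simp add: distrib_left)
  qed simp
qed

text \<open>Follow only those orders whose next \<open>q\<close> steps discover vertices of the
  reserved set \<open>T\<close>: there are card T, card T - 1, ... choices in turn, with at least
  \<open>\<kappa>\<close> half-edges each. Half-edges of \<open>P\<close> are spent first, so that a
  large \<open>q\<close> leaves none there. The disjunction keeps the exploration alive: a vertex of
  degree at least 2 never lowers the number of active half-edges, a leaf lowers it by one. The
  factorial of \<open>card T - q\<close> stands on the right to avoid division.\<close>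

lemma weight_discover:
  assumes "state D F" and "T \<subseteq> U - D" and "P \<subseteq> D" and "\<forall>w\<in>T. \<kappa> \<le> d w" and "q \<le> card T"
    and "(2 \<le> \<kappa> \<and> 1 \<le> active D F) \<or> (1 \<le> \<kappa> \<and> q \<le> active D F)"
    and "\<And>D' F'. state D' F' \<Longrightarrow> D \<subseteq> D' \<Longrightarrow> D' \<subseteq> D \<union> T \<Longrightarrow> card D' = card D + q \<Longrightarrow>
        card F' = card F + q \<Longrightarrow> (\<Sum>v\<in>P. res F' v) \<le> (\<Sum>v\<in>P. res F v) - q \<Longrightarrow> B \<le> weight D' F'"
  shows "\<kappa> ^ q * fact (card T) * B \<le> weight D F * fact (card T - q)"
  using assms
proof (induction q arbitrary: D F T)
  case 0
  have "B \<le> weight D F" using 0(1) by (intro 0(7)) auto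
  then show ?case by simp
next
  case (Suc q)
  note st = Suc.prems(1) and TU = Suc.prems(2) and PD = Suc.prems(3)
  have fD: "finite D" using state_finite(2)[OF st] .
  have fT: "finite T" using TU fin finite_subset by blast
  have "active D F > 0" using Suc.prems(6) by auto
  then have ex: "\<exists>v\<in>D. res F v > 0" unfolding active_def by (metis gr0I less_irrefl sum.neutral)
  \<comment> \<open>When \<open>P\<close> is exhausted any active vertex will do, since the
    truncated bound on the half-edges of \<open>P\<close> is then 0.\<close>
  obtain v where v: "v \<in> D" and pos: "res F v > 0" and pr: "v \<in> P \<or> (\<Sum>x\<in>P. res F x) = 0"
  proof (cases "\<exists>v\<in>P. res F v > 0")
    case True
    then show ?thesis using that PD by auto
  next
    case False
    then show ?thesis using that ex by (metis gr0I sum.neutral)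
  qed
  define t where "t = card T"
  have each: "\<kappa> ^ q * fact (t - 1) * B \<le> weight (insert w D) (insert {v, w} F) * fact (t - Suc q)"
    if w: "w \<in> T" for w
  proof -
    have wU: "w \<in> U - D" using w TU by auto
    have wp: "w \<in> partners F v" using wU partners_split[OF st v] by auto
    have dw: "d w \<ge> \<kappa>" "d w \<ge> 1" using w Suc.prems(4,6) by auto
    have rw: "res F w > 0" using state_undiscovered(2)[OF st] wU dw by auto
    have act: "active (insert w D) (insert {v, w} F) + 2 = active D F + d w"
      using active_step_new[OF st v wU pos] dw by simp
    have cT: "card (T - {w}) = t - 1" using w fT by (simp add: t_def)
    have Pw: "(\<Sum>x\<in>P. res (insert {v, w} F) x) \<le> (\<Sum>x\<in>P. res F x) - 1"
    proof (cases "v \<in> P")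
      case True
      have fP: "finite P" using PD fD finite_subset by blast
      have "(\<Sum>x\<in>P-{v}. res (insert {v, w} F) x) \<le> (\<Sum>x\<in>P-{v}. res F x)"
        using res_insert[OF st wp] by (intro sum_mono) auto
      moreover have "res (insert {v, w} F) v = res F v - 1" using res_insert[OF st wp] by simp
      ultimately show ?thesis using pos unfolding sum.remove[OF fP True] by simp
    next
      case False
      then have z: "(\<Sum>x\<in>P. res F x) = 0" using pr by simp
      have "(\<Sum>x\<in>P. res (insert {v, w} F) x) \<le> (\<Sum>x\<in>P. res F x)"
        using res_insert[OF st wp] by (intro sum_mono) auto
      then show ?thesis using z by simp
    qed
    have "\<kappa> ^ q * fact (card (T - {w})) * B \<le> weight (insert w D) (insert {v, w} F) * fact (card (T - {w}) - q)"
    proof (rule Suc.IH)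
      show "state (insert w D) (insert {v, w} F)" using state_step[OF st v wp pos rw] .
      show "T - {w} \<subseteq> U - insert w D" using TU by auto
      show "P \<subseteq> insert w D" using PD by auto
      show "\<forall>w\<in>T - {w}. \<kappa> \<le> d w" using Suc.prems(4) by auto
      show "q \<le> card (T - {w})" using Suc.prems(5) cT t_def by simp
      show "2 \<le> \<kappa> \<and> 1 \<le> active (insert w D) (insert {v, w} F) \<or> 1 \<le> \<kappa> \<and> q \<le> active (insert w D) (insert {v, w} F)"
        using Suc.prems(6) act dw by auto
      fix D' F'
      assume a: "state D' F'" "insert w D \<subseteq> D'" "D' \<subseteq> insert w D \<union> (T - {w})"
        "card D' = card (insert w D) + q" "card F' = card (insert {v, w} F) + q"
        "sum (res F') P \<le> sum (res (insert {v, w} F)) P - q"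
      show "B \<le> weight D' F'"
      proof (rule Suc.prems(7))
        show "D' \<subseteq> D \<union> T" using a(3) w by auto
        show "card D' = card D + Suc q" using a(4) wU fD by simp
        show "card F' = card F + Suc q" using a(5) card_step[OF st wp] by simp
        show "sum (res F') P \<le> sum (res F) P - Suc q" using a(6) Pw by simp
      qed (use a in auto)
    qed
    moreover have "t - 1 - q = t - Suc q" by simp
    ultimately show ?thesis unfolding cT by simp
  qed
  have t: "t > 0" using Suc.prems(5) t_def by simp
  have ft: "fact t = t * (fact (t - 1) :: nat)" using t by (cases t) auto
  have "\<kappa> ^ Suc q * fact t * B = (\<Sum>w\<in>T. \<kappa> * (\<kappa> ^ q * fact (t - 1) * B))"
    using ft by (simp add: t_def mult_ac)
  also have "\<dots> \<le> (\<Sum>w\<in>T. d w * (weight (insert w D) (insert {v, w} F) * fact (t - Suc q)))"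
  proof (rule sum_mono)
    fix w assume "w \<in> T"
    then show "\<kappa> * (\<kappa> ^ q * fact (t - 1) * B)
      \<le> d w * (weight (insert w D) (insert {v, w} F) * fact (t - Suc q))"
      using mult_le_mono[OF _ each[of w], of \<kappa> "d w"] Suc.prems(4) by auto
  qed
  also have "\<dots> \<le> (\<Sum>w\<in>U-D. d w * (weight (insert w D) (insert {v, w} F) * fact (t - Suc q)))"
    using TU fin by (intro sum_mono2) auto
  also have "\<dots> = (\<Sum>w\<in>U-D. d w * weight (insert w D) (insert {v, w} F)) * fact (t - Suc q)"
    by (simp only: sum_distrib_right mult.assoc)
  also have "\<dots> \<le> weight D F * fact (t - Suc q)"
    unfolding weight_rec_split[OF st v pos] by (intro mult_right_mono) auto
  finally show ?case by (simp add: t_def)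
qed

end

section \<open>Weighted exploration paths\<close>

lemma path_weight_cong:
  "(\<And>k. k \<in> {1..M} \<Longrightarrow> u k = u' k) \<Longrightarrow> path_weight M C s A u = path_weight M C s A u'"
proof (induction s arbitrary: A u u')
  case (Suc s)
  have "path_weight M C s B (u(k := u k - 1)) = path_weight M C s B (u'(k := u' k - 1))" if "k \<in> {1..M}" for B k
    using Suc.prems that by (intro Suc.IH) auto
  moreover have "{k \<in> {1..M}. u k > 0} = {k \<in> {1..M}. u' k > 0}" using Suc.prems by auto
  moreover have "path_weight M C s (A - 2) u = path_weight M C s (A - 2) u'" using Suc.prems by (intro Suc.IH) auto
  ultimately show ?case by simp
qed auto

lemma sum_decrement:
  fixes f c :: "nat \<Rightarrow> nat"
  assumes "k \<in> {1..M}" "c k > 0"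
  shows "(\<Sum>i=1..M. f i * c i) = f k + (\<Sum>i=1..M. f i * (c(k := c k - 1)) i)"
proof -
  have "(\<Sum>i\<in>{1..M}-{k}. f i * c i) = (\<Sum>i\<in>{1..M}-{k}. f i * (c(k := c k - 1)) i)"
    by (rule sum.cong) auto
  moreover have "f k * c k = f k + f k * (c k - 1)" using assms by (cases "c k") auto
  ultimately show ?thesis
    using sum.remove[OF finite_atLeastAtMost assms(1), of "\<lambda>i. f i * c i"]
      sum.remove[OF finite_atLeastAtMost assms(1), of "\<lambda>i. f i * (c(k := c k - 1)) i"] by simp
qed

text \<open>Degrees of at least 2 keep the number of active half-edges positive, so the whole batch
  can be discovered in any order. A single order is kept; the entropy lost is small because this is
  applied to surplus vertices only.\<close>

lemma path_weight_discover:
  assumes "\<forall>k\<in>{1..M}. c k \<le> u k" and "\<forall>k\<in>{1..M}. c k > 0 \<longrightarrow> 2 \<le> k" and "1 \<le> A"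
    and "N = (\<Sum>k=1..M. c k)"
  shows "path_weight M C s (A + (\<Sum>k=1..M. k * c k) - 2 * N) (\<lambda>k. u k - c k) \<le> path_weight M C (s + N) A u"
  using assms
proof (induction N arbitrary: A u c)
  case 0
  then have "\<forall>k\<in>{1..M}. c k = 0" by simp
  then have "path_weight M C s A (\<lambda>k. u k - c k) = path_weight M C s A u"
    by (intro path_weight_cong) auto
  moreover have "(\<Sum>k=1..M. k * c k) = 0" using 0 by simp
  ultimately show ?case using 0 by simp
next
  case (Suc N)
  then obtain k where k: "k \<in> {1..M}" "c k > 0" by (metis gr0I sum.neutral nat.distinct(1))
  define c' u' where "c' = c(k := c k - 1)" and "u' = u(k := u k - 1)"
  have k2: "2 \<le> k" using k Suc.prems by simp
  have uk: "u k > 0" using k Suc.prems(1) by (metis gr_zeroI leD)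
  have remN: "(\<Sum>i=1..M. f i * c i) = f k + (\<Sum>i=1..M. f i * c' i)" for f
    unfolding c'_def using k by (rule sum_decrement)
  have N: "N = (\<Sum>k=1..M. c' k)" using Suc.prems(4) remN[of "\<lambda>_. 1"] by simp
  have "path_weight M C s ((A + k - 2) + (\<Sum>k=1..M. k * c' k) - 2 * N) (\<lambda>k. u' k - c' k)
      \<le> path_weight M C (s + N) (A + k - 2) u'"
  proof (rule Suc.IH)
    show "\<forall>k\<in>{1..M}. c' k \<le> u' k" using Suc.prems(1) k by (auto simp: c'_def u'_def intro!: diff_le_mono)
    show "\<forall>k\<in>{1..M}. c' k > 0 \<longrightarrow> 2 \<le> k" using Suc.prems(2) k by (auto simp: c'_def)
  qed (use Suc.prems(3) k2 N in auto)
  also have "\<dots> \<le> (\<Sum>k\<in>{k\<in>{1..M}. u k > 0}. path_weight M C (s + N) (A + k - 2) (u(k := u k - 1)))"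
    unfolding u'_def by (rule member_le_sum) (use k uk in auto)
  also have "\<dots> \<le> path_weight M C (s + Suc N) A u" using Suc.prems(3) by simp
  also have "(\<lambda>i. u' i - c' i) = (\<lambda>i. u i - c i)" using k by (auto simp: u'_def c'_def)
  also have "A + k - 2 + (\<Sum>k=1..M. k * c' k) - 2 * N = A + (\<Sum>k=1..M. k * c k) - 2 * Suc N"
    using remN[of "\<lambda>k. k"] k2 by simp
  finally show ?case .
qed

text \<open>Matching a leaf gains one half-edge and uses two, so \<open>n\<close> active half-edges
  and \<open>n\<close> leaves run out together.\<close>

lemma path_weight_leaves:
  assumes "1 \<le> M" "u 1 = n" "\<forall>k\<in>{2..M}. u k = 0"
  shows "1 \<le> path_weight M C n n u"
  using assms
proof (induction n arbitrary: u)
  case 0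
  have "u k = 0" if "k \<in> {1..M}" for k using 0 that by (cases "k = 1") auto
  then show ?case by simp
next
  case (Suc n)
  have "1 \<le> path_weight M C n n (u(1 := n))" using Suc.prems by (intro Suc.IH) auto
  also have "\<dots> = path_weight M C n (Suc n + 1 - 2) (u(1 := u 1 - 1))" using Suc.prems by simp
  also have "\<dots> \<le> (\<Sum>k\<in>{k\<in>{1..M}. u k > 0}. path_weight M C n (Suc n + k - 2) (u(k := u k - 1)))"
    using Suc.prems by (intro member_le_sum) auto
  also have "\<dots> \<le> path_weight M C (Suc n) (Suc n) u" by simp
  finally show ?case .
qed

text \<open>When i steps are left there are \<open>A + 2 * i\<close> active half-edges, of which at
  least \<open>2 * i\<close> are admissible because \<open>C \<le> A\<close>.\<close>

lemma path_weight_back: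
  assumes "C \<le> A"
  shows "2 ^ b * fact b * path_weight M C s A u \<le> path_weight M C (s + b) (A + 2 * b) u"
proof (induction b)
  case (Suc b)
  have "2 ^ Suc b * fact (Suc b) * path_weight M C s A u =
      (2 * Suc b) * (2 ^ b * fact b * path_weight M C s A u)" by (simp add: algebra_simps)
  also have "\<dots> \<le> (A + 2 * Suc b - C) * path_weight M C (s + b) (A + 2 * b) u"
    using Suc assms by (intro mult_mono) auto
  also have "\<dots> \<le> path_weight M C (s + Suc b) (A + 2 * Suc b) u" by simp
  finally show ?case .
qed simp

text \<open>By Pascal's rule for multinomial coefficients, a block contributes the number of orderings of
  its steps.\<close>

lemma path_weight_block:
  assumes "\<forall>k\<in>{1..M}. c k \<le> u k" and "N = (\<Sum>k=1..M. c k) + b" and "2 * N + C + a \<le> A" and "1 \<le> C"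
  shows "fact N * a ^ b * path_weight M C s (A + (\<Sum>k=1..M. k * c k) - 2 * N) (\<lambda>k. u k - c k)
    \<le> (\<Prod>k=1..M. fact (c k)) * fact b * path_weight M C (s + N) A u"
  using assms
proof (induction N arbitrary: A u c b)
  case 0
  then have c0: "\<forall>k\<in>{1..M}. c k = 0" and "b = 0" by simp_all
  moreover have "path_weight M C s A (\<lambda>k. u k - c k) \<le> path_weight M C s A u"
    using c0 by (intro eq_refl path_weight_cong) auto
  moreover have "(\<Sum>k=1..M. k * c k) = 0" using c0 by simp
  ultimately show ?case using c0 by simp
next
  case (Suc N)
  let ?f = "\<lambda>c. \<Prod>k=1..M. fact (c k) :: nat"
  define A' where "A' = A + (\<Sum>k=1..M. k * c k) - 2 * Suc N"
  define X where "X = path_weight M C s A' (\<lambda>k. u k - c k)"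
  have disc: "c k * (fact N * a ^ b * X) \<le> ?f c * fact b * path_weight M C (s + N) (A + k - 2) (u(k := u k - 1))"
    if k: "k \<in> {1..M}" "c k > 0" for k
  proof -
    define c' u' where "c' = c(k := c k - 1)" and "u' = u(k := u k - 1)"
    have remN: "(\<Sum>i=1..M. f i * c i) = f k + (\<Sum>i=1..M. f i * c' i)" for f
      unfolding c'_def using k by (rule sum_decrement)
    have fc: "?f c = c k * ?f c'"
    proof -
      have "(\<Prod>i\<in>{1..M}-{k}. fact (c i)) = (\<Prod>i\<in>{1..M}-{k}. fact (c' i) :: nat)"
        by (rule prod.cong) (auto simp: c'_def)
      moreover have "fact (c k) = c k * (fact (c' k) :: nat)" using k by (cases "c k") (auto simp: c'_def)
      ultimately show ?thesis
        using prod.remove[OF finite_atLeastAtMost k(1), of "\<lambda>i. fact (c i) :: nat"]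
          prod.remove[OF finite_atLeastAtMost k(1), of "\<lambda>i. fact (c' i) :: nat"] by simp
    qed
    have "fact N * a ^ b * path_weight M C s ((A + k - 2) + (\<Sum>k=1..M. k * c' k) - 2 * N) (\<lambda>k. u' k - c' k)
      \<le> ?f c' * fact b * path_weight M C (s + N) (A + k - 2) u'"
    proof (rule Suc.IH)
      show "\<forall>k\<in>{1..M}. c' k \<le> u' k" using Suc.prems(1) k by (auto simp: c'_def u'_def intro!: diff_le_mono)
      show "N = (\<Sum>k=1..M. c' k) + b" using Suc.prems(2) remN[of "\<lambda>_. 1"] by simp
      \<comment> \<open>A step costs at most two active half-edges, so the reserve of two per step
        keeps at least \<open>a\<close> admissible targets throughout the block.\<close>
      show "2 * N + C + a \<le> A + k - 2" using Suc.prems(3) k by simp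
    qed (use Suc.prems(4) in auto)
    moreover have "(\<lambda>i. u' i - c' i) = (\<lambda>i. u i - c i)" using k by (auto simp: u'_def c'_def)
    moreover have "(A + k - 2) + (\<Sum>k=1..M. k * c' k) - 2 * N = A'"
      using remN[of "\<lambda>k. k"] k Suc.prems(3) by (simp add: A'_def)
    ultimately have "fact N * a ^ b * X \<le> ?f c' * fact b * path_weight M C (s + N) (A + k - 2) u'"
      by (simp add: X_def)
    then have "c k * (fact N * a ^ b * X) \<le> c k * (?f c' * fact b * path_weight M C (s + N) (A + k - 2) u')"
      by (rule mult_left_mono) simp
    then show ?thesis by (simp only: fc u'_def mult.assoc)
  qed
  have back_step: "b * (fact N * a ^ b * X) \<le> ?f c * fact b * ((A - C) * path_weight M C (s + N) (A - 2) u)"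
  proof (cases b)
    case (Suc b')
    have "fact N * a ^ b' * path_weight M C s ((A - 2) + (\<Sum>k=1..M. k * c k) - 2 * N) (\<lambda>k. u k - c k)
      \<le> ?f c * fact b' * path_weight M C (s + N) (A - 2) u"
      using Suc.prems Suc by (intro Suc.IH) auto
    moreover have "(A - 2) + (\<Sum>k=1..M. k * c k) - 2 * N = A'" using Suc.prems(3) by (simp add: A'_def)
    ultimately have *: "fact N * a ^ b' * X \<le> ?f c * fact b' * path_weight M C (s + N) (A - 2) u"
      by (simp add: X_def)
    have "b * (fact N * a ^ b * X) = (b * a) * (fact N * a ^ b' * X)" by (simp add: Suc algebra_simps)
    also have "\<dots> \<le> (b * (A - C)) * (?f c * fact b' * path_weight M C (s + N) (A - 2) u)"
      using Suc.prems(3) by (intro mult_le_mono[OF _ *]) auto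
    also have "\<dots> = ?f c * fact b * ((A - C) * path_weight M C (s + N) (A - 2) u)" by (simp add: Suc algebra_simps)
    finally show ?thesis .
  qed simp
  \<comment> \<open>Distributing (N + 1)! according to N + 1 = sum c_k + b classifies the orderings
    by their first step.\<close>
  have split: "fact (Suc N) * a ^ b * X = (\<Sum>k=1..M. c k * (fact N * a ^ b * X)) + b * (fact N * a ^ b * X)"
    unfolding sum_distrib_right[symmetric] distrib_right[symmetric] Suc.prems(2)[symmetric] fact_Suc
    by (simp only: of_nat_id mult.assoc)
  define g where "g k = path_weight M C (s + N) (A + k - 2) (u(k := u k - 1))" for k
  define t where "t = fact N * a ^ b * X"
  define r where "r = ?f c * fact b"
  have "(\<Sum>k=1..M. c k * t) = (\<Sum>k\<in>{k\<in>{1..M}. c k > 0}. c k * t)"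
    by (rule sum.mono_neutral_right) auto
  also have "\<dots> \<le> (\<Sum>k\<in>{k\<in>{1..M}. c k > 0}. r * g k)"
  proof (rule sum_mono)
    fix k assume "k \<in> {k\<in>{1..M}. c k > 0}"
    then have "k \<in> {1..M}" "c k > 0" by simp_all
    then show "c k * t \<le> r * g k" unfolding g_def t_def r_def by (rule disc)
  qed
  also have "\<dots> \<le> (\<Sum>k\<in>{k\<in>{1..M}. u k > 0}. r * g k)"
  proof (rule sum_mono2)
    show "{k\<in>{1..M}. c k > 0} \<subseteq> {k\<in>{1..M}. u k > 0}"
    proof
      fix k assume "k \<in> {k\<in>{1..M}. c k > 0}"
      then have "k \<in> {1..M}" "c k > 0" "c k \<le> u k" using bspec[OF Suc.prems(1), of k] by simp_all
      then show "k \<in> {k\<in>{1..M}. u k > 0}" by simp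
    qed
  qed auto
  also have "\<dots> = r * (\<Sum>k\<in>{k\<in>{1..M}. u k > 0}. g k)"
    by (rule sum_distrib_left[symmetric])
  finally have "(\<Sum>k=1..M. c k * (fact N * a ^ b * X)) \<le>
    ?f c * fact b * (\<Sum>k\<in>{k\<in>{1..M}. u k > 0}. path_weight M C (s + N) (A + k - 2) (u(k := u k - 1)))"
    unfolding g_def t_def r_def .
  then have "fact (Suc N) * a ^ b * X \<le>
      ?f c * fact b * (\<Sum>k\<in>{k\<in>{1..M}. u k > 0}. path_weight M C (s + N) (A + k - 2) (u(k := u k - 1)))
      + ?f c * fact b * ((A - C) * path_weight M C (s + N) (A - 2) u)"
    unfolding split using back_step by (rule add_mono)
  then have "fact (Suc N) * a ^ b * X \<le> ?f c * fact b * path_weight M C (s + Suc N) A u"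
  proof -
    have "path_weight M C (s + Suc N) A u = (\<Sum>k\<in>{k\<in>{1..M}. u k > 0}. path_weight M C (s + N) (A + k - 2) (u(k := u k - 1)))
      + (A - C) * path_weight M C (s + N) (A - 2) u"
      using Suc.prems(3) by simp
    moreover assume "fact (Suc N) * a ^ b * X \<le>
      ?f c * fact b * (\<Sum>k\<in>{k\<in>{1..M}. u k > 0}. path_weight M C (s + N) (A + k - 2) (u(k := u k - 1)))
      + ?f c * fact b * ((A - C) * path_weight M C (s + N) (A - 2) u)"
    ultimately show ?thesis by (simp only: distrib_left)
  qed
  then show ?case unfolding X_def A'_def .
qed

text \<open>Blocks are appended at the end, so the induction hypothesis is used with
  \<open>N J\<close> more steps remaining. Keeping factorials on both sides stays within the natural
  numbers.\<close>

lemma path_weight_blocks: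
  assumes "\<And>j. j < J \<Longrightarrow> N j = (\<Sum>k=1..M. c j k) + b j"
    and "\<And>j. j < J \<Longrightarrow> 2 * N j + C + a j \<le> A j"
    and "\<And>j. j < J \<Longrightarrow> A (Suc j) + 2 * N j = A j + (\<Sum>k=1..M. k * c j k)"
    and "\<And>k. k \<in> {1..M} \<Longrightarrow> (\<Sum>j<J. c j k) \<le> u k" and "1 \<le> C"
  shows "(\<Prod>j<J. fact (N j) * a j ^ b j) * path_weight M C s (A J) (\<lambda>k. u k - (\<Sum>j<J. c j k))
    \<le> (\<Prod>j<J. (\<Prod>k=1..M. fact (c j k)) * fact (b j)) * path_weight M C (s + (\<Sum>j<J. N j)) (A 0) u"
  using assms
proof (induction J arbitrary: s)
  case (Suc J)
  define u' where "u' = (\<lambda>k. u k - (\<Sum>j<J. c j k))"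
  define p q where "p = (\<Prod>j<J. fact (N j) * a j ^ b j)" and "q = (\<Prod>j<J. (\<Prod>k=1..M. fact (c j k)) * fact (b j) :: nat)"
  have "p * path_weight M C (s + N J) (A J) u' \<le> q * path_weight M C (s + N J + (\<Sum>j<J. N j)) (A 0) u"
    unfolding p_def q_def u'_def
  proof (rule Suc.IH)
    fix k assume "k \<in> {1..M}"
    then have "(\<Sum>j<J. c j k) + c J k \<le> u k" using Suc.prems(4) by simp
    then show "(\<Sum>j<J. c j k) \<le> u k" by simp
  qed (use Suc.prems in auto)
  then have 1: "p * path_weight M C (s + N J) (A J) u' \<le> q * path_weight M C (s + (\<Sum>j<Suc J. N j)) (A 0) u"
    by (simp add: add.assoc add.commute[of "N J"])
  have "fact (N J) * a J ^ b J * path_weight M C s (A J + (\<Sum>k=1..M. k * c J k) - 2 * N J) (\<lambda>k. u' k - c J k)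
    \<le> (\<Prod>k=1..M. fact (c J k)) * fact (b J) * path_weight M C (s + N J) (A J) u'"
  proof (rule path_weight_block)
    show "\<forall>k\<in>{1..M}. c J k \<le> u' k"
    proof
      fix k assume "k \<in> {1..M}"
      then have "(\<Sum>j<J. c j k) + c J k \<le> u k" using Suc.prems(4) by simp
      then show "c J k \<le> u' k" by (simp add: u'_def)
    qed
  qed (use Suc.prems in auto)
  moreover have "A J + (\<Sum>k=1..M. k * c J k) - 2 * N J = A (Suc J)" using Suc.prems(3)[of J] by simp
  moreover have "(\<lambda>k. u' k - c J k) = (\<lambda>k. u k - (\<Sum>j<Suc J. c j k))" by (auto simp: u'_def)
  ultimately have 2: "fact (N J) * a J ^ b J * path_weight M C s (A (Suc J)) (\<lambda>k. u k - (\<Sum>j<Suc J. c j k))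
    \<le> (\<Prod>k=1..M. fact (c J k)) * fact (b J) * path_weight M C (s + N J) (A J) u'" by simp
  have "p * (fact (N J) * a J ^ b J * path_weight M C s (A (Suc J)) (\<lambda>k. u k - (\<Sum>j<Suc J. c j k)))
    \<le> p * ((\<Prod>k=1..M. fact (c J k)) * fact (b J) * path_weight M C (s + N J) (A J) u')"
    using 2 by (rule mult_left_mono) simp
  also have "\<dots> = (\<Prod>k=1..M. fact (c J k)) * fact (b J) * (p * path_weight M C (s + N J) (A J) u')"
    by (simp only: mult_ac)
  also have "\<dots> \<le> (\<Prod>k=1..M. fact (c J k)) * fact (b J) * (q * path_weight M C (s + (\<Sum>j<Suc J. N j)) (A 0) u)"
    using 1 by (rule mult_left_mono) simp
  also have "\<dots> = (\<Prod>j<Suc J. (\<Prod>k=1..M. fact (c j k)) * fact (b j)) *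
      path_weight M C (s + (\<Sum>j<Suc J. N j)) (A 0) u"
    unfolding q_def by (simp only: prod.lessThan_Suc mult_ac)
  also have "p * (fact (N J) * a J ^ b J * path_weight M C s (A (Suc J)) (\<lambda>k. u k - (\<Sum>j<Suc J. c j k))) =
      (\<Prod>j<Suc J. fact (N j) * a j ^ b j) * path_weight M C s (A (Suc J)) (\<lambda>k. u k - (\<Sum>j<Suc J. c j k))"
    unfolding p_def by (simp only: prod.lessThan_Suc mult.assoc)
  finally show ?case .
qed simp

section \<open>Lower bounds for all graphs and for connected graphs\<close>

context exploration
begin

lemma weight_mono: "D \<subseteq> D' \<Longrightarrow> weight D F \<le> weight D' F"
proof -
  assume "D \<subseteq> D'"
  then have "extensions D F \<subseteq> extensions D' F" unfolding extensions_def by blast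
  then show ?thesis
    unfolding weight_def using finite_extensions by (intro mult_right_mono card_mono) auto
qed

lemma state_empty: "D \<subseteq> U \<Longrightarrow> state D {}"
  by (auto simp: state_def simple_graph_on_def vertex_degree_def)

lemma res_empty [simp]: "res {} v = d v"
  by (simp add: res_def vertex_degree_def)

lemma sum_undiscovered:
  assumes "\<forall>v\<in>U-D. 1 \<le> d v \<and> d v \<le> M"
  shows "(\<Sum>v\<in>U-D. d v) = (\<Sum>k=1..M. k * undisc D k)"
proof -
  have "(\<Sum>v\<in>U-D. d v) = (\<Sum>k=1..M. \<Sum>v\<in>{v\<in>U-D. d v = k}. d v)"
    using assms fin by (intro sum.group[symmetric]) auto
  also have "\<dots> = (\<Sum>k=1..M. k * undisc D k)"
    unfolding undisc_def by (intro sum.cong) auto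
  finally show ?thesis .
qed

text \<open>All vertices outside a set \<open>T\<close> of leaves count as discovered from the
  start, which is allowed because connectivity is not asked for. \<open>H\<close> leaves exhaust the
  vertices of degree above \<open>M\<close>; then \<open>b\<close> cycles are closed among vertices
  of bounded degree; the other leaves match what is left. These last half-edges, at least
  \<open>C\<close> of them, are what keeps loops and multiple edges avoidable.\<close>

lemma weight_all_lower:
  assumes T: "T \<subseteq> U" "\<forall>v\<in>T. d v = 1" and M: "1 \<le> M"
    and H: "(\<Sum>v\<in>{v\<in>U. d v > M}. d v) = H" and C: "C = M + M * M" and HC: "H + C \<le> card T"
    and s: "(\<Sum>v\<in>U. d v) = 2 * (b + card T)"
  shows "fact (card T) * 2 ^ b * fact b \<le> weight U {}"
proof -
  let ?P = "{v\<in>U. d v > M}"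
  define L where "L = card T - H"
  have PT: "?P \<subseteq> U - T" using T M by auto
  have fT: "finite T" using T fin finite_subset by blast
  have act0: "active (U - T) {} = (\<Sum>v\<in>U-T. d v)" by (simp add: active_def)
  have "1 ^ H * fact (card T) * (fact L * (2 ^ b * fact b)) \<le> weight (U - T) {} * fact (card T - H)"
  proof (rule weight_discover)
    show "state (U - T) {}" by (rule state_empty) auto
    show "T \<subseteq> U - (U - T)" using T by auto
    show "?P \<subseteq> U - T" by (fact PT)
    show "\<forall>w\<in>T. 1 \<le> d w" using T by auto
    show "H \<le> card T" using HC by simp
    have "H \<le> active (U - T) {}" unfolding act0 H[symmetric] using PT fin by (intro sum_mono2) auto
    then show "2 \<le> (1::nat) \<and> 1 \<le> active (U - T) {} \<or> 1 \<le> (1::nat) \<and> H \<le> active (U - T) {}" by simp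
  next
    fix D' F'
    assume st: "state D' F'" and D': "U - T \<subseteq> D'" "D' \<subseteq> U - T \<union> T" and cD: "card D' = card (U - T) + H"
      and cF: "card F' = card {} + H" and P0: "sum (res F') ?P \<le> sum (res {}) ?P - H"
    have DU: "D' \<subseteq> U" using D' T by auto
    have UD: "U - D' \<subseteq> T" using D' by auto
    have "card (U - D') = card U - card D'" using DU fin by (simp add: card_Diff_subset finite_subset)
    also have "card (U - T) = card U - card T" using T fT by (simp add: card_Diff_subset)
    moreover have "card T \<le> card U" using T fin card_mono by blast
    ultimately have cUD: "card (U - D') = L" using cD by (simp add: L_def)
    have d1: "\<forall>v\<in>U-D'. d v = 1" using UD T by auto
    have u1: "undisc D' 1 = L"
    proof -
      have "{v \<in> U - D'. d v = 1} = U - D'" using d1 by auto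
      then show ?thesis using cUD by (simp add: undisc_def)
    qed
    have u0: "undisc D' k = 0" if "k \<noteq> 1" for k
    proof -
      have "{v \<in> U - D'. d v = k} = {}" using d1 that by auto
      then show ?thesis unfolding undisc_def by (metis card.empty)
    qed
    have dU: "\<forall>v\<in>U-D'. 1 \<le> d v \<and> d v \<le> M" using d1 M by auto
    have "(\<Sum>v\<in>U-D'. d v) = L" using d1 cUD by simp
    then have act: "active D' F' = L + 2 * b"
      using active_eq[OF st] s cF HC by (simp add: L_def)
    have sr: "(\<Sum>v\<in>U. res F' v) = 2 * (L + b)"
      using sum_res[OF st] s cF HC by (simp add: L_def)
    have fP: "finite ?P" using fin by simp
    have "sum (res F') ?P = 0" using P0 H by simp
    then have z: "\<forall>v\<in>?P. res F' v = 0" using fP by (metis (no_types, lifting) sum_eq_0_iff)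
    have lowD: "\<forall>v\<in>D'. res F' v > 0 \<longrightarrow> d v \<le> M" using z DU by (metis (mono_tags, lifting) less_irrefl mem_Collect_eq not_le subsetD)
    have prod: "(\<Prod>k=1..M. k ^ undisc D' k * fact (undisc D' k)) = (fact L :: nat)"
    proof -
      have "(\<Prod>k=1..M. k ^ undisc D' k * fact (undisc D' k)) = (\<Prod>k\<in>{1}. k ^ undisc D' k * fact (undisc D' k) :: nat)"
        by (rule prod.mono_neutral_right) (use M u0 in auto)
      then show ?thesis using u1 by simp
    qed
    have "2 ^ b * fact b * 1 \<le> 2 ^ b * fact b * path_weight M C L L (undisc D')"
      using path_weight_leaves[OF M, of "undisc D'" L C] u1 u0 by (intro mult_left_mono) auto
    also have "\<dots> \<le> path_weight M C (L + b) (L + 2 * b) (undisc D')"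
      by (rule path_weight_back) (use HC in \<open>simp add: L_def\<close>)
    finally have "fact L * (2 ^ b * fact b) \<le> fact L * path_weight M C (L + b) (L + 2 * b) (undisc D')" by simp
    also have "\<dots> \<le> weight D' F'" using weight_lower[OF C st sr lowD dU] unfolding prod act .
    finally show "fact L * (2 ^ b * fact b) \<le> weight D' F'" .
  qed
  then have "fact L * (fact (card T) * (2 ^ b * fact b)) \<le> fact L * weight (U - T) {}"
    by (simp add: L_def mult_ac)
  then have "fact (card T) * (2 ^ b * fact b) \<le> weight (U - T) {}" by simp
  also have "\<dots> \<le> weight U {}" by (rule weight_mono) auto
  finally show ?thesis by (simp add: mult_ac)
qed

text \<open>From a root of degree at least 3 all \<open>h\<close> vertices of degree above
  \<open>M\<close> are discovered, which is possible because degrees of at least 2 keep the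
  exploration alive. Then \<open>q\<close> vertices of degree \<open>k0\<close> are attached, to
  half-edges of the large vertices as long as there are any, so that only bounded degrees stay
  active. The factors of these \<open>q\<close> vertices restore the full product over
  \<open>undisc {x}\<close>, so this phase is free.\<close>

lemma weight_connected_lower:
  assumes x: "x \<in> U" "d x = k0" and k0: "3 \<le> k0" "k0 \<le> M" and pos: "\<forall>v\<in>U. 1 \<le> d v"
    and C: "C = M + M * M"
    and h: "h = card {v\<in>U. d v > M}" and Hq: "(\<Sum>v\<in>{v\<in>U. d v > M}. d v) \<le> q"
    and q: "q \<le> undisc {x} k0"
    and s: "(\<Sum>v\<in>U. d v) = 2 * (s + h + q)"
    and u': "u' = (undisc {x})(k0 := undisc {x} k0 - q)"
    and A: "A + (\<Sum>k=1..M. k * u' k) = 2 * s"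
  shows "fact h * (\<Prod>k=1..M. k ^ undisc {x} k * fact (undisc {x} k)) * path_weight M C s A u'
    \<le> weight {x} {}"
proof -
  let ?P = "{v\<in>U. d v > M}"
  let ?u = "undisc {x}"
  have fP: "finite ?P" using fin by simp
  have xP: "x \<notin> ?P" using x k0 by simp
  define R where "R = (\<Prod>k\<in>{1..M}-{k0}. k ^ ?u k * fact (?u k) :: nat)"
  have k0M: "k0 \<in> {1..M}" using k0 by simp
  have Pu: "(\<Prod>k=1..M. k ^ ?u k * fact (?u k)) = k0 ^ ?u k0 * fact (?u k0) * R"
    unfolding R_def by (rule prod.remove) (use k0M in auto)
  have Pu': "(\<Prod>k=1..M. k ^ u' k * fact (u' k)) = k0 ^ (?u k0 - q) * fact (?u k0 - q) * R"
    unfolding prod.remove[OF finite_atLeastAtMost k0M] u' R_def by simp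
  have "2 ^ h * fact (card ?P) * ((\<Prod>k=1..M. k ^ ?u k * fact (?u k)) * path_weight M C s A u')
    \<le> weight {x} {} * fact (card ?P - h)"
  proof (rule weight_discover)
    show "state {x} {}" using x by (intro state_empty) auto
    show "?P \<subseteq> U - {x}" using xP by auto
    show "\<forall>w\<in>?P. 2 \<le> d w" using k0 by auto
    show "2 \<le> (2::nat) \<and> 1 \<le> active {x} {} \<or> 1 \<le> (2::nat) \<and> h \<le> active {x} {}"
      using x k0 by (simp add: active_def)
  next
    fix D F
    assume st: "state D F" and D: "{x} \<subseteq> D" "D \<subseteq> {x} \<union> ?P" and cD: "card D = card {x} + h"
      and cF: "card F = card {} + h"
    have "card ({x} \<union> ?P) = card {x} + h" using fP xP h by simp
    then have D_eq: "D = {x} \<union> ?P" using cD D fP by (intro card_subset_eq) auto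
    let ?T = "{v\<in>U-D. d v = k0}"
    have T_eq: "{v\<in>U-D. d v = k} = {v\<in>U-{x}. d v = k}" if "k \<le> M" for k
      unfolding D_eq using that by auto
    have cT: "card ?T = ?u k0" using T_eq[OF k0(2)] by (simp add: undisc_def)
    have DU: "D \<subseteq> U" using x unfolding D_eq by auto
    have act: "1 \<le> active D F"
    proof -
      have "(\<Sum>v\<in>U. d v) = (\<Sum>v\<in>U-D. d v) + (\<Sum>v\<in>D. d v)" using DU fin by (rule sum.subset_diff)
      also have "(\<Sum>v\<in>D. d v) = k0 + (\<Sum>v\<in>?P. d v)" unfolding D_eq using x xP fP by simp
      finally have "active D F + 2 * h = k0 + (\<Sum>v\<in>?P. d v)" using active_eq[OF st] cF by simp
      moreover have "(\<Sum>v\<in>?P. 2) \<le> (\<Sum>v\<in>?P. d v)" using k0 by (intro sum_mono) auto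
      ultimately show ?thesis using k0 h by simp
    qed
    have "k0 ^ q * fact (card ?T) * ((\<Prod>k=1..M. k ^ u' k * fact (u' k)) * path_weight M C s A u')
      \<le> weight D F * fact (card ?T - q)"
    proof (rule weight_discover[OF st, where P = ?P])
      show "?P \<subseteq> D" unfolding D_eq by auto
      show "2 \<le> k0 \<and> 1 \<le> active D F \<or> 1 \<le> k0 \<and> q \<le> active D F" using act k0 by simp
      show "q \<le> card ?T" using cT q by simp
    next
      fix D' F'
      assume st': "state D' F'" and D': "D \<subseteq> D'" "D' \<subseteq> D \<union> ?T" and cD': "card D' = card D + q"
        and cF': "card F' = card F + q" and P0: "sum (res F') ?P \<le> sum (res F) ?P - q"
      have fD: "finite D" "finite D'" using state_finite st st' by auto
      have DU': "D' \<subseteq> U" using st' by (simp add: state_def)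
      have "sum (res F) ?P \<le> sum d ?P" by (intro sum_mono) (simp add: res_def)
      then have "sum (res F') ?P = 0" using P0 Hq by simp
      then have z: "\<forall>v\<in>?P. res F' v = 0" using fP by (metis (no_types, lifting) sum_eq_0_iff)
      have lowD: "\<forall>v\<in>D'. res F' v > 0 \<longrightarrow> d v \<le> M"
        using z DU' by (metis (mono_tags, lifting) less_irrefl mem_Collect_eq not_le subsetD)
      have dU: "\<forall>v\<in>U-D'. 1 \<le> d v \<and> d v \<le> M" using D' pos unfolding D_eq by auto
      have ud: "undisc D' k = u' k" if "k \<in> {1..M}" for k
      proof (cases "k = k0")
        case False
        have "{v\<in>U-D'. d v = k} = {v\<in>U-D. d v = k}" using D' False by auto
        then show ?thesis using False that T_eq[of k] by (simp add: undisc_def u')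
      next
        case True
        have "{v\<in>U-D'. d v = k0} = ?T - (D' - D)" using D' by auto
        then have "undisc D' k0 = card ?T - card (D' - D)"
          unfolding undisc_def using fD D' by (metis (no_types, lifting) card_Diff_subset
              Diff_subset_conv finite_Diff)
        also have "card (D' - D) = q" using cD' D' fD by (simp add: card_Diff_subset)
        finally show ?thesis using True cT by (simp add: u')
      qed
      have cc: "card F' = h + q" using cF cF' by simp
      have sr: "(\<Sum>v\<in>U. res F' v) = 2 * s" using sum_res[OF st'] s cc by simp
      have "(\<Sum>v\<in>U-D'. d v) = (\<Sum>k=1..M. k * u' k)"
        unfolding sum_undiscovered[OF dU] using ud by (intro sum.cong) auto
      then have act': "active D' F' = A" using active_eq[OF st'] s cc A by simp
      have "(\<Prod>k=1..M. k ^ undisc D' k * fact (undisc D' k)) = (\<Prod>k=1..M. k ^ u' k * fact (u' k) :: nat)"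
        using ud by (intro prod.cong) auto
      moreover have "path_weight M C s A (undisc D') = path_weight M C s A u'"
        using ud by (rule path_weight_cong)
      ultimately show "(\<Prod>k=1..M. k ^ u' k * fact (u' k)) * path_weight M C s A u' \<le> weight D' F'"
        using weight_lower[OF C st' sr lowD dU] act' by simp
    qed auto
    then have le: "k0 ^ q * fact (?u k0) * (k0 ^ (?u k0 - q) * fact (?u k0 - q) * R * path_weight M C s A u')
      \<le> weight D F * fact (?u k0 - q)" unfolding cT Pu' .
    have pw: "k0 ^ ?u k0 = k0 ^ q * k0 ^ (?u k0 - q)" using q by (simp add: power_add[symmetric])
    define X where "X = k0 ^ ?u k0 * fact (?u k0) * R * path_weight M C s A u'"
    have "fact (?u k0 - q) * X
      = k0 ^ q * fact (?u k0) * (k0 ^ (?u k0 - q) * fact (?u k0 - q) * R * path_weight M C s A u')"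
      unfolding pw X_def by (simp only: mult_ac)
    with le have "fact (?u k0 - q) * X \<le> fact (?u k0 - q) * weight D F" by (simp add: mult.commute)
    then have "X \<le> weight D F" by simp
    then show "(\<Prod>k=1..M. k ^ ?u k * fact (?u k)) * path_weight M C s A u' \<le> weight D F"
      unfolding Pu X_def .
  qed (use h in auto)
  then have le: "2 ^ h * (fact h * (\<Prod>k=1..M. k ^ ?u k * fact (?u k)) * path_weight M C s A u') \<le> weight {x} {}"
    using h by (simp add: mult.assoc)
  \<comment> \<open>The factor \<open>2 ^ h\<close> from the bound 2 on the large degrees is given
    away.\<close>
  have "1 * (fact h * (\<Prod>k=1..M. k ^ ?u k * fact (?u k)) * path_weight M C s A u')
    \<le> 2 ^ h * (fact h * (\<Prod>k=1..M. k ^ ?u k * fact (?u k)) * path_weight M C s A u')"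
    by (rule mult_right_mono) auto
  also note le
  finally show ?thesis by simp
qed

end

section \<open>The two graph counts as weights\<close>

lemma exploration_interval: "exploration {1..n::nat}"
  by unfold_locales simp

lemma weight_graphs:
  "exploration.weight {1..n} d {1..n} {} = card (graphs_with_degrees n d) * (\<Prod>i=1..n. fact (d i))"
proof -
  interpret exploration "{1..n}" d by (rule exploration_interval)
  have "extensions {1..n} {} = graphs_with_degrees n d"
    unfolding extensions_def graphs_with_degrees_def by auto
  then show ?thesis unfolding weight_def by simp
qed

text \<open>The value is the same for every root \<open>x\<close>. The upper bound uses the root 1,
  the lower bound a root of degree \<open>k0\<close>, and this lemma identifies the two
  weights.\<close>

lemma weight_connected_graphs:
  assumes x: "x \<in> {1..n}"
  shows "exploration.weight {1..n} d {x} {} =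
    card (connected_graphs_with_degrees n d) * (\<Prod>i=1..n. fact (d i))"
proof -
  interpret exploration "{1..n}" d by (rule exploration_interval)
  have sym: "(v, u) \<in> {(x, y). {x, y} \<in> E}\<^sup>*" if "(u, v) \<in> {(x, y). {x, y} \<in> E}\<^sup>*" for u v :: nat and E
  proof -
    have "sym {(x, y). {x, y} \<in> E}" by (auto simp: sym_def insert_commute)
    then show ?thesis using that by (meson sym_rtrancl symD)
  qed
  have "(\<forall>u\<in>{1..n}. \<exists>y\<in>{x}. (u, y) \<in> {(x, y). {x, y} \<in> E}\<^sup>*) \<longleftrightarrow> connected_graph_on {1..n} E" for E
  proof
    assume r: "\<forall>u\<in>{1..n}. \<exists>y\<in>{x}. (u, y) \<in> {(x, y). {x, y} \<in> E}\<^sup>*"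
    have "(u, v) \<in> {(x, y). {x, y} \<in> E}\<^sup>*" if "u \<in> {1..n}" "v \<in> {1..n}" for u v
      using r that sym[of v x E] by (metis (no_types, lifting) rtrancl_trans singletonD)
    then show "connected_graph_on {1..n} E" using x by (auto simp: connected_graph_on_def)
  qed (use x in \<open>auto simp: connected_graph_on_def\<close>)
  then have "extensions {x} {} = connected_graphs_with_degrees n d"
    unfolding extensions_def connected_graphs_with_degrees_def graphs_with_degrees_def by auto
  then show ?thesis unfolding weight_def by simp
qed

section \<open>The tilting parameter\<close>

lemma has_sum_imp_LIMSEQ_from_1:
  fixes f :: "nat \<Rightarrow> real"
  assumes "(f has_sum s) {1..}"
  shows "(\<lambda>M. \<Sum>k=1..M. f k) \<longlonglongrightarrow> s"
proof -
  have "filterlim (\<lambda>M. {1..M::nat}) (finite_subsets_at_top {1..}) sequentially"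
    unfolding filterlim_finite_subsets_at_top
  proof (intro allI impI)
    fix X :: "nat set" assume X: "finite X \<and> X \<subseteq> {1..}"
    then obtain m where m: "\<forall>x\<in>X. x \<le> m" using finite_nat_set_iff_bounded_le by blast
    show "\<forall>\<^sub>F M in sequentially. finite {1..M} \<and> X \<subseteq> {1..M} \<and> {1..M} \<subseteq> {1..}"
      using eventually_ge_at_top[of m] by eventually_elim (use X m in force)
  qed
  with assms show ?thesis unfolding has_sum_def by (rule filterlim_compose)
qed

lemma sum_le_has_sum_from_1:
  fixes f :: "nat \<Rightarrow> real"
  assumes "(f has_sum s) {1..}" "\<And>k. k \<ge> 1 \<Longrightarrow> f k \<ge> 0"
  shows "(\<Sum>k=1..M. f k) \<le> s"
  using assms has_sum_mono_neutral[OF has_sum_finite[of "{1..M}" f] assms(1)] by force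

lemma has_sum_diff_real:
  fixes f g :: "'a \<Rightarrow> real"
  assumes "(f has_sum s) A" "(g has_sum t) A"
  shows "((\<lambda>x. f x - g x) has_sum (s - t)) A"
proof -
  have "((\<lambda>x. - g x) has_sum (- t)) A" using assms(2) by (simp add: has_sum_uminus)
  from has_sum_add[OF assms(1) this] show ?thesis by simp
qed

lemma summable_on_comparison_norm:
  fixes f g :: "'a \<Rightarrow> real"
  assumes "g summable_on A" "\<And>x. x \<in> A \<Longrightarrow> norm (f x) \<le> g x"
  shows "f summable_on A"
  using Infinite_Sum.abs_summable_on_comparison_test'[OF assms] by (rule abs_summable_summable)

text \<open>With k = m + 2 this is the monotonicity of (b - b^(k-1)) / (1 - b^k), cross-multiplied.
  The difference factors as (c - b) (1 - b c) times a sum that, symmetrised under i -> m - i,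
  consists of products of two differences of equal sign; the term i = 0 gives strictness.\<close>

lemma tilt_ineq:
  fixes b c :: real
  assumes "0 < b" "b < c" "c < 1"
  shows "(b - b ^ (m + 1)) * (1 - c ^ (m + 2)) \<le> (c - c ^ (m + 1)) * (1 - b ^ (m + 2))"
    and "m \<ge> 1 \<Longrightarrow> (b - b ^ (m + 1)) * (1 - c ^ (m + 2)) < (c - c ^ (m + 1)) * (1 - b ^ (m + 2))"
proof -
  let ?D = "\<Sum>i=0..m. (b * c) ^ i - c ^ i * b ^ (m - i)"
  let ?E = "\<lambda>i. (b ^ i - b ^ (m - i)) * (c ^ i - c ^ (m - i))"
  have bc: "b * c < 1" using assms by (smt (verit) mult_less_cancel_left2)
  have 1: "1 - (b * c) ^ (m + 1) = (1 - b * c) * (\<Sum>i=0..m. (b * c) ^ i)"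
    using one_diff_power_eq[of "b * c" "m + 1"] by (simp add: atLeast0AtMost lessThan_Suc_atMost)
  have 2: "c ^ (m + 1) - b ^ (m + 1) = (c - b) * (\<Sum>i=0..m. c ^ i * b ^ (m - i))"
    using diff_power_eq_sum[of c m b] by (simp add: atLeast0AtMost lessThan_Suc_atMost)
  have "(c - c ^ (m + 1)) * (1 - b ^ (m + 2)) - (b - b ^ (m + 1)) * (1 - c ^ (m + 2)) =
      (c - b) * (1 - (b * c) ^ (m + 1)) - (1 - b * c) * (c ^ (m + 1) - b ^ (m + 1))"
    by (simp add: algebra_simps power_mult_distrib)
  also have "\<dots> = (c - b) * (1 - b * c) * ?D"
    unfolding 1 2 sum_subtractf by (simp add: algebra_simps)
  finally have diff: "(c - c ^ (m + 1)) * (1 - b ^ (m + 2)) - (b - b ^ (m + 1)) * (1 - c ^ (m + 2)) =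
      (c - b) * (1 - b * c) * ?D" .
  have rev: "(\<Sum>i=0..m. (b * c) ^ i - c ^ i * b ^ (m - i)) =
      (\<Sum>i=0..m. (b * c) ^ (m - i) - c ^ (m - i) * b ^ i)"
    by (subst sum.atLeastAtMost_rev) (intro sum.cong, auto)
  have "2 * ?D = ?D + ?D" by simp
  also have "\<dots> = (\<Sum>i=0..m. ((b * c) ^ i - c ^ i * b ^ (m - i)) + ((b * c) ^ (m - i) - c ^ (m - i) * b ^ i))"
    unfolding sum.distrib using rev by simp
  also have "\<dots> = (\<Sum>i=0..m. ?E i)"
    by (intro sum.cong) (auto simp: power_mult_distrib algebra_simps)
  finally have D: "2 * ?D = (\<Sum>i=0..m. ?E i)" .
  have E: "0 \<le> ?E i" if "i \<in> {0..m}" for i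
  proof (cases "i \<le> m - i")
    case True
    then have "b ^ (m - i) \<le> b ^ i" "c ^ (m - i) \<le> c ^ i"
      using assms by (auto intro!: power_decreasing)
    then show ?thesis by (intro mult_nonneg_nonneg) auto
  next
    case False
    then have "b ^ i \<le> b ^ (m - i)" "c ^ i \<le> c ^ (m - i)"
      using assms by (auto intro!: power_decreasing)
    then show ?thesis by (intro mult_nonpos_nonpos) auto
  qed
  have pos: "0 < (c - b) * (1 - b * c)" using assms bc by simp
  have "0 \<le> ?D" using D E by (smt (verit) sum_nonneg)
  with pos show "(b - b ^ (m + 1)) * (1 - c ^ (m + 2)) \<le> (c - c ^ (m + 1)) * (1 - b ^ (m + 2))"
    using diff by (smt (verit) mult_nonneg_nonneg)
  show "(b - b ^ (m + 1)) * (1 - c ^ (m + 2)) < (c - c ^ (m + 1)) * (1 - b ^ (m + 2))" if "m \<ge> 1"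
  proof -
    have "b ^ m < 1" "c ^ m < 1" using assms that by (auto intro!: power_Suc_less_one power_less_one_iff[THEN iffD2])
    then have "0 < ?E 0" by simp
    also have "?E 0 \<le> (\<Sum>i=0..m. ?E i)" using E by (intro member_le_sum) auto
    finally have "0 < ?D" using D by linarith
    with pos show ?thesis using diff by (smt (verit) mult_pos_pos)
  qed
qed

lemma one_minus_power_pos: "0 < b \<Longrightarrow> b < 1 \<Longrightarrow> 1 \<le> k \<Longrightarrow> 0 < 1 - (b::real) ^ k"
  using power_less_one_iff[of b k] by simp

text \<open>The equation defining \<open>\<beta>\<close>, divided by \<open>\<beta>\<close>, reads \<open>\<Sum>k tilt p k \<beta> = 0\<close>.\<close>

definition tilt :: "(nat \<Rightarrow> real) \<Rightarrow> nat \<Rightarrow> real \<Rightarrow> real" where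
  "tilt p k b = real k * p k * (b - b ^ (k - 1)) / (1 - b ^ k)"

locale limit_distribution =
  fixes p :: "nat \<Rightarrow> real"
  assumes p_dist: "prob_dist_pos p"
    and mean_finite: "(\<lambda>i. real i * p i) summable_on {1..}"
    and p1: "p 1 > 0"
    and mean_gt_2: "mean_pos p > 2"
begin

lemma p_nonneg: "k \<ge> 1 \<Longrightarrow> p k \<ge> 0"
  using p_dist by (simp add: prob_dist_pos_def)

lemma has_sum_p: "(p has_sum 1) {1..}"
  using p_dist by (simp add: prob_dist_pos_def)

lemma has_sum_mean: "((\<lambda>k. real k * p k) has_sum mean_pos p) {1..}"
  using mean_finite unfolding mean_pos_def by (rule has_sum_infsum)

lemma ex_degree_ge_3: "\<exists>k\<ge>3. p k > 0"
proof (rule ccontr)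
  assume "\<not> ?thesis"
  then have z: "p k = 0" if "k \<ge> 3" for k using p_nonneg[of k] that by force
  have "mean_pos p \<le> 2 * 1"
  proof (rule has_sum_mono[OF has_sum_mean has_sum_cmult_right[OF has_sum_p]])
    fix k :: nat assume "k \<in> {1..}"
    then show "real k * p k \<le> 2 * p k"
      using z[of k] p_nonneg[of k] by (cases "k \<ge> 3") (auto intro!: mult_right_mono)
  qed
  with mean_gt_2 show False by simp
qed

lemma tilt_1: "0 < b \<Longrightarrow> b < 1 \<Longrightarrow> tilt p 1 b = - p 1"
  by (simp add: tilt_def divide_eq_eq) (simp add: algebra_simps)

text \<open>The term of degree 1 is constant and that of degree 2 is zero; strictness starts at
  degree 3, where \<open>ex_degree_ge_3\<close> supplies a positive \<open>p k\<close> for the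
  uniqueness of the root.\<close>

lemma tilt_mono:
  assumes "0 < b" "b < c" "c < 1" "k \<ge> 1"
  shows "tilt p k b \<le> tilt p k c" and "k \<ge> 3 \<Longrightarrow> p k > 0 \<Longrightarrow> tilt p k b < tilt p k c"
proof -
  have pos: "0 < 1 - b ^ k" "0 < 1 - c ^ k" using one_minus_power_pos assms by auto
  have frac: "(b - b ^ (k - 1)) / (1 - b ^ k) \<le> (c - c ^ (k - 1)) / (1 - c ^ k)" if "k \<ge> 2"
    using tilt_ineq(1)[OF assms(1-3), of "k - 2"] pos that
    by (simp add: divide_le_eq le_divide_eq Suc_diff_Suc numeral_2_eq_2)
  show "tilt p k b \<le> tilt p k c"
  proof (cases "k = 1")
    case True
    then show ?thesis using tilt_1[of b] tilt_1[of c] assms by simp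
  next
    case False
    then have "real k * p k * ((b - b ^ (k - 1)) / (1 - b ^ k)) \<le> real k * p k * ((c - c ^ (k - 1)) / (1 - c ^ k))"
      using p_nonneg[OF assms(4)] assms(4) by (intro mult_left_mono frac) auto
    then show ?thesis by (simp add: tilt_def)
  qed
  show "tilt p k b < tilt p k c" if "k \<ge> 3" "p k > 0"
  proof -
    have "(b - b ^ (k - 1)) / (1 - b ^ k) < (c - c ^ (k - 1)) / (1 - c ^ k)"
      using tilt_ineq(2)[OF assms(1-3), of "k - 2"] pos that
      by (simp add: divide_less_eq less_divide_eq Suc_diff_Suc numeral_2_eq_2)
    then have "real k * p k * ((b - b ^ (k - 1)) / (1 - b ^ k)) < real k * p k * ((c - c ^ (k - 1)) / (1 - c ^ k))"
      using that by (intro mult_strict_left_mono) auto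
    then show ?thesis by (simp add: tilt_def)
  qed
qed

text \<open>A majorant independent of b, as the Weierstrass test needs for the continuity of the
  sum.\<close>

lemma tilt_bound:
  assumes b: "0 < b" "b < 1" and k: "k \<ge> 1"
  shows "\<bar>tilt p k b\<bar> \<le> real k * p k"
proof (cases "k = 1")
  case True
  then show ?thesis using tilt_1[OF b] p1 by simp
next
  case False
  have pos: "0 < 1 - b ^ k" using one_minus_power_pos b k by auto
  have "b ^ (k - 1) \<le> b ^ 1" using b False k by (intro power_decreasing) auto
  moreover have "b - b ^ (k - 1) \<le> 1 - b ^ k"
  proof -
    have "0 \<le> (1 - b) * (1 - b ^ (k - 1))" using b by (intro mult_nonneg_nonneg) (auto simp: power_le_one)
    also have "\<dots> = (1 - b ^ (k - 1)) - (b - b ^ k)" using k by (cases k) (auto simp: algebra_simps)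
    finally have "b + b ^ (k - 1) \<le> 1 + b ^ k" by simp
    moreover have "b ^ k \<le> b ^ (k - 1)" using b by (intro power_decreasing) auto
    ultimately show ?thesis by linarith
  qed
  ultimately have "0 \<le> (b - b ^ (k - 1)) / (1 - b ^ k)" "(b - b ^ (k - 1)) / (1 - b ^ k) \<le> 1"
    using pos by auto
  then have "\<bar>(b - b ^ (k - 1)) / (1 - b ^ k)\<bar> \<le> 1" by linarith
  then have "real k * p k * \<bar>(b - b ^ (k - 1)) / (1 - b ^ k)\<bar> \<le> real k * p k * 1"
    using p_nonneg[OF k] by (intro mult_left_mono) auto
  then have "\<bar>real k * p k * ((b - b ^ (k - 1)) / (1 - b ^ k))\<bar> \<le> real k * p k"
    using p_nonneg[OF k] by (simp add: abs_mult)
  then show ?thesis by (simp add: tilt_def)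
qed

lemma summable_on_tilt:
  assumes "0 < b" "b < 1" shows "(\<lambda>k. tilt p k b) summable_on {1..}"
  by (rule summable_on_comparison_norm[OF mean_finite]) (use tilt_bound[OF assms] in auto)

lemma summable_on_div:
  assumes "0 < b" "b < 1" shows "(\<lambda>k. real k * p k / (1 - b ^ k)) summable_on {1..}"
proof (rule summable_on_comparison_norm[OF summable_on_cmult_right[OF mean_finite, of "1 / (1 - b)"]])
  fix k :: nat assume k: "k \<in> {1..}"
  then have "b ^ k \<le> b ^ 1" using assms by (intro power_decreasing) auto
  then have "real k * p k / (1 - b ^ k) \<le> real k * p k / (1 - b)"
    using assms k p_nonneg[of k] by (intro divide_left_mono) auto
  then show "norm (real k * p k / (1 - b ^ k)) \<le> 1 / (1 - b) * (real k * p k)"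
    using k p_nonneg[of k] one_minus_power_pos[OF assms, of k] by simp
qed

lemma equation_iff_tilt:
  assumes b: "0 < b" "b < 1"
  shows "mean_pos p = (1 - b\<^sup>2) * (\<Sum>\<^sub>\<infinity>k\<in>{1..}. real k * p k / (1 - b ^ k)) \<longleftrightarrow>
    (\<Sum>\<^sub>\<infinity>k\<in>{1..}. tilt p k b) = 0"
proof -
  have "((\<lambda>k. real k * p k - (1 - b\<^sup>2) * (real k * p k / (1 - b ^ k))) has_sum
      (mean_pos p - (1 - b\<^sup>2) * (\<Sum>\<^sub>\<infinity>k\<in>{1..}. real k * p k / (1 - b ^ k)))) {1..}"
    by (intro has_sum_diff_real has_sum_mean has_sum_cmult_right has_sum_infsum summable_on_div b)
  moreover have "((\<lambda>k. b * tilt p k b) has_sum (b * (\<Sum>\<^sub>\<infinity>k\<in>{1..}. tilt p k b))) {1..}"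
    by (intro has_sum_cmult_right has_sum_infsum summable_on_tilt b)
  moreover have "real k * p k - (1 - b\<^sup>2) * (real k * p k / (1 - b ^ k)) = b * tilt p k b"
    if "k \<in> {1..}" for k
  proof -
    have "b * b ^ (k - 1) = b ^ k" using that by (cases k) auto
    moreover have "1 - b ^ k \<noteq> 0" using one_minus_power_pos[OF b, of k] that by auto
    ultimately show ?thesis
      by (simp add: tilt_def field_simps power2_eq_square)
  qed
  ultimately have "mean_pos p - (1 - b\<^sup>2) * (\<Sum>\<^sub>\<infinity>k\<in>{1..}. real k * p k / (1 - b ^ k)) =
      b * (\<Sum>\<^sub>\<infinity>k\<in>{1..}. tilt p k b)"
    by (metis (no_types, lifting) has_sum_cong has_sum_unique)
  then show ?thesis using b by auto
qed

lemma tilt_root_unique: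
  assumes "0 < b" "b < c" "c < 1" "(\<Sum>\<^sub>\<infinity>k\<in>{1..}. tilt p k b) = 0" "(\<Sum>\<^sub>\<infinity>k\<in>{1..}. tilt p k c) = 0"
  shows False
proof -
  obtain k where k: "k \<ge> 3" "p k > 0" using ex_degree_ge_3 by auto
  have "((\<lambda>k. tilt p k b) has_sum 0) {1..}" "((\<lambda>k. tilt p k c) has_sum 0) {1..}"
    using assms has_sum_infsum[OF summable_on_tilt[of b]] has_sum_infsum[OF summable_on_tilt[of c]] by auto
  from has_sum_diff_real[OF this(2,1)]
  have "((\<lambda>k. tilt p k c - tilt p k b) has_sum 0) {1..}" by simp
  then have "(\<Sum>i=1..k. tilt p i c - tilt p i b) \<le> 0"
    using sum_le_has_sum_from_1[of "\<lambda>k. tilt p k c - tilt p k b" 0 k] tilt_mono(1)[OF assms(1-3)] by simp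
  moreover have "tilt p k c - tilt p k b \<le> (\<Sum>i=1..k. tilt p i c - tilt p i b)"
    using tilt_mono(1)[OF assms(1-3)] k by (intro member_le_sum) auto
  ultimately show False using tilt_mono(2)[OF assms(1-3) _ k] k by simp
qed

lemma tilt_has_sum_LIMSEQ:
  assumes "0 < b" "b < 1"
  shows "(\<lambda>M. \<Sum>k=1..M. tilt p k b) \<longlonglongrightarrow> (\<Sum>\<^sub>\<infinity>k\<in>{1..}. tilt p k b)"
  by (intro has_sum_imp_LIMSEQ_from_1 has_sum_infsum summable_on_tilt assms)

lemma continuous_tilt_sum: "continuous_on {0<..<1} (\<lambda>b. \<Sum>\<^sub>\<infinity>k\<in>{1..}. tilt p k b)"
proof -
  have eq: "(\<Sum>k=1..M. tilt p k b) = (\<Sum>i<M. tilt p (Suc i) b)" for M b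
    by (simp add: sum.atLeast1_atMost_eq)
  have "(\<lambda>M. \<Sum>k=1..M. real k * p k) \<longlonglongrightarrow> mean_pos p"
    by (rule has_sum_imp_LIMSEQ_from_1[OF has_sum_mean])
  then have "(\<lambda>i. real (Suc i) * p (Suc i)) sums mean_pos p"
    by (simp add: sums_def sum.atLeast1_atMost_eq)
  then have sm: "summable (\<lambda>i. real (Suc i) * p (Suc i))" by (rule sums_summable)
  have "uniform_limit {0<..<1} (\<lambda>M b. \<Sum>i<M. tilt p (Suc i) b) (\<lambda>b. \<Sum>i. tilt p (Suc i) b) sequentially"
    by (rule Weierstrass_m_test[OF _ sm]) (use tilt_bound in force)
  moreover have "continuous_on {0<..<1} (\<lambda>b. \<Sum>i<M. tilt p (Suc i) b)" for M
  proof -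
    have "1 - x ^ Suc i \<noteq> 0" if "x \<in> {0<..<1}" for x :: real and i
      using one_minus_power_pos[of x "Suc i"] that by auto
    then show ?thesis unfolding tilt_def by (intro continuous_intros ballI) blast
  qed
  ultimately have c: "continuous_on {0<..<1} (\<lambda>b. \<Sum>i. tilt p (Suc i) b)"
    by (intro uniform_limit_theorem[OF _ _ sequentially_bot]) auto
  have "(\<Sum>i. tilt p (Suc i) b) = (\<Sum>\<^sub>\<infinity>k\<in>{1..}. tilt p k b)" if "b \<in> {0<..<1}" for b
    using tilt_has_sum_LIMSEQ[of b] that unfolding eq by (intro sums_unique[symmetric]) (auto simp: sums_def)
  then show ?thesis by (intro continuous_on_eq[OF c])
qed

lemma tilt_sum_neg: "\<exists>b. 0 < b \<and> b < 1/2 \<and> (\<Sum>\<^sub>\<infinity>k\<in>{1..}. tilt p k b) < 0"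
proof -
  \<comment> \<open>As b -> 0 only the leaf term \<open>- p 1\<close> survives. The bound 1/3 gives
    1 - b^k >= 1/2, so the other terms sum to at most 2 b \<open>mean_pos p\<close>, and the second
    bound makes this at most \<open>p 1 / 2\<close>.\<close>
  define b where "b = min (1/3) (p 1 / (4 * mean_pos p))"
  have b: "0 < b" "b < 1/2" "b < 1" using p1 mean_gt_2 by (auto simp: b_def)
  have "(\<Sum>k=1..M. tilt p k b) \<le> - p 1 + p 1 / 2" if "M \<ge> 1" for M
  proof -
    have "(\<Sum>k=1..M. tilt p k b) = tilt p 1 b + (\<Sum>k=2..M. tilt p k b)"
      using that by (simp add: sum.atLeast_Suc_atMost numeral_2_eq_2)
    also have "(\<Sum>k=2..M. tilt p k b) \<le> (\<Sum>k=2..M. 2 * b * (real k * p k))"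
    proof (rule sum_mono)
      fix k assume k: "k \<in> {2..M}"
      have "b ^ k \<le> b ^ 1" using b k by (intro power_decreasing) auto
      then have "1 / 2 \<le> 1 - b ^ k" using b by simp
      then have "b \<le> (2 * b) * (1 - b ^ k)" using b mult_left_mono[of "1/2" "1 - b ^ k" "2 * b"] by simp
      moreover have "0 < 1 - b ^ k" using b k by (intro one_minus_power_pos) auto
      moreover have "b - b ^ (k - 1) \<le> b" using b by simp
      ultimately have "(b - b ^ (k - 1)) / (1 - b ^ k) \<le> 2 * b" by (simp add: divide_le_eq)
      then have "real k * p k * ((b - b ^ (k - 1)) / (1 - b ^ k)) \<le> real k * p k * (2 * b)"
        using p_nonneg[of k] k by (intro mult_left_mono) auto
      then show "tilt p k b \<le> 2 * b * (real k * p k)" by (simp add: tilt_def mult_ac)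
    qed
    also have "\<dots> = 2 * b * (\<Sum>k=2..M. real k * p k)" by (simp add: sum_distrib_left)
    also have "\<dots> \<le> 2 * b * (\<Sum>k=1..M. real k * p k)"
      using b p_nonneg by (intro mult_left_mono sum_mono2) auto
    also have "\<dots> \<le> 2 * b * mean_pos p"
      using b p_nonneg by (intro mult_left_mono sum_le_has_sum_from_1[OF has_sum_mean]) auto
    also have "\<dots> \<le> 2 * (p 1 / (4 * mean_pos p)) * mean_pos p"
      using mean_gt_2 by (intro mult_right_mono) (auto simp: b_def)
    also have "\<dots> = p 1 / 2" using mean_gt_2 by simp
    finally show ?thesis using tilt_1[of b] b by simp
  qed
  then have "(\<Sum>\<^sub>\<infinity>k\<in>{1..}. tilt p k b) \<le> - p 1 + p 1 / 2"
    by (intro tendsto_upperbound[OF tilt_has_sum_LIMSEQ[OF b(1,3)]])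
      (auto intro: eventually_sequentiallyI[of 1])
  then show ?thesis using b p1 by (intro exI[of _ b]) auto
qed

text \<open>Compare numerator and denominator with 1 - b: a geometric sum bounds the first from
  below, Bernoulli's inequality the second from above. As b -> 1 the bound tends to (k - 2)
  \<open>p k\<close>.\<close>

lemma tilt_lower:
  assumes b: "0 < b" "b < 1" and k: "k \<ge> 2"
  shows "real (k - 2) * b ^ (k - 2) * p k \<le> tilt p k b"
proof -
  have pos: "0 < 1 - b ^ k" using one_minus_power_pos b k by auto
  have "real (k - 2) * b ^ (k - 2) * (1 - b) \<le> b - b ^ (k - 1)"
  proof -
    have "b ^ (k - 2) * real (k - 2) = (\<Sum>i<k-2. b ^ (k - 2))" by simp
    also have "\<dots> \<le> (\<Sum>i<k-2. b ^ (i + 1))" using b by (intro sum_mono power_decreasing) auto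
    also have "\<dots> = b * (\<Sum>i<k-2. b ^ i)" by (simp add: sum_distrib_left)
    finally have "(1 - b) * (b ^ (k - 2) * real (k - 2)) \<le> (1 - b) * (b * (\<Sum>i<k-2. b ^ i))"
      using b by (intro mult_left_mono) auto
    also have "\<dots> = b * (1 - b ^ (k - 2))" using one_diff_power_eq[of b "k - 2"] by simp
    also have "\<dots> = b - b ^ (k - 1)" using k by (simp add: algebra_simps power_Suc[symmetric] Suc_diff_le Suc_diff_Suc numeral_2_eq_2 del: power_Suc)
    finally show ?thesis by (simp add: mult_ac)
  qed
  moreover have "1 - b ^ k \<le> real k * (1 - b)"
    using Bernoulli_inequality[of "b - 1" k] b by (simp add: algebra_simps)
  ultimately have a: "real (k - 2) * b ^ (k - 2) * (1 - b) \<le> b - b ^ (k - 1)"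
    and c: "1 - b ^ k \<le> real k * (1 - b)" by auto
  have "real (k - 2) * b ^ (k - 2) * (1 - b ^ k) \<le> real (k - 2) * b ^ (k - 2) * (real k * (1 - b))"
    using c b by (intro mult_left_mono) auto
  also have "\<dots> = real k * (real (k - 2) * b ^ (k - 2) * (1 - b))" by (simp only: mult_ac)
  also have "\<dots> \<le> real k * (b - b ^ (k - 1))" using a by (rule mult_left_mono) simp
  finally have "real (k - 2) * b ^ (k - 2) * (1 - b ^ k) \<le> real k * (b - b ^ (k - 1))" .
  then have "real (k - 2) * b ^ (k - 2) \<le> real k * (b - b ^ (k - 1)) / (1 - b ^ k)"
    using pos by (simp add: le_divide_eq)
  then have "real (k - 2) * b ^ (k - 2) * p k \<le> real k * (b - b ^ (k - 1)) / (1 - b ^ k) * p k"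
    using p_nonneg[of k] k by (intro mult_right_mono) auto
  then show ?thesis by (simp add: tilt_def mult_ac)
qed

lemma tilt_nonneg:
  assumes b: "0 < b" "b < 1" and k: "k \<ge> 2"
  shows "0 \<le> tilt p k b"
proof -
  have "0 \<le> real (k - 2) * b ^ (k - 2) * p k"
    using b k p_nonneg[of k] by (intro mult_nonneg_nonneg) auto
  then show ?thesis using tilt_lower[OF assms] by linarith
qed

lemma tilt_sum_pos: "\<exists>b. 1/2 < b \<and> b < 1 \<and> (\<Sum>\<^sub>\<infinity>k\<in>{1..}. tilt p k b) > 0"
proof -
  have "(\<lambda>M. (\<Sum>k=1..M. real k * p k) - 2 * (\<Sum>k=1..M. p k)) \<longlonglongrightarrow> mean_pos p - 2 * 1"
    by (intro tendsto_diff tendsto_mult tendsto_const has_sum_imp_LIMSEQ_from_1 has_sum_mean has_sum_p)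
  then have "\<forall>\<^sub>F M in sequentially. (\<Sum>k=1..M. real k * p k) - 2 * (\<Sum>k=1..M. p k) > 0"
    using mean_gt_2 by (intro order_tendstoD(1)) auto
  then have "\<forall>\<^sub>F M in sequentially. M \<ge> 1 \<and> (\<Sum>k=1..M. real k * p k) - 2 * (\<Sum>k=1..M. p k) > 0"
    using eventually_ge_at_top[of 1] by eventually_elim auto
  then obtain N where N: "N \<ge> 1" "(\<Sum>k=1..N. real k * p k) - 2 * (\<Sum>k=1..N. p k) > 0"
    by (auto simp: eventually_sequentially)
  \<comment> \<open>At b = 1 this is the sum of (k - 2) p_k over k <= N, positive because the mean
    exceeds 2 and N is large. Being a polynomial, it stays positive slightly left of 1, and the
    terms beyond N are nonnegative.\<close>
  define L where "L b = - p 1 + (\<Sum>k=2..N. real (k - 2) * b ^ (k - 2) * p k)" for b :: real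
  have L1: "L 1 = (\<Sum>k=1..N. real k * p k) - 2 * (\<Sum>k=1..N. p k)"
  proof -
    have "(\<Sum>k=1..N. real k * p k) - 2 * (\<Sum>k=1..N. p k) = (\<Sum>k=1..N. (real k - 2) * p k)"
      by (simp add: sum_distrib_left sum_subtractf[symmetric] algebra_simps)
    also have "\<dots> = (real 1 - 2) * p 1 + (\<Sum>k=2..N. (real k - 2) * p k)"
      using N(1) by (simp add: sum.atLeast_Suc_atMost numeral_2_eq_2)
    also have "(\<Sum>k=2..N. (real k - 2) * p k) = (\<Sum>k=2..N. real (k - 2) * 1 ^ (k - 2) * p k)"
      by (intro sum.cong) auto
    finally show ?thesis by (simp add: L_def)
  qed
  have "isCont L 1" unfolding L_def by (intro continuous_intros)
  then have "(L \<longlongrightarrow> L 1) (at_left 1)" unfolding isCont_def by (rule filterlim_mono) (auto simp: at_le)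
  then have "\<forall>\<^sub>F b in at_left 1. L b > 0" using L1 N by (intro order_tendstoD(1)) auto
  moreover have "\<forall>\<^sub>F b in at_left 1. b \<in> {1/2<..<1::real}"
    by (rule eventually_at_left_real) simp
  ultimately have "\<forall>\<^sub>F b in at_left (1::real). L b > 0 \<and> b \<in> {1/2<..<1}" by eventually_elim auto
  then obtain b where b: "L b > 0" "1/2 < b" "b < 1"
    using eventually_happens'[of "at_left (1::real)"] trivial_limit_at_left_real by force
  have b0: "0 < b" using b by simp
  have "L b \<le> (\<Sum>k=1..M. tilt p k b)" if "M \<ge> N" for M
  proof -
    have "(\<Sum>k=1..M. tilt p k b) = tilt p 1 b + (\<Sum>k=2..M. tilt p k b)"
      using that N by (simp add: sum.atLeast_Suc_atMost numeral_2_eq_2)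
    moreover have "(\<Sum>k=2..N. tilt p k b) \<le> (\<Sum>k=2..M. tilt p k b)"
      using that tilt_nonneg[OF b0 b(3)] by (intro sum_mono2) auto
    moreover have "(\<Sum>k=2..N. real (k - 2) * b ^ (k - 2) * p k) \<le> (\<Sum>k=2..N. tilt p k b)"
      using tilt_lower[OF b0 b(3)] by (intro sum_mono) auto
    ultimately show ?thesis using tilt_1[OF b0 b(3)] by (simp add: L_def)
  qed
  then have "L b \<le> (\<Sum>\<^sub>\<infinity>k\<in>{1..}. tilt p k b)"
    by (intro tendsto_lowerbound[OF tilt_has_sum_LIMSEQ[OF b0 b(3)]])
      (auto intro: eventually_sequentiallyI[of N])
  then show ?thesis using b by (intro exI[of _ b]) auto
qed

lemma tilt_root: "\<exists>b. 0 < b \<and> b < 1 \<and> (\<Sum>\<^sub>\<infinity>k\<in>{1..}. tilt p k b) = 0"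
proof -
  obtain a where a: "0 < a" "a < 1/2" "(\<Sum>\<^sub>\<infinity>k\<in>{1..}. tilt p k a) < 0" using tilt_sum_neg by auto
  obtain c where c: "1/2 < c" "c < 1" "(\<Sum>\<^sub>\<infinity>k\<in>{1..}. tilt p k c) > 0" using tilt_sum_pos by auto
  have "continuous_on {a..c} (\<lambda>b. \<Sum>\<^sub>\<infinity>k\<in>{1..}. tilt p k b)"
    by (rule continuous_on_subset[OF continuous_tilt_sum]) (use a c in auto)
  then obtain b where "a \<le> b" "b \<le> c" "(\<Sum>\<^sub>\<infinity>k\<in>{1..}. tilt p k b) = 0"
    using IVT'[of "\<lambda>b. \<Sum>\<^sub>\<infinity>k\<in>{1..}. tilt p k b" a 0 c] a c by auto
  then show ?thesis using a c by (intro exI[of _ b]) auto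
qed

text \<open>The intermediate value theorem gives existence and strict monotonicity uniqueness, so
  the description in \<open>beta\<close> denotes.\<close>

lemma beta_props:
  shows "0 < beta p" "beta p < 1"
    "mean_pos p = (1 - (beta p)\<^sup>2) * (\<Sum>\<^sub>\<infinity>k\<in>{1..}. real k * p k / (1 - beta p ^ k))"
proof -
  let ?P = "\<lambda>b. 0 < b \<and> b < 1 \<and> mean_pos p = (1 - b\<^sup>2) * (\<Sum>\<^sub>\<infinity>k\<in>{1..}. real k * p k / (1 - b ^ k))"
  have iff: "?P b \<longleftrightarrow> 0 < b \<and> b < 1 \<and> (\<Sum>\<^sub>\<infinity>k\<in>{1..}. tilt p k b) = 0" for b
    using equation_iff_tilt[of b] by blast
  have "\<exists>!b. ?P b"
    unfolding iff using tilt_root tilt_root_unique by (metis linorder_neqE)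
  then have "?P (beta p)" unfolding beta_def by (rule theI')
  then show "0 < beta p" "beta p < 1"
    "mean_pos p = (1 - (beta p)\<^sup>2) * (\<Sum>\<^sub>\<infinity>k\<in>{1..}. real k * p k / (1 - beta p ^ k))" by auto
qed

end

section \<open>A schedule for the exploration\<close>

text \<open>The exploration discovers first all surplus vertices of degree at least 2, then runs through
  the prescribed blocks, then only closes cycles, and finally matches the remaining half-edges with
  the remaining leaves.\<close>

lemma path_weight_schedule:
  fixes M C J s A b' :: nat and c :: "nat \<Rightarrow> nat \<Rightarrow> nat" and b a N u :: "nat \<Rightarrow> nat"
  assumes M: "1 \<le> M" and C: "1 \<le> C" and A: "1 \<le> A"
    and N: "\<And>j. N j = (\<Sum>k=1..M. c j k) + b j"
    and cu: "\<And>k. k \<in> {1..M} \<Longrightarrow> (\<Sum>j<J. c j k) \<le> u k"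
    and tot: "A + (\<Sum>k=1..M. k * u k) = 2 * s"
    and s: "s = (\<Sum>k=1..M. u k) + (\<Sum>j<J. b j) + b'"
    and L: "C + (\<Sum>j<J. c j 1) \<le> u 1"
    and cond: "\<And>j. j < J \<Longrightarrow> real (2 * N j + C + a j) \<le>
      real A + (\<Sum>k=2..M. (real k - 2) * (real (u k) - (\<Sum>i<J. real (c i k))))
      + (\<Sum>i<j. (\<Sum>k=1..M. real k * real (c i k)) - 2 * real (N i))"
  shows "(\<Prod>j<J. fact (N j) * a j ^ b j) * (2 ^ b' * fact b')
    \<le> (\<Prod>j<J. (\<Prod>k=1..M. fact (c j k)) * fact (b j)) * path_weight M C s A u"
proof -
  \<comment> \<open>Surplus vertices: those of degree at least 2 that no block uses. Surplus leaves
    are not discovered here but kept as \<open>LL\<close>.\<close>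
  define c0 where "c0 k = (if k \<ge> 2 then u k - (\<Sum>j<J. c j k) else 0)" for k
  define N0 where "N0 = (\<Sum>k=1..M. c0 k)"
  define u1 where "u1 k = u k - c0 k" for k
  define LL where "LL = u 1 - (\<Sum>j<J. c j 1)"
  have CL: "C \<le> LL" using L by (simp add: LL_def)
  define A0 where "A0 = A + (\<Sum>k=1..M. k * c0 k) - 2 * N0"
  have le2: "2 * N0 \<le> (\<Sum>k=1..M. k * c0 k)"
    unfolding N0_def sum_distrib_left by (intro sum_mono) (auto simp: c0_def)
  have first: "{1..M} = insert 1 {2..M}" using M by auto
  have split: "(\<Sum>k=1..M. f k) = f 1 + (\<Sum>k=2..M. f k)" for f :: "nat \<Rightarrow> 'b::comm_monoid_add"
    unfolding first by (subst sum.insert) auto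
  have rc0: "real (c0 k) = real (u k) - (\<Sum>i<J. real (c i k))" if "k \<in> {2..M}" for k
  proof -
    have "(\<Sum>j<J. c j k) \<le> u k" using that by (intro cu) auto
    then show ?thesis using that by (simp add: c0_def of_nat_diff)
  qed
  have A0r: "real A0 = real A + (\<Sum>k=2..M. (real k - 2) * (real (u k) - (\<Sum>i<J. real (c i k))))"
  proof -
    have "real A0 = real A + (\<Sum>k=1..M. real k * real (c0 k)) - 2 * real N0"
      using le2 by (simp add: A0_def of_nat_diff)
    also have "\<dots> = real A + (\<Sum>k=1..M. (real k - 2) * real (c0 k))"
      by (simp add: N0_def sum_distrib_left sum_subtractf left_diff_distrib)
    also have "(\<Sum>k=1..M. (real k - 2) * real (c0 k)) = (\<Sum>k=2..M. (real k - 2) * real (c0 k))"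
      unfolding split by (simp add: c0_def)
    also have "\<dots> = (\<Sum>k=2..M. (real k - 2) * (real (u k) - (\<Sum>i<J. real (c i k))))"
      using rc0 by (intro sum.cong) auto
    finally show ?thesis .
  qed
  \<comment> \<open>The balance of active half-edges is kept in the integers, where partial sums are
    not truncated; \<open>Zpos\<close> then allows the return to natural numbers.\<close>
  define Z where "Z j = int A0 + (\<Sum>i<j. (\<Sum>k=1..M. int k * int (c i k)) - 2 * int (N i))" for j
  define AA where "AA j = nat (Z j)" for j
  have Zcond: "int (2 * N j + C + a j) \<le> Z j" if "j < J" for j
  proof -
    have "real_of_int (Z j) = real A0 + (\<Sum>i<j. (\<Sum>k=1..M. real k * real (c i k)) - 2 * real (N i))"
      unfolding Z_def by simp
    with cond[OF that] A0r have "real (2 * N j + C + a j) \<le> real_of_int (Z j)" by simp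
    then show ?thesis by linarith
  qed
  have Zstep: "Z (Suc j) = Z j + (\<Sum>k=1..M. int k * int (c j k)) - 2 * int (N j)" for j
    unfolding Z_def by simp
  \<comment> \<open>The condition on a block guarantees \<open>2 * N\<close> active half-edges
    before it, and the block consumes no more than that; this also covers the value after the last
    block.\<close>
  have Zpos: "0 \<le> Z j" if "j \<le> J" for j
  proof (cases j)
    case 0
    then show ?thesis by (simp add: Z_def)
  next
    case (Suc i)
    have "0 \<le> (\<Sum>k=1..M. int k * int (c i k))" by (intro sum_nonneg) auto
    then show ?thesis using Zcond[of i] that Zstep[of i] Suc by simp
  qed
  have disc: "path_weight M C (b' + LL + (\<Sum>j<J. N j)) A0 u1 \<le> path_weight M C (b' + LL + (\<Sum>j<J. N j) + N0) A u"
    unfolding A0_def u1_def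
    by (rule path_weight_discover) (use A in \<open>auto simp: c0_def N0_def\<close>)
  have Nsum: "(\<Sum>j<J. N j) = (\<Sum>k=1..M. \<Sum>j<J. c j k) + (\<Sum>j<J. b j)"
    unfolding N sum.distrib by (subst sum.swap) simp
  \<comment> \<open>Used with f = 1 to count vertices and with f k = k to count half-edges.\<close>
  have usum: "(\<Sum>k=1..M. f k * u k) = (\<Sum>k=1..M. f k * c0 k) + (\<Sum>k=1..M. f k * (\<Sum>j<J. c j k)) + f 1 * LL"
    for f :: "nat \<Rightarrow> nat"
  proof -
    have "f k * u k = f k * c0 k + f k * (\<Sum>j<J. c j k)" if "k \<in> {2..M}" for k
      using cu[of k] that by (simp add: c0_def distrib_left[symmetric])
    then have "(\<Sum>k=2..M. f k * u k) = (\<Sum>k=2..M. f k * c0 k) + (\<Sum>k=2..M. f k * (\<Sum>j<J. c j k))"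
      by (simp add: sum.distrib)
    moreover have "u 1 = (\<Sum>j<J. c j 1) + LL" using L by (simp add: LL_def)
    moreover have "c0 1 = 0" by (simp add: c0_def)
    ultimately show ?thesis unfolding split by (simp add: distrib_left)
  qed
  have seq: "b' + LL + (\<Sum>j<J. N j) + N0 = s"
    using s usum[of "\<lambda>_. 1"] Nsum by (simp add: N0_def)
  have blk: "(\<Prod>j<J. fact (N j) * a j ^ b j) * path_weight M C (b' + LL) (AA J) (\<lambda>k. u1 k - (\<Sum>j<J. c j k))
    \<le> (\<Prod>j<J. (\<Prod>k=1..M. fact (c j k)) * fact (b j)) * path_weight M C (b' + LL + (\<Sum>j<J. N j)) (AA 0) u1"
  proof (rule path_weight_blocks)
    fix j assume j: "j < J"
    show "N j = (\<Sum>k=1..M. c j k) + b j" by (rule N)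
    show "2 * N j + C + a j \<le> AA j" using Zcond[OF j] by (simp add: AA_def)
    have "int (AA (Suc j)) = Z (Suc j)" "int (AA j) = Z j" using Zpos j by (auto simp: AA_def)
    then have "int (AA (Suc j) + 2 * N j) = int (AA j + (\<Sum>k=1..M. k * c j k))"
      using Zstep[of j] by simp
    then show "AA (Suc j) + 2 * N j = AA j + (\<Sum>k=1..M. k * c j k)" by (simp only: of_nat_eq_iff)
  next
    fix k assume k: "k \<in> {1..M}"
    then show "(\<Sum>j<J. c j k) \<le> u1 k" using cu[OF k] by (auto simp: u1_def c0_def)
  qed (fact C)
  have A00: "AA 0 = A0" by (simp add: AA_def Z_def)
  \<comment> \<open>Total degree and total number of steps are prescribed, so the closing phases
    find exactly this number of active half-edges.\<close>
  have AJ: "AA J = LL + 2 * b'"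
  proof -
    have "int A0 = int A + int (\<Sum>k=1..M. k * c0 k) - 2 * int N0"
      using le2 unfolding A0_def by linarith
    moreover have "(\<Sum>i<J. (\<Sum>k=1..M. int k * int (c i k)) - 2 * int (N i)) =
        int (\<Sum>k=1..M. k * (\<Sum>j<J. c j k)) - 2 * int (\<Sum>j<J. N j)"
      unfolding sum_subtractf of_nat_sum of_nat_mult sum_distrib_left by (subst sum.swap) simp
    ultimately have "Z J = int A + int (\<Sum>k=1..M. k * u k) - int LL - 2 * int N0 - 2 * int (\<Sum>j<J. N j)"
      using usum[of "\<lambda>k. k"] by (simp add: Z_def)
    also have "\<dots> = int (LL + 2 * b')" using tot seq by linarith
    finally show ?thesis by (simp add: AA_def)
  qed
  have "path_weight M C LL LL v \<ge> 1" if "v 1 = LL" "\<forall>k\<in>{2..M}. v k = 0" for v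
    by (rule path_weight_leaves[OF M that])
  then have "1 \<le> path_weight M C LL LL (\<lambda>k. u1 k - (\<Sum>j<J. c j k))"
    using cu by (auto simp: u1_def c0_def LL_def)
  then have "2 ^ b' * fact b' * 1 \<le> 2 ^ b' * fact b' * path_weight M C LL LL (\<lambda>k. u1 k - (\<Sum>j<J. c j k))"
    by (rule mult_left_mono) simp
  then have "2 ^ b' * fact b' \<le> path_weight M C (b' + LL) (LL + 2 * b') (\<lambda>k. u1 k - (\<Sum>j<J. c j k))"
    using path_weight_back[OF CL, of b' M LL "\<lambda>k. u1 k - (\<Sum>j<J. c j k)"]
    by (simp only: add.commute[of b' LL] mult_1_right)
  then have "(\<Prod>j<J. fact (N j) * a j ^ b j) * (2 ^ b' * fact b') \<le>
    (\<Prod>j<J. fact (N j) * a j ^ b j) * path_weight M C (b' + LL) (AA J) (\<lambda>k. u1 k - (\<Sum>j<J. c j k))"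
    unfolding AJ by (rule mult_left_mono) simp
  also note blk
  also have "(\<Prod>j<J. (\<Prod>k=1..M. fact (c j k)) * fact (b j)) * path_weight M C (b' + LL + (\<Sum>j<J. N j)) (AA 0) u1
    \<le> (\<Prod>j<J. (\<Prod>k=1..M. fact (c j k)) * fact (b j)) * path_weight M C s A u"
    using disc unfolding A00 seq by (rule mult_left_mono) simp
  finally show ?thesis .
qed

section \<open>Factorials up to exp (o(n))\<close>

lemma odd_fact_fact: "odd_fact s * (2 ^ s * fact s) = fact (2 * s)"
proof (induction s)
  case (Suc s)
  have "odd_fact (Suc s) * (2 ^ Suc s * fact (Suc s)) = (2 * s + 2) * ((2 * s + 1) * (odd_fact s * (2 ^ s * fact s)))"
    by (simp add: algebra_simps)
  also have "\<dots> = fact (2 * Suc s)" unfolding Suc by simp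
  finally show ?case .
qed simp

lemma double_fact_odd: "s \<ge> 1 \<Longrightarrow> double_fact (2 * s - 1) = odd_fact s"
proof (induction s)
  case (Suc s)
  then show ?case by (cases s) auto
qed simp

lemma abs_xlnx_le: "0 \<le> y \<Longrightarrow> y \<le> 1 \<Longrightarrow> \<bar>y * ln y\<bar> \<le> 2 * sqrt (y::real)"
proof -
  assume y: "0 \<le> y" "y \<le> 1"
  show ?thesis
  proof (cases "y = 0")
    case False
    then have y0: "0 < y" using y by simp
    have "ln (1 / sqrt y) \<le> 1 / sqrt y - 1" using y0 by (intro ln_le_minus_one) auto
    then have "- ln y \<le> 2 * (1 / sqrt y)" using y0 by (simp add: ln_div ln_sqrt)
    then have "y * (- ln y) \<le> y * (2 * (1 / sqrt y))" using y by (intro mult_left_mono) auto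
    also have "\<dots> = 2 * (y / sqrt y)" by simp
    also have "\<dots> = 2 * sqrt y" using y by (simp only: real_div_sqrt)
    finally have "- (y * ln y) \<le> 2 * sqrt y" by simp
    moreover have "y * ln y \<le> 0" using y0 y by (intro mult_nonneg_nonpos) auto
    ultimately show ?thesis by simp
  qed simp
qed

text \<open>At 0 the logarithm is not continuous, but x ln x is, by the bound 2 sqrt x. The case
  matters because \<open>p k\<close> or \<open>1 - mass M\<close> may vanish.\<close>

lemma tendsto_xlnx:
  fixes f :: "'a \<Rightarrow> real"
  assumes "(f \<longlongrightarrow> x) F" "\<forall>\<^sub>F n in F. f n \<ge> 0" "x \<ge> 0"
  shows "((\<lambda>n. f n * ln (f n)) \<longlongrightarrow> x * ln x) F"
proof (cases "x = 0")
  case False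
  then show ?thesis using assms by (intro tendsto_intros) auto
next
  case True
  have "((\<lambda>n. f n * ln (f n)) \<longlongrightarrow> 0) F"
  proof (rule Lim_null_comparison)
    have "\<forall>\<^sub>F n in F. f n < 1" using assms(1) True by (intro order_tendstoD) auto
    then show "\<forall>\<^sub>F n in F. norm (f n * ln (f n)) \<le> 2 * sqrt (f n)"
      using assms(2) by eventually_elim (use abs_xlnx_le in auto)
    have "((\<lambda>n. 2 * sqrt (f n)) \<longlongrightarrow> 2 * sqrt 0) F" using assms(1) True by (intro tendsto_intros) auto
    then show "((\<lambda>n. 2 * sqrt (f n)) \<longlongrightarrow> 0) F" by simp
  qed
  then show ?thesis using True by simp
qed

text \<open>m^m / m! is one term of the series for exp m.\<close>

lemma ln_fact_lower: "real m * ln (real m) - real m \<le> ln (fact m)"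
proof (cases "m = 0")
  case False
  have "(\<lambda>i. inverse (fact i) * real m ^ i) sums exp (real m)" by (rule exp_converges[where 'a = real, simplified])
  then have "inverse (fact m) * real m ^ m \<le> exp (real m)"
    using sum_le_suminf[of "\<lambda>i. inverse (fact i) * real m ^ i" "{m}"] by (simp add: sums_iff)
  then have "real m ^ m \<le> exp (real m) * fact m" by (simp add: field_simps)
  then have "ln (real m ^ m) \<le> ln (exp (real m) * fact m)" using False by (subst ln_le_cancel_iff) auto
  then show ?thesis using False by (simp add: ln_mult ln_realpow)
qed simp

lemma ln_fact_upper: "m \<ge> 1 \<Longrightarrow> ln (fact m) \<le> (real m + 1) * ln (real m) - real m + 1"
proof (induction m rule: nat_induct_at_least)
  case (Suc m)
  have m: "real m > 0" using Suc by simp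
  have "ln (real m / (real m + 1)) \<le> real m / (real m + 1) - 1" using m by (intro ln_le_minus_one) auto
  also have "\<dots> = - 1 / (real m + 1)" using m by (simp add: field_simps)
  finally have "ln (real m) - ln (real m + 1) \<le> - 1 / (real m + 1)" using m by (simp add: ln_div)
  then have "(real m + 1) * (ln (real m) - ln (real m + 1)) \<le> (real m + 1) * (- 1 / (real m + 1))"
    using m by (intro mult_left_mono) auto
  then have "(real m + 1) * ln (real m) - (real m + 1) * ln (real m + 1) \<le> - 1"
    using m by (simp add: right_diff_distrib)
  moreover have "ln (fact (Suc m)) = ln (real m + 1) + ln (fact m)" by (simp add: ln_mult add.commute)
  ultimately show ?case using Suc.IH by (simp add: algebra_simps)
qed simp

text \<open>If f n = n^(m n) exp (c n + o(n)), this tends to c. In the product estimates below the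
  exponents \<open>m\<close> add up to the number of edges, so the terms with ln n cancel.\<close>

definition norm_ln :: "(nat \<Rightarrow> real) \<Rightarrow> (nat \<Rightarrow> nat) \<Rightarrow> nat \<Rightarrow> real" where
  "norm_ln f m n = (ln (f n) - real (m n) * ln (real n)) / real n"

lemma norm_ln_fact:
  assumes lim: "(\<lambda>n. real (m n) / real n) \<longlonglongrightarrow> x"
  shows "norm_ln (\<lambda>n. fact (m n)) m \<longlonglongrightarrow> x * ln x - x"
proof -
  have x: "x \<ge> 0" using lim by (rule LIMSEQ_le_const) auto
  define y where "y n = real (m n) / real n" for n
  \<comment> \<open>Error of the crude Stirling bounds, with ln m <= 2 sqrt m; it is o(1) because m
    = O(n).\<close>
  define e where "e n = (1 + 2 * sqrt (real (m n))) / real n" for n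
  have main: "(\<lambda>n. y n * ln (y n) - y n) \<longlonglongrightarrow> x * ln x - x"
    using lim x unfolding y_def by (intro tendsto_diff tendsto_xlnx) auto
  have bounds: "y n * ln (y n) - y n \<le> norm_ln (\<lambda>n. fact (m n)) m n \<and>
      norm_ln (\<lambda>n. fact (m n)) m n \<le> y n * ln (y n) - y n + e n" if n: "n \<ge> 1" for n
  proof (cases "m n = 0")
    case True
    then show ?thesis using n by (simp add: y_def norm_ln_def e_def)
  next
    case False
    then have m: "real (m n) > 0" "m n \<ge> 1" by auto
    have eq: "y n * ln (y n) - y n = (real (m n) * ln (real (m n)) - real (m n) - real (m n) * ln (real n)) / real n"
      using n m by (simp add: y_def ln_div field_simps)
    have "ln (sqrt (real (m n))) \<le> sqrt (real (m n)) - 1" using m by (intro ln_le_minus_one) auto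
    then have "ln (real (m n)) \<le> 2 * sqrt (real (m n))" using m by (simp add: ln_sqrt)
    then have "ln (fact (m n)) \<le> real (m n) * ln (real (m n)) - real (m n) + (1 + 2 * sqrt (real (m n)))"
      using ln_fact_upper[OF m(2)] by (simp add: algebra_simps)
    then have "norm_ln (\<lambda>n. fact (m n)) m n \<le> (real (m n) * ln (real (m n)) - real (m n) + (1 + 2 * sqrt (real (m n)))
      - real (m n) * ln (real n)) / real n"
      unfolding norm_ln_def using n by (intro divide_right_mono) auto
    also have "\<dots> = y n * ln (y n) - y n + e n" unfolding eq e_def by (simp add: add_divide_distrib diff_divide_distrib)
    finally have 1: "norm_ln (\<lambda>n. fact (m n)) m n \<le> y n * ln (y n) - y n + e n" .
    have "y n * ln (y n) - y n \<le> norm_ln (\<lambda>n. fact (m n)) m n"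
      unfolding eq norm_ln_def using ln_fact_lower[of "m n"] n by (intro divide_right_mono) auto
    with 1 show ?thesis by simp
  qed
  have rsqrt: "(\<lambda>n. 1 / sqrt (real n)) \<longlonglongrightarrow> 0"
    using tendsto_real_sqrt[OF lim_1_over_n[where 'a = real]] by (simp add: real_sqrt_divide)
  have "(\<lambda>n. 1 / real n + 2 * (sqrt (y n) * (1 / sqrt (real n)))) \<longlonglongrightarrow> 0 + 2 * (sqrt x * 0)"
    using lim unfolding y_def
    by (intro tendsto_intros lim_1_over_n rsqrt)
  then have e0: "(\<lambda>n. 1 / real n + 2 * (sqrt (y n) * (1 / sqrt (real n)))) \<longlonglongrightarrow> 0" by simp
  have "e n = 1 / real n + 2 * (sqrt (y n) * (1 / sqrt (real n)))" if "n \<ge> 1" for n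
    using that by (simp add: e_def y_def real_sqrt_divide add_divide_distrib)
  then have "\<forall>\<^sub>F n in sequentially. 1 / real n + 2 * (sqrt (y n) * (1 / sqrt (real n))) = e n"
    by (intro eventually_sequentiallyI[of 1]) auto
  with e0 have "e \<longlonglongrightarrow> 0" by (rule Lim_transform_eventually)
  then have "(\<lambda>n. y n * ln (y n) - y n + e n) \<longlonglongrightarrow> x * ln x - x + 0"
    by (intro tendsto_add main)
  then have up: "(\<lambda>n. y n * ln (y n) - y n + e n) \<longlonglongrightarrow> x * ln x - x" by simp
  show ?thesis
    by (rule tendsto_sandwich[OF _ _ main up]) (auto intro!: eventually_sequentiallyI[of 1] dest: bounds)
qed

text \<open>Write (2m - 1)!! as (2m)! / (2^m m!).\<close>

lemma norm_ln_odd_fact: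
  assumes lim: "(\<lambda>n. real (m n) / real n) \<longlonglongrightarrow> x"
  shows "norm_ln (\<lambda>n. odd_fact (m n)) m \<longlonglongrightarrow> x * ln (2 * x) - x"
proof -
  have x: "x \<ge> 0" using lim by (rule LIMSEQ_le_const) auto
  have lim2: "(\<lambda>n. real (2 * m n) / real n) \<longlonglongrightarrow> 2 * x"
    using tendsto_mult[OF tendsto_const[of 2] lim] by simp
  have eqn: "norm_ln (\<lambda>n. odd_fact (m n)) m n =
    norm_ln (\<lambda>n. fact (2 * m n)) (\<lambda>n. 2 * m n) n - norm_ln (\<lambda>n. fact (m n)) m n - real (m n) / real n * ln 2" for n
  proof -
    have o: "real (odd_fact (m n)) > 0" using odd_fact_fact[of "m n"] by (metis fact_gt_zero mult_zero_left of_nat_0_less_iff zero_less_iff_neq_zero)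
    have "real (odd_fact (m n)) * (2 ^ m n * fact (m n)) = fact (2 * m n)"
      using arg_cong[OF odd_fact_fact[of "m n"], of real] by simp
    then have "ln (fact (2 * m n)) = ln (real (odd_fact (m n)) * (2 ^ m n * fact (m n)))" by simp
    also have "\<dots> = ln (real (odd_fact (m n))) + (real (m n) * ln 2 + ln (fact (m n)))"
      using o by (simp add: ln_mult ln_realpow)
    finally show ?thesis
      by (simp add: norm_ln_def diff_divide_distrib add_divide_distrib)
  qed
  have limit: "(\<lambda>n. norm_ln (\<lambda>n. fact (2 * m n)) (\<lambda>n. 2 * m n) n - norm_ln (\<lambda>n. fact (m n)) m n
      - real (m n) / real n * ln 2) \<longlonglongrightarrow> ((2 * x) * ln (2 * x) - 2 * x) - (x * ln x - x) - x * ln 2"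
    by (intro tendsto_diff tendsto_mult tendsto_const norm_ln_fact lim lim2)
  have val: "((2 * x) * ln (2 * x) - 2 * x) - (x * ln x - x) - x * ln 2 = x * ln (2 * x) - x"
    using x by (cases "x = 0") (auto simp: ln_mult algebra_simps)
  show ?thesis using limit unfolding val eqn[symmetric] .
qed

section \<open>The limiting trajectory\<close>

lemma one_minus_exp_le: "1 - exp (- y) \<le> (y::real)"
  using exp_ge_add_one_self[of "- y"] by simp

lemma one_minus_exp_ge: "0 \<le> y \<Longrightarrow> y - y\<^sup>2 \<le> 1 - exp (- (y::real))"
proof -
  assume y: "0 \<le> y"
  have "1 + y \<le> exp y" by (rule exp_ge_add_one_self)
  then have "exp (- y) \<le> 1 / (1 + y)" using y by (simp add: exp_minus field_simps)
  moreover have "1 - 1 / (1 + y) \<ge> y - y\<^sup>2"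
  proof -
    have "(y - y\<^sup>2) * (1 + y) = y - y ^ 3" by (simp add: algebra_simps power2_eq_square power3_eq_cube)
    also have "\<dots> \<le> y" using y by simp
    finally have "y - y\<^sup>2 \<le> y / (1 + y)" using y by (simp add: le_divide_eq)
    also have "\<dots> = 1 - 1 / (1 + y)" using y by (simp add: field_simps)
    finally show ?thesis .
  qed
  ultimately show ?thesis by linarith
qed

context limit_distribution
begin

text \<open>Limiting density of degree k in the enlarged model: \<open>p k\<close> for the original
  vertices and \<open>p k * beta p ^ k / (1 - beta p ^ k)\<close> for the additional ones.\<close>

definition xw :: "nat \<Rightarrow> real" where "xw k = p k / (1 - beta p ^ k)"
definition total_xw :: real where "total_xw = (\<Sum>\<^sub>\<infinity>k\<in>{1..}. real k * xw k)"
definition log_surv :: real where "log_surv = (\<Sum>\<^sub>\<infinity>k\<in>{1..}. p k * ln (1 - beta p ^ k))"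
text \<open>The time at which exp (-t) = \<open>beta p\<close>; by then a fraction
  \<open>1 - beta p ^ k\<close> of the \<open>xw k\<close> vertices is discovered, which is
  \<open>p k\<close>.\<close>

definition tau :: real where "tau = - ln (beta p)"

lemma tau_pos: "0 < tau"
  using beta_props by (simp add: tau_def)

lemma exp_tau: "exp (- (real k * tau)) = beta p ^ k"
  using beta_props by (simp add: tau_def exp_of_nat_mult)

lemma xw_nonneg: "k \<ge> 1 \<Longrightarrow> 0 \<le> xw k"
  using p_nonneg[of k] one_minus_power_pos[of "beta p" k] beta_props by (simp add: xw_def)

lemma xw_eq: "k \<ge> 1 \<Longrightarrow> xw k * (1 - beta p ^ k) = p k"
  using one_minus_power_pos[of "beta p" k] beta_props by (simp add: xw_def)

lemma has_sum_total_xw: "((\<lambda>k. real k * xw k) has_sum total_xw) {1..}"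
  using has_sum_infsum[OF summable_on_div[of "beta p"]] beta_props
  by (simp add: xw_def total_xw_def)

lemma mean_eq: "mean_pos p = (1 - (beta p)\<^sup>2) * total_xw"
  using beta_props(3) by (simp add: total_xw_def xw_def)

lemma total_xw_pos: "0 < total_xw"
proof -
  have "(beta p)\<^sup>2 < 1" using beta_props power_less_one_iff[of "beta p" 2] by simp
  moreover have "0 < (1 - (beta p)\<^sup>2) * total_xw" using mean_eq mean_gt_2 by simp
  ultimately show ?thesis by (simp add: zero_less_mult_iff)
qed

text \<open>The equation for \<open>beta\<close> read at time \<open>tau\<close>: the half-edges
  still alive are just those of undiscovered vertices, so no active one is left.\<close>

lemma has_sum_tail: "((\<lambda>k. real k * xw k * beta p ^ k) has_sum ((beta p)\<^sup>2 * total_xw)) {1..}"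
proof -
  have "((\<lambda>k. real k * xw k - real k * p k) has_sum (total_xw - mean_pos p)) {1..}"
    by (intro has_sum_diff_real has_sum_total_xw has_sum_mean)
  moreover have "real k * xw k - real k * p k = real k * xw k * beta p ^ k" if "k \<in> {1..}" for k
  proof -
    have "xw k - p k = xw k * beta p ^ k" using xw_eq[of k] that by (simp add: algebra_simps)
    then show ?thesis by (metis mult.assoc right_diff_distrib)
  qed
  moreover have "total_xw - mean_pos p = (beta p)\<^sup>2 * total_xw"
    using mean_eq by (simp add: algebra_simps)
  ultimately show ?thesis by (metis (no_types, lifting) has_sum_cong)
qed

lemma ln_surv_bound:
  assumes "k \<ge> 1" shows "\<bar>ln (1 - beta p ^ k)\<bar> \<le> - ln (1 - beta p)"
proof -
  have "beta p ^ k \<le> beta p ^ 1" using beta_props assms by (intro power_decreasing) auto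
  then have "ln (1 - beta p) \<le> ln (1 - beta p ^ k)" using beta_props by (subst ln_le_cancel_iff) auto
  moreover have "ln (1 - beta p ^ k) \<le> 0"
    using beta_props one_minus_power_pos[of "beta p" k] assms by (subst ln_le_zero_iff) auto
  ultimately show ?thesis by simp
qed

lemma has_sum_log_surv: "((\<lambda>k. p k * ln (1 - beta p ^ k)) has_sum log_surv) {1..}"
proof -
  have "p summable_on {1..}" using has_sum_p by (rule has_sum_imp_summable)
  then have "(\<lambda>k. p k * (- ln (1 - beta p))) summable_on {1..}" by (rule summable_on_cmult_left)
  then have "(\<lambda>k. p k * ln (1 - beta p ^ k)) summable_on {1..}"
  proof (rule summable_on_comparison_norm)
    fix k :: nat assume "k \<in> {1..}"
    then have "p k * \<bar>ln (1 - beta p ^ k)\<bar> \<le> p k * (- ln (1 - beta p))"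
      using p_nonneg[of k] ln_surv_bound[of k] by (intro mult_left_mono) auto
    then show "norm (p k * ln (1 - beta p ^ k)) \<le> p k * (- ln (1 - beta p))"
      using p_nonneg[of k] \<open>k \<in> {1..}\<close> by (simp add: abs_mult)
  qed
  then show ?thesis unfolding log_surv_def by (rule has_sum_infsum)
qed

text \<open>Limit of \<open>norm_ln\<close> for the number of pairings and, as proved below, for the
  weight of all simple graphs; \<open>limit_conn\<close> is its counterpart for connected
  graphs.\<close>

definition limit_all :: real where "limit_all = mean_pos p / 2 * ln (mean_pos p) - mean_pos p / 2"
definition limit_conn :: real where "limit_conn = mean_pos p / 2 * ln total_xw - mean_pos p / 2 + log_surv"

lemma limit_diff: "limit_all - limit_conn = K_rate p"
proof -
  have "(beta p)\<^sup>2 < 1" using beta_props power_less_one_iff[of "beta p" 2] by simp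
  then have "ln (mean_pos p) = ln (1 - (beta p)\<^sup>2) + ln total_xw"
    unfolding mean_eq using total_xw_pos by (simp add: ln_mult)
  then show ?thesis
    by (simp add: limit_all_def limit_conn_def K_rate_def log_surv_def algebra_simps)
qed

text \<open>Comparing \<open>p\<close> with the weights 2^(-k) by ln x <= x - 1 bounds its entropy
  through the finite mean. Uniformity in \<open>M\<close> is needed in
  \<open>conn_lower_bound\<close>, where a fraction eta of this sum is left over.\<close>

lemma entropy_bound: "\<exists>B\<ge>0. \<forall>M. - B \<le> (\<Sum>k=1..M. p k * ln (real k) + p k * ln (p k))"
proof (intro exI conjI allI)
  show "0 \<le> mean_pos p + 1" using mean_gt_2 by simp
  fix M
  have "- (real k * p k) - (1 / 2) ^ k \<le> p k * ln (real k) + p k * ln (p k)" if k: "k \<ge> 1" for k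
  proof (cases "p k = 0")
    case False
    then have pk: "p k > 0" using p_nonneg[OF k] by simp
    have "ln ((1 / 2) ^ k / p k) \<le> (1 / 2) ^ k / p k - 1" using pk by (intro ln_le_minus_one) auto
    then have "p k * ln ((1 / 2) ^ k / p k) \<le> p k * ((1 / 2) ^ k / p k - 1)"
      using pk by (intro mult_left_mono) auto
    moreover have "ln ((1 / 2) ^ k / p k) = - (real k * ln 2) - ln (p k)"
      using pk by (simp add: ln_div ln_realpow)
    moreover have "p k * ((1 / 2) ^ k / p k - 1) \<le> (1 / 2) ^ k" using pk by (simp add: right_diff_distrib)
    ultimately have "p k * (- (real k * ln 2) - ln (p k)) \<le> (1 / 2) ^ k" by simp
    then have "- (p k * (real k * ln 2)) - (1 / 2) ^ k \<le> p k * ln (p k)" by (simp add: algebra_simps)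
    moreover have "p k * (real k * ln 2) \<le> p k * (real k * 1)"
      using pk ln_2_less_1 by (intro mult_left_mono) auto
    moreover have "0 \<le> p k * ln (real k)" using pk k by simp
    ultimately show ?thesis by (simp add: mult.commute)
  qed simp
  then have "(\<Sum>k=1..M. - (real k * p k) - (1 / 2) ^ k) \<le> (\<Sum>k=1..M. p k * ln (real k) + p k * ln (p k))"
    by (intro sum_mono) auto
  moreover have "(\<Sum>k=1..M. real k * p k) \<le> mean_pos p"
    using p_nonneg by (intro sum_le_has_sum_from_1[OF has_sum_mean]) auto
  moreover have "(\<Sum>k=1..M. (1 / 2) ^ k) \<le> (1::real)"
  proof -
    have "(\<Sum>k=1..M. (1 / 2) ^ k) = 1 - (1 / 2 :: real) ^ M" by (induction M) (auto simp: field_simps)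
    then show ?thesis by simp
  qed
  ultimately show "- (mean_pos p + 1) \<le> (\<Sum>k=1..M. p k * ln (real k) + p k * ln (p k))"
    by (simp add: sum_subtractf sum_negf)
qed

text \<open>\<open>alpha M t\<close> is the rescaled number of active half-edges at time \<open>t\<close> in the exploration of the
  tilted model in which half-edges die at rate 1: of the vertices of degree \<open>k\<close> a fraction
  \<open>exp (- k t)\<close> is still undiscovered, and a fraction \<open>exp (- 2 t)\<close> of all half-edges is alive.\<close>

definition alpha :: "nat \<Rightarrow> real \<Rightarrow> real" where
  "alpha M t = total_xw * exp (- (2 * t)) - (\<Sum>k=1..M. real k * xw k * exp (- (real k * t)))"

text \<open>Mass of vertices of degree k discovered between t and t + D.\<close>

definition gam :: "nat \<Rightarrow> real \<Rightarrow> real \<Rightarrow> real" where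
  "gam k t D = xw k * (exp (- (real k * t)) - exp (- (real k * (t + D))))"

text \<open>Mass of exploration steps in the same interval: a step kills two half-edges, hence the
  factor 1/2.\<close>

definition sig :: "real \<Rightarrow> real \<Rightarrow> real" where
  "sig t D = total_xw / 2 * (exp (- (2 * t)) - exp (- (2 * (t + D))))"

text \<open>The steps that discover nothing, that is, close a cycle.\<close>

definition bck :: "nat \<Rightarrow> real \<Rightarrow> real \<Rightarrow> real" where
  "bck M t D = sig t D - (\<Sum>k=1..M. gam k t D)"

definition second_moment :: "nat \<Rightarrow> real" where
  "second_moment M = (\<Sum>k=1..M. (real k)\<^sup>2 * xw k)"

text \<open>On [b, 1] the convex function x^(k-2) lies below its chord, and z is the point with
  weight l on b. For k = 1 the exponent is -1 and the chord inequality for 1/x is derived by hand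
  from b + 1/b >= 2.\<close>

lemma power_chord:
  fixes b l :: real
  assumes b: "0 < b" "b < 1" and l: "0 \<le> l" "l \<le> 1" and k: "k \<ge> 1"
  defines "z \<equiv> l * b + (1 - l)"
  shows "z ^ k \<le> z\<^sup>2 * (l * (b ^ k / b\<^sup>2) + (1 - l))"
proof (cases "k = 1")
  case True
  have z: "0 \<le> z" using b l by (simp add: z_def)
  have "2 \<le> b + 1 / b"
  proof -
    have "0 \<le> (1 - b)\<^sup>2 / b" using b by simp
    also have "\<dots> = b + 1 / b - 2" using b by (simp add: field_simps power2_eq_square)
    finally show ?thesis by simp
  qed
  then have "l * (1 - l) * 2 \<le> l * (1 - l) * (b + 1 / b)" using l by (intro mult_left_mono) auto
  then have "1 \<le> l\<^sup>2 + (1 - l)\<^sup>2 + l * (1 - l) * (b + 1 / b)"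
    by (simp add: power2_eq_square algebra_simps)
  also have "\<dots> = z * (l / b + (1 - l))" using b by (simp add: z_def field_simps power2_eq_square)
  finally have "z * 1 \<le> z * (z * (l / b + (1 - l)))" using z by (intro mult_left_mono) auto
  then show ?thesis using True b by (simp add: power2_eq_square mult.assoc)
next
  case False
  then have k2: "k = (k - 2) + 2" using k by simp
  have "convex_on {0::real..} (\<lambda>x. x ^ (k - 2))"
    using convex_power_even[of "k - 2"] convex_power_odd[of "k - 2"] by (cases "even (k - 2)") (auto intro: convex_on_subset)
  from convex_onD[OF this, of "1 - l" b 1]
  have "z ^ (k - 2) \<le> l * b ^ (k - 2) + (1 - l)"
    using b l by (simp add: z_def)
  then have "z\<^sup>2 * z ^ (k - 2) \<le> z\<^sup>2 * (l * b ^ (k - 2) + (1 - l))" by (intro mult_left_mono) auto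
  moreover have "z\<^sup>2 * z ^ (k - 2) = z ^ k" using k2 by (metis power_add mult.commute)
  moreover have "b ^ (k - 2) = b ^ k / b\<^sup>2" using b using k2 power_add[of b "k - 2" 2] by simp
  ultimately show ?thesis by simp
qed

text \<open>Put z = exp (-t). Divided by z^2, the sum over degrees lies below its chord between z =
  \<open>beta p\<close> and z = 1. At both ends it is at most \<open>total_xw\<close>, with equality
  in the limit of large \<open>M\<close>.\<close>

lemma alpha_nonneg:
  assumes t: "0 \<le> t" "t \<le> tau" shows "0 \<le> alpha M t"
proof -
  define b where "b = beta p"
  have b: "0 < b" "b < 1" using beta_props by (simp_all add: b_def)
  define z where "z = exp (- t)"
  have z: "b \<le> z" "z \<le> 1"
  proof -
    have "b = exp (- tau)" using exp_tau[of 1] by (simp add: b_def)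
    then show "b \<le> z" using t by (simp add: z_def)
  qed (use t in \<open>simp add: z_def\<close>)
  define l where "l = (1 - z) / (1 - b)"
  have l: "0 \<le> l" "l \<le> 1" using z b by (simp_all add: l_def)
  have zl: "z = l * b + (1 - l)"
  proof -
    have "l * (1 - b) = 1 - z" using b by (simp add: l_def)
    then show ?thesis by (simp add: algebra_simps)
  qed
  have ez: "exp (- (real k * t)) = z ^ k" for k
    by (simp add: z_def exp_of_nat_mult[symmetric])
  have "(\<Sum>k=1..M. real k * xw k * z ^ k) \<le> (\<Sum>k=1..M. real k * xw k * (z\<^sup>2 * (l * (b ^ k / b\<^sup>2) + (1 - l))))"
  proof (rule sum_mono)
    fix k assume "k \<in> {1..M}"
    then show "real k * xw k * z ^ k \<le> real k * xw k * (z\<^sup>2 * (l * (b ^ k / b\<^sup>2) + (1 - l)))"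
      using power_chord[OF b l, of k] xw_nonneg[of k] unfolding zl by (intro mult_left_mono) auto
  qed
  also have "\<dots> = z\<^sup>2 * (l / b\<^sup>2 * (\<Sum>k=1..M. real k * xw k * b ^ k) + (1 - l) * (\<Sum>k=1..M. real k * xw k))"
    unfolding sum_distrib_left sum.distrib[symmetric] by (intro sum.cong) (auto simp: algebra_simps)
  also have "\<dots> \<le> z\<^sup>2 * (l / b\<^sup>2 * (b\<^sup>2 * total_xw) + (1 - l) * total_xw)"
  proof -
    have "(\<Sum>k=1..M. real k * xw k * b ^ k) \<le> b\<^sup>2 * total_xw"
      unfolding b_def using xw_nonneg beta_props by (intro sum_le_has_sum_from_1[OF has_sum_tail]) auto
    moreover have "(\<Sum>k=1..M. real k * xw k) \<le> total_xw"
      using xw_nonneg by (intro sum_le_has_sum_from_1[OF has_sum_total_xw]) auto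
    ultimately show ?thesis using l by (intro mult_left_mono add_mono) auto
  qed
  also have "\<dots> = total_xw * z\<^sup>2" using b by (simp add: algebra_simps)
  finally show ?thesis unfolding alpha_def ez using ez[of 2] by simp
qed

lemma second_moment_pos: "M \<ge> 1 \<Longrightarrow> 0 < second_moment M"
proof -
  assume M: "M \<ge> 1"
  have "0 < xw 1" using p1 beta_props by (simp add: xw_def)
  also have "xw 1 = (real 1)\<^sup>2 * xw 1" by simp
  also have "\<dots> \<le> second_moment M"
    unfolding second_moment_def using M xw_nonneg by (intro member_le_sum) auto
  finally show ?thesis .
qed

lemma gam_nonneg: "k \<ge> 1 \<Longrightarrow> 0 \<le> D \<Longrightarrow> 0 \<le> gam k t D"
  unfolding gam_def using xw_nonneg[of k] by (intro mult_nonneg_nonneg) auto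

lemma exp_split: "exp (- (c * t)) - exp (- (c * (t + D))) = exp (- (c * t)) * (1 - exp (- (c * (D::real))))"
  by (simp add: algebra_simps exp_add[symmetric])

lemma gam_upper:
  assumes "k \<ge> 1" shows "gam k t D \<le> D * (real k * xw k * exp (- (real k * t)))"
proof -
  have "exp (- (real k * t)) * (1 - exp (- (real k * D))) \<le> exp (- (real k * t)) * (real k * D)"
    by (intro mult_left_mono one_minus_exp_le) auto
  then have "gam k t D \<le> xw k * (exp (- (real k * t)) * (real k * D))"
    unfolding gam_def exp_split using xw_nonneg[OF assms] by (rule mult_left_mono)
  then show ?thesis by (simp add: mult_ac)
qed

lemma gam_lower:
  assumes "k \<ge> 1" "0 \<le> D" "0 \<le> t"
  shows "D * (real k * xw k * exp (- (real k * t))) - D\<^sup>2 * ((real k)\<^sup>2 * xw k) \<le> gam k t D"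
proof -
  have "exp (- (real k * t)) * (real k * D - (real k * D)\<^sup>2) \<le> exp (- (real k * t)) * (1 - exp (- (real k * D)))"
    using assms by (intro mult_left_mono one_minus_exp_ge) auto
  moreover have "exp (- (real k * t)) * (real k * D)\<^sup>2 \<le> 1 * (real k * D)\<^sup>2"
    using assms by (intro mult_right_mono) auto
  ultimately have "exp (- (real k * t)) * (real k * D) - (real k * D)\<^sup>2 \<le> exp (- (real k * t)) * (1 - exp (- (real k * D)))"
    by (simp add: right_diff_distrib)
  then have "xw k * (exp (- (real k * t)) * (real k * D) - (real k * D)\<^sup>2) \<le> gam k t D"
    unfolding gam_def exp_split using xw_nonneg[OF assms(1)] by (rule mult_left_mono)
  then show ?thesis by (simp add: algebra_simps power_mult_distrib)
qed

lemma gam_upper_end: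
  assumes "k \<ge> 1" "0 \<le> D" "0 \<le> t"
  shows "gam k t D \<le> D * (real k * xw k * exp (- (real k * (t + D)))) + D\<^sup>2 * ((real k)\<^sup>2 * xw k)"
proof -
  have "exp (- (real k * t)) - exp (- (real k * (t + D))) \<le> 1 * (real k * D)"
    unfolding exp_split using assms by (intro mult_mono one_minus_exp_le) auto
  then have "real k * D * exp (- (real k * t)) \<le> real k * D * (exp (- (real k * (t + D))) + real k * D)"
    using assms by (intro mult_left_mono) auto
  then have "xw k * (real k * D * exp (- (real k * t))) \<le> xw k * (real k * D * (exp (- (real k * (t + D))) + real k * D))"
    using xw_nonneg[OF assms(1)] by (rule mult_left_mono)
  then show ?thesis using gam_upper[OF assms(1), of t D]
    by (simp add: algebra_simps power2_eq_square)
qed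

lemma sig_upper: "sig t D \<le> D * (total_xw * exp (- (2 * t)))"
proof -
  have "exp (- (2 * t)) * (1 - exp (- (2 * D))) \<le> exp (- (2 * t)) * (2 * D)"
    by (intro mult_left_mono one_minus_exp_le) auto
  then have "sig t D \<le> total_xw / 2 * (exp (- (2 * t)) * (2 * D))"
    unfolding sig_def exp_split using total_xw_pos by (intro mult_left_mono) auto
  then show ?thesis by (simp add: mult_ac)
qed

lemma sig_lower: "D * (total_xw * exp (- (2 * (t + D)))) \<le> sig t D"
proof -
  have "exp (- (2 * t)) = exp (- (2 * (t + D))) * exp (2 * D)" by (simp add: exp_add[symmetric] algebra_simps)
  then have "exp (- (2 * t)) - exp (- (2 * (t + D))) = exp (- (2 * (t + D))) * (exp (2 * D) - 1)"
    by (simp add: right_diff_distrib)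
  moreover have "2 * D \<le> exp (2 * D) - 1" using exp_ge_add_one_self[of "2 * D"] by linarith
  ultimately have "exp (- (2 * (t + D))) * (2 * D) \<le> exp (- (2 * t)) - exp (- (2 * (t + D)))" by simp
  then have "total_xw / 2 * (exp (- (2 * (t + D))) * (2 * D)) \<le> sig t D"
    unfolding sig_def using total_xw_pos by (intro mult_left_mono) auto
  then show ?thesis by (simp add: mult_ac)
qed

text \<open>Cycles are closed at rate \<open>alpha\<close>: the function f has this derivative and
  its increment is \<open>bck\<close>.\<close>

lemma bck_nonneg:
  assumes "0 \<le> t" "0 \<le> D" "t + D \<le> tau" shows "0 \<le> bck M t D"
proof -
  define f where "f s = - total_xw / 2 * exp (- (2 * s)) + (\<Sum>k=1..M. xw k * exp (- (real k * s)))" for s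
  have "f t \<le> f (t + D)"
  proof (rule DERIV_nonneg_imp_nondecreasing[of t "t + D" f])
    fix s assume s: "t \<le> s" "s \<le> t + D"
    have "(f has_real_derivative (- total_xw / 2 * (exp (- (2 * s)) * - 2) +
        (\<Sum>k=1..M. xw k * (exp (- (real k * s)) * - real k)))) (at s)"
      unfolding f_def by (intro DERIV_add DERIV_sum) (auto intro!: derivative_eq_intros)
    moreover have "(\<Sum>k=1..M. xw k * (exp (- (real k * s)) * - real k)) = - (\<Sum>k=1..M. real k * xw k * exp (- (real k * s)))"
      unfolding sum_negf[symmetric] by (rule sum.cong) auto
    then have "- total_xw / 2 * (exp (- (2 * s)) * - 2) + (\<Sum>k=1..M. xw k * (exp (- (real k * s)) * - real k)) = alpha M s"
      unfolding alpha_def by simp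
    ultimately show "\<exists>y. (f has_real_derivative y) (at s) \<and> 0 \<le> y"
      using alpha_nonneg[of s M] s assms by (intro exI[of _ "alpha M s"]) auto
  qed (use assms in simp_all)
  moreover have "f (t + D) - f t = bck M t D"
    unfolding f_def bck_def sig_def gam_def by (simp add: right_diff_distrib sum_subtractf)
  ultimately show ?thesis by simp
qed

lemma bck_upper:
  assumes "0 \<le> t" "0 \<le> D" shows "bck M t D \<le> D * (alpha M t + D * second_moment M)"
proof -
  have "(\<Sum>k=1..M. D * (real k * xw k * exp (- (real k * t))) - D\<^sup>2 * ((real k)\<^sup>2 * xw k)) \<le> (\<Sum>k=1..M. gam k t D)"
    using assms by (intro sum_mono gam_lower) auto
  then show ?thesis using sig_upper[of t D]
    by (simp add: bck_def alpha_def second_moment_def sum_subtractf sum_distrib_left[symmetric] algebra_simps power2_eq_square)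
qed

text \<open>Evaluated at the end of the interval, where the summation by parts in
  \<open>total_entropy\<close> puts \<open>alpha\<close>.\<close>

lemma bck_lower:
  assumes "0 \<le> t" "0 \<le> D" shows "D * alpha M (t + D) - D\<^sup>2 * second_moment M \<le> bck M t D"
proof -
  have "(\<Sum>k=1..M. gam k t D) \<le> (\<Sum>k=1..M. D * (real k * xw k * exp (- (real k * (t + D)))) + D\<^sup>2 * ((real k)\<^sup>2 * xw k))"
    using assms by (intro sum_mono gam_upper_end) auto
  then have "(\<Sum>k=1..M. gam k t D) \<le> D * (\<Sum>k=1..M. real k * xw k * exp (- (real k * (t + D)))) + D\<^sup>2 * second_moment M"
    by (simp only: sum.distrib second_moment_def sum_distrib_left)
  then show ?thesis using sig_lower[of D t]
    by (simp add: bck_def alpha_def right_diff_distrib)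
qed

text \<open>Exact discrete balance of active half-edges, of the same form as the balance in
  \<open>path_weight_blocks\<close>; the rounded blocks inherit it in the limit.\<close>

lemma alpha_step: "alpha M (t + D) = alpha M t + (\<Sum>k=1..M. real k * gam k t D) - 2 * sig t D"
proof -
  have "(\<Sum>k=1..M. real k * gam k t D) =
      (\<Sum>k=1..M. real k * xw k * exp (- (real k * t))) - (\<Sum>k=1..M. real k * xw k * exp (- (real k * (t + D))))"
    unfolding sum_subtractf[symmetric] by (intro sum.cong) (auto simp: gam_def algebra_simps)
  then show ?thesis by (simp add: alpha_def sig_def algebra_simps)
qed

lemma sum_gam:
  assumes "J > 0" "k \<ge> 1"
  shows "(\<Sum>j<J. gam k (real j * (tau / real J)) (tau / real J)) = p k"
proof -
  define e where "e j = exp (- (real k * (real j * (tau / real J))))" for j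
  have "gam k (real j * (tau / real J)) (tau / real J) = xw k * (e j - e (Suc j))" for j
  proof -
    have "real (Suc j) * (tau / real J) = real j * (tau / real J) + tau / real J"
      unfolding of_nat_Suc distrib_right by simp
    then show ?thesis unfolding gam_def e_def by presburger
  qed
  then have "(\<Sum>j<J. gam k (real j * (tau / real J)) (tau / real J)) = xw k * (\<Sum>j<J. e j - e (Suc j))"
    by (simp add: sum_distrib_left)
  also have "(\<Sum>j<J. e j - e (Suc j)) = e 0 - e J" by (rule sum_lessThan_telescope')
  also have "\<dots> = 1 - beta p ^ k" using assms exp_tau[of k] by (simp add: e_def)
  finally show ?thesis using xw_eq[OF assms(2)] by simp
qed

lemma sum_sig:
  assumes "J > 0"
  shows "(\<Sum>j<J. sig (real j * (tau / real J)) (tau / real J)) = mean_pos p / 2"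
proof -
  define e where "e j = exp (- (2 * (real j * (tau / real J))))" for j
  have "sig (real j * (tau / real J)) (tau / real J) = total_xw / 2 * (e j - e (Suc j))" for j
  proof -
    have "real (Suc j) * (tau / real J) = real j * (tau / real J) + tau / real J"
      unfolding of_nat_Suc distrib_right by simp
    then show ?thesis unfolding sig_def e_def by presburger
  qed
  then have "(\<Sum>j<J. sig (real j * (tau / real J)) (tau / real J)) = total_xw / 2 * (\<Sum>j<J. e j - e (Suc j))"
    by (simp only: sum_distrib_left)
  also have "(\<Sum>j<J. e j - e (Suc j)) = e 0 - e J" by (rule sum_lessThan_telescope')
  also have "\<dots> = 1 - (beta p)\<^sup>2" using assms exp_tau[of 2] by (simp add: e_def)
  finally show ?thesis using mean_eq by simp
qed

text \<open>The right side is the limiting log count of a block: the orderings of its steps, times B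
  rescaled choices for each closed cycle. On the left \<open>sig\<close> is estimated by its rate at
  the end of the interval, \<open>gam\<close> and \<open>bck\<close> by upper bounds; ln B then
  cancels.\<close>

lemma block_entropy:
  assumes t: "0 \<le> t" and D: "0 < D" and tD: "t + D \<le> tau" and M: "M \<ge> 1"
  defines "B \<equiv> alpha M t + D * second_moment M"
  shows "sig t D * (ln total_xw - 2 * (t + D)) - (\<Sum>k=1..M. gam k t D * (ln (real k * xw k) - real k * t))
    \<le> sig t D * ln (sig t D) - (\<Sum>k=1..M. gam k t D * ln (gam k t D)) - bck M t D * ln (bck M t D)
      + bck M t D * ln B"
proof -
  have B: "0 < B" using alpha_nonneg[of t M] second_moment_pos[OF M] t D tD by (simp add: B_def add_nonneg_pos)
  have s0: "0 < D * (total_xw * exp (- (2 * (t + D))))" using D total_xw_pos by simp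
  then have sp: "0 < sig t D" using sig_lower[of D t] by linarith
  have "ln (D * (total_xw * exp (- (2 * (t + D))))) \<le> ln (sig t D)"
    using s0 sp sig_lower[of D t] by (subst ln_le_cancel_iff) auto
  then have "ln D + (ln total_xw - 2 * (t + D)) \<le> ln (sig t D)"
    using D total_xw_pos by (simp add: ln_mult)
  then have S: "sig t D * (ln D + (ln total_xw - 2 * (t + D))) \<le> sig t D * ln (sig t D)"
    using sp by (intro mult_left_mono) auto
  have "(\<Sum>k=1..M. gam k t D * ln (gam k t D)) \<le> (\<Sum>k=1..M. gam k t D * (ln D + (ln (real k * xw k) - real k * t)))"
  proof (rule sum_mono)
    fix k assume "k \<in> {1..M}"
    then have k: "k \<ge> 1" by simp
    show "gam k t D * ln (gam k t D) \<le> gam k t D * (ln D + (ln (real k * xw k) - real k * t))"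
    proof (cases "gam k t D = 0")
      case False
      then have g: "0 < gam k t D" using gam_nonneg[OF k, of D t] D by simp
      have x: "0 < real k * xw k" using False xw_nonneg[OF k] k by (auto simp: gam_def)
      have "ln (gam k t D) \<le> ln (D * (real k * xw k * exp (- (real k * t))))"
        using g x D gam_upper[OF k, of t D] by (subst ln_le_cancel_iff) auto
      also have "\<dots> = ln D + (ln (real k * xw k) - real k * t)"
      proof -
        have "ln (D * (real k * xw k * exp (- (real k * t)))) = ln D + ln (real k * xw k * exp (- (real k * t)))"
          using x D by (intro ln_mult_pos) auto
        also have "ln (real k * xw k * exp (- (real k * t))) = ln (real k * xw k) + ln (exp (- (real k * t)))"
          using x by (intro ln_mult_pos) auto
        finally show ?thesis by simp
      qed
      finally show ?thesis using g by (intro mult_left_mono) auto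
    qed simp
  qed
  also have "\<dots> = ln D * (\<Sum>k=1..M. gam k t D) + (\<Sum>k=1..M. gam k t D * (ln (real k * xw k) - real k * t))"
    unfolding sum_distrib_left sum.distrib[symmetric] by (intro sum.cong) (auto simp: algebra_simps)
  finally have G: "(\<Sum>k=1..M. gam k t D * ln (gam k t D)) \<le>
    ln D * (\<Sum>k=1..M. gam k t D) + (\<Sum>k=1..M. gam k t D * (ln (real k * xw k) - real k * t))" .
  have Bk: "bck M t D * ln (bck M t D) \<le> bck M t D * (ln D + ln B)"
  proof (cases "bck M t D = 0")
    case False
    then have b: "0 < bck M t D" using bck_nonneg[of t D M] t D tD by simp
    have "ln (bck M t D) \<le> ln (D * B)"
      using b D B bck_upper[of t D M] t unfolding B_def[symmetric] by (subst ln_le_cancel_iff) auto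
    also have "\<dots> = ln D + ln B" using D B by (simp add: ln_mult)
    finally show ?thesis using b by (intro mult_left_mono) auto
  qed simp
  \<comment> \<open>The terms with ln D cancel because every step either discovers a vertex or
    closes a cycle.\<close>
  have "sig t D * ln D = ln D * (\<Sum>k=1..M. gam k t D) + bck M t D * ln D"
    by (simp add: bck_def algebra_simps)
  with S G Bk show ?thesis by (simp add: algebra_simps)
qed

lemma abel_sum: "(\<Sum>j<J. real j * D * (f (Suc j) - f j)) = real J * D * f J - D * (\<Sum>j<J. f (Suc j))" for f :: "nat \<Rightarrow> real"
  by (induction J) (auto simp: algebra_simps)

text \<open>By \<open>alpha_step\<close> the terms of \<open>block_entropy\<close> that are linear
  in time combine to t times the increment of \<open>alpha\<close>. Summation by parts turns them
  into a negative Riemann sum of \<open>alpha\<close>, which by \<open>bck_lower\<close> is at least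
  minus the total of \<open>bck\<close> up to O(D). The integral itself is never formed.\<close>

lemma total_entropy:
  assumes J: "J > 0" and M: "M \<ge> 1"
  defines "D \<equiv> tau / real J"
  defines "t \<equiv> \<lambda>j. real j * D"
  shows "mean_pos p / 2 * ln total_xw - (\<Sum>k=1..M. p k * ln (real k * xw k)) - mean_pos p / 2 + (\<Sum>k=1..M. p k)
      - D * (tau * second_moment M + mean_pos p)
    \<le> (\<Sum>j<J. sig (t j) D * ln (sig (t j) D) - (\<Sum>k=1..M. gam k (t j) D * ln (gam k (t j) D))
        - bck M (t j) D * ln (bck M (t j) D) + bck M (t j) D * ln (alpha M (t j) + D * second_moment M))"
proof -
  have D: "0 < D" using J tau_pos by (simp add: D_def)
  have JD: "real J * D = tau" using J by (simp add: D_def)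
  have t0: "0 \<le> t j" for j using D by (simp add: t_def)
  have tS: "t j + D = t (Suc j)" for j by (simp add: t_def algebra_simps)
  have tle: "t j + D \<le> tau" if "j < J" for j
  proof -
    have "real (Suc j) * D \<le> real J * D" using that D by (intro mult_right_mono) auto
    then show ?thesis unfolding tS JD by (simp only: t_def)
  qed
  have gsum: "(\<Sum>j<J. gam k (t j) D) = p k" if "k \<ge> 1" for k
    using sum_gam[OF J that] by (simp add: t_def D_def)
  have ssum: "(\<Sum>j<J. sig (t j) D) = mean_pos p / 2"
    using sum_sig[OF J] by (simp add: t_def D_def)
  have bsum: "(\<Sum>j<J. bck M (t j) D) = mean_pos p / 2 - (\<Sum>k=1..M. p k)"
  proof -
    have "(\<Sum>j<J. \<Sum>k=1..M. gam k (t j) D) = (\<Sum>k=1..M. p k)"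
      using gsum by (subst sum.swap) auto
    then show ?thesis by (simp add: bck_def sum_subtractf ssum)
  qed
  have al: "alpha M (t (Suc j)) - alpha M (t j) = (\<Sum>k=1..M. real k * gam k (t j) D) - 2 * sig (t j) D" for j
    using alpha_step[of M "t j" D] unfolding tS by simp
  have "(\<Sum>j<J. sig (t j) D * (ln total_xw - 2 * (t j + D)) - (\<Sum>k=1..M. gam k (t j) D * (ln (real k * xw k) - real k * t j)))
    = (\<Sum>j<J. ln total_xw * sig (t j) D - 2 * D * sig (t j) D - (\<Sum>k=1..M. ln (real k * xw k) * gam k (t j) D)
        + real j * D * (alpha M (t (Suc j)) - alpha M (t j)))"
  proof (rule sum.cong)
    fix j
    have "(\<Sum>k=1..M. gam k (t j) D * (ln (real k * xw k) - real k * t j)) =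
        (\<Sum>k=1..M. ln (real k * xw k) * gam k (t j) D) - t j * (\<Sum>k=1..M. real k * gam k (t j) D)"
      unfolding sum_distrib_left sum_subtractf[symmetric] by (intro sum.cong) (auto simp: algebra_simps)
    then show "sig (t j) D * (ln total_xw - 2 * (t j + D)) - (\<Sum>k=1..M. gam k (t j) D * (ln (real k * xw k) - real k * t j))
      = ln total_xw * sig (t j) D - 2 * D * sig (t j) D - (\<Sum>k=1..M. ln (real k * xw k) * gam k (t j) D)
        + real j * D * (alpha M (t (Suc j)) - alpha M (t j))"
      unfolding al t_def[symmetric] by (simp add: algebra_simps t_def)
  qed simp
  also have "\<dots> = ln total_xw * (mean_pos p / 2) - 2 * D * (mean_pos p / 2) - (\<Sum>k=1..M. ln (real k * xw k) * p k)
      + (tau * alpha M (t J) - D * (\<Sum>j<J. alpha M (t (Suc j))))"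
  proof -
    have "(\<Sum>j<J. \<Sum>k=1..M. ln (real k * xw k) * gam k (t j) D) = (\<Sum>k=1..M. ln (real k * xw k) * p k)"
      using gsum by (subst sum.swap) (auto simp: sum_distrib_left[symmetric])
    moreover have "(\<Sum>j<J. real j * D * (alpha M (t (Suc j)) - alpha M (t j))) =
        tau * alpha M (t J) - D * (\<Sum>j<J. alpha M (t (Suc j)))"
      using abel_sum[where f = "\<lambda>j. alpha M (t j)" and D = D and J = J] JD by simp
    ultimately show ?thesis
      by (simp add: sum.distrib sum_subtractf sum_distrib_left[symmetric] ssum)
  qed
  finally have eq: "(\<Sum>j<J. sig (t j) D * (ln total_xw - 2 * (t j + D)) - (\<Sum>k=1..M. gam k (t j) D * (ln (real k * xw k) - real k * t j)))
    = ln total_xw * (mean_pos p / 2) - 2 * D * (mean_pos p / 2) - (\<Sum>k=1..M. ln (real k * xw k) * p k)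
      + (tau * alpha M (t J) - D * (\<Sum>j<J. alpha M (t (Suc j))))" .
  have "0 \<le> alpha M (t J)" using t0[of J] JD by (intro alpha_nonneg) (auto simp: t_def)
  then have aJ: "0 \<le> tau * alpha M (t J)" using tau_pos by simp
  have "(\<Sum>j<J. D * alpha M (t (Suc j)) - D\<^sup>2 * second_moment M) \<le> (\<Sum>j<J. bck M (t j) D)"
    using bck_lower[OF t0, of D M] D by (intro sum_mono) (simp add: tS)
  then have h1: "D * (\<Sum>j<J. alpha M (t (Suc j))) - real J * (D\<^sup>2 * second_moment M) \<le> mean_pos p / 2 - (\<Sum>k=1..M. p k)"
    by (simp add: sum_subtractf sum_distrib_left bsum)
  have h2: "real J * (D\<^sup>2 * second_moment M) = D * (tau * second_moment M)"
    unfolding JD[symmetric] by (simp add: power2_eq_square)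
  have h3: "(\<Sum>k=1..M. ln (real k * xw k) * p k) = (\<Sum>k=1..M. p k * ln (real k * xw k))"
    by (simp add: mult.commute)
  have h4: "mean_pos p / 2 * ln total_xw = ln total_xw * (mean_pos p / 2)" "2 * D * (mean_pos p / 2) = D * mean_pos p"
    by simp_all
  have "mean_pos p / 2 * ln total_xw - (\<Sum>k=1..M. p k * ln (real k * xw k)) - mean_pos p / 2 + (\<Sum>k=1..M. p k)
      - D * (tau * second_moment M + mean_pos p) \<le>
    (\<Sum>j<J. sig (t j) D * (ln total_xw - 2 * (t j + D)) - (\<Sum>k=1..M. gam k (t j) D * (ln (real k * xw k) - real k * t j)))"
    unfolding eq unfolding distrib_left h4 h3 using aJ h1 h2 by linarith
  also have "\<dots> \<le> (\<Sum>j<J. sig (t j) D * ln (sig (t j) D) - (\<Sum>k=1..M. gam k (t j) D * ln (gam k (t j) D))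
        - bck M (t j) D * ln (bck M (t j) D) + bck M (t j) D * ln (alpha M (t j) + D * second_moment M))"
    using D M tle t0 by (intro sum_mono block_entropy) auto
  finally show ?thesis .
qed

lemma p_ln_xw: "k \<ge> 1 \<Longrightarrow> p k * ln (real k * xw k) = p k * ln (real k) + p k * ln (p k) - p k * ln (1 - beta p ^ k)"
proof (cases "p k = 0")
  case False
  assume k: "k \<ge> 1"
  have "0 < p k" "0 < 1 - beta p ^ k"
    using p_nonneg[OF k] False one_minus_power_pos[of "beta p" k] beta_props k by auto
  then show ?thesis using k by (simp add: xw_def ln_mult ln_div algebra_simps)
qed simp

end

section \<open>Asymptotics\<close>

lemma nat_floor_lim:
  assumes "0 \<le> (c::real)"
  shows "(\<lambda>n. real (nat \<lfloor>real n * c\<rfloor>) / real n) \<longlonglongrightarrow> c"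
proof (rule tendsto_sandwich[OF _ _ _ tendsto_const])
  have "(\<lambda>n. c - 1 / real n) \<longlonglongrightarrow> c - 0" by (intro tendsto_diff tendsto_const lim_1_over_n)
  then show "(\<lambda>n. c - 1 / real n) \<longlonglongrightarrow> c" by simp
  have "real n * c - 1 \<le> real (nat \<lfloor>real n * c\<rfloor>)" for n by linarith
  then show "\<forall>\<^sub>F n in sequentially. c - 1 / real n \<le> real (nat \<lfloor>real n * c\<rfloor>) / real n"
  proof (intro eventually_sequentiallyI[of 1])
    fix n :: nat assume "1 \<le> n"
    then have "c - 1 / real n = (real n * c - 1) / real n" by (simp add: diff_divide_distrib)
    also have "\<dots> \<le> real (nat \<lfloor>real n * c\<rfloor>) / real n"
      using \<open>\<And>n. real n * c - 1 \<le> real (nat \<lfloor>real n * c\<rfloor>)\<close> by (rule divide_right_mono) simp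
    finally show "c - 1 / real n \<le> real (nat \<lfloor>real n * c\<rfloor>) / real n" .
  qed
  have "real (nat \<lfloor>real n * c\<rfloor>) \<le> real n * c" for n
    using assms by (simp add: of_nat_nat)
  then show "\<forall>\<^sub>F n in sequentially. real (nat \<lfloor>real n * c\<rfloor>) / real n \<le> c"
    by (intro eventually_sequentiallyI[of 1]) (simp add: divide_le_eq mult.commute)
qed

lemma eventually_gt_of_lim:
  fixes f g :: "nat \<Rightarrow> real"
  assumes "g \<longlonglongrightarrow> l" "a < l" "\<forall>\<^sub>F n in sequentially. g n \<le> f n"
  shows "\<forall>\<^sub>F n in sequentially. a < f n"
  using order_tendstoD(1)[OF assms(1,2)] assms(3) by eventually_elim auto

lemma eventually_less_of_lim:
  fixes f g :: "nat \<Rightarrow> real"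
  assumes "f \<longlonglongrightarrow> l" "g \<longlonglongrightarrow> l'" "l < l'"
  shows "\<forall>\<^sub>F n in sequentially. f n < g n"
proof -
  obtain a where a: "l < a" "a < l'" using dense[OF assms(3)] by auto
  show ?thesis
    using order_tendstoD(2)[OF assms(1) a(1)] order_tendstoD(1)[OF assms(2) a(2)] by eventually_elim auto
qed

lemma odd_fact_pos: "odd_fact s > 0"
  by (induction s) auto

lemma ln_binomial_fact:
  "ln (real ((e + u) choose u)) = ln (fact (e + u)) - ln (fact e) - ln (fact u)"
proof -
  have "real ((e + u) choose u) = fact (e + u) / (fact u * fact e)"
    by (simp add: binomial_fact)
  then show ?thesis by (simp add: ln_div ln_mult)
qed

section \<open>Degree sequences with a limiting distribution, and the upper bounds\<close>

locale degree_sequences = limit_distribution p for p :: "nat \<Rightarrow> real" +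
  fixes d :: "nat \<Rightarrow> nat \<Rightarrow> nat"
  assumes deg_seq: "\<And>n. n \<ge> 1 \<Longrightarrow> degree_sequence n (d n)"
    and n0: "\<And>n. n \<ge> 1 \<Longrightarrow> degree_count n (d n) 0 = 0"
    and cond_a: "\<And>i. i \<ge> 1 \<Longrightarrow> (\<lambda>n. real (degree_count n (d n) i) / real n) \<longlonglongrightarrow> p i"
    and cond_b: "(\<lambda>n. real (total_degree n (d n)) / real n) \<longlonglongrightarrow> mean_pos p"
begin

abbreviation wt :: "nat \<Rightarrow> nat set \<Rightarrow> nat" where
  "wt n D \<equiv> exploration.weight {1..n} (d n) D {}"

abbreviation und :: "nat \<Rightarrow> nat \<Rightarrow> nat \<Rightarrow> nat" where
  "und n x k \<equiv> exploration.undisc {1..n} (d n) {x} k"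

definition edges :: "nat \<Rightarrow> nat" where "edges n = total_degree n (d n) div 2"

lemma total_edges: "n \<ge> 1 \<Longrightarrow> (\<Sum>v\<in>{1..n}. d n v) = 2 * edges n"
  using deg_seq[of n] by (simp add: degree_sequence_def edges_def total_degree_def)

lemma lim_edges: "(\<lambda>n. real (edges n) / real n) \<longlonglongrightarrow> mean_pos p / 2"
proof -
  have "(\<lambda>n. real (total_degree n (d n)) / real n / 2) \<longlonglongrightarrow> mean_pos p / 2"
    by (intro tendsto_divide cond_b tendsto_const) simp
  moreover have "\<forall>\<^sub>F n in sequentially. real (total_degree n (d n)) / real n / 2 = real (edges n) / real n"
  proof (rule eventually_sequentiallyI[of 1])
    fix n :: nat assume "1 \<le> n"
    then have "total_degree n (d n) = 2 * edges n" using total_edges by (simp add: total_degree_def)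
    then show "real (total_degree n (d n)) / real n / 2 = real (edges n) / real n" by simp
  qed
  ultimately show ?thesis by (rule Lim_transform_eventually)
qed

lemma degree_pos: "n \<ge> 1 \<Longrightarrow> \<forall>v\<in>{1..n}. 1 \<le> d n v"
proof
  fix v assume n: "n \<ge> 1" and v: "v \<in> {1..n}"
  have "{j \<in> {1..n}. d n j = 0} = {}" using n0[OF n] by (simp add: degree_count_def)
  then show "1 \<le> d n v" using v by (metis (mono_tags, lifting) empty_Collect_eq less_one not_le)
qed

lemma und_bounds:
  shows "und n x k \<le> degree_count n (d n) k" "degree_count n (d n) k \<le> und n x k + 1"
proof -
  interpret exploration "{1..n}" "d n" by (rule exploration_interval)
  have eq: "{v \<in> {1..n} - {x}. d n v = k} = {v \<in> {1..n}. d n v = k} - {x}" by auto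
  show "und n x k \<le> degree_count n (d n) k" "degree_count n (d n) k \<le> und n x k + 1"
    unfolding undisc_def eq degree_count_def by (auto simp: card_Diff_singleton_if)
qed

lemma lim_und:
  assumes "k \<ge> 1" shows "(\<lambda>n. real (und n (x n) k) / real n) \<longlonglongrightarrow> p k"
proof (rule tendsto_sandwich[OF _ _ _ cond_a[OF assms]])
  have "(\<lambda>n. real (degree_count n (d n) k) / real n - 1 / real n) \<longlonglongrightarrow> p k - 0"
    by (intro tendsto_diff cond_a assms lim_1_over_n)
  then show "(\<lambda>n. real (degree_count n (d n) k) / real n - 1 / real n) \<longlonglongrightarrow> p k" by simp
  show "\<forall>\<^sub>F n in sequentially. real (degree_count n (d n) k) / real n - 1 / real n \<le> real (und n (x n) k) / real n"
  proof (intro always_eventually allI)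
    fix n
    have "real (degree_count n (d n) k) - 1 \<le> real (und n (x n) k)" using und_bounds(2)[of n k "x n"] by linarith
    then have "(real (degree_count n (d n) k) - 1) / real n \<le> real (und n (x n) k) / real n"
      by (rule divide_right_mono) simp
    then show "real (degree_count n (d n) k) / real n - 1 / real n \<le> real (und n (x n) k) / real n"
      by (simp add: diff_divide_distrib)
  qed
  show "\<forall>\<^sub>F n in sequentially. real (und n (x n) k) / real n \<le> real (degree_count n (d n) k) / real n"
    using und_bounds(1)[of _ "x _" k] by (intro always_eventually allI divide_right_mono) auto
qed

lemma weight_all_le: "n \<ge> 1 \<Longrightarrow> wt n {1..n} \<le> odd_fact (edges n)"
proof -
  assume n: "n \<ge> 1"
  interpret exploration "{1..n}" "d n" by (rule exploration_interval)
  have "weight {1..n} {} * (\<Prod>k\<in>{}. (0 + undisc {1..n} k) choose undisc {1..n} k) * odd_fact 0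
    \<le> odd_fact (0 + edges n)"
  proof (rule weight_upper)
    show "state {1..n} {}" by (rule state_empty) simp
    show "(\<Sum>v\<in>{1..n}. res {} v) = 2 * edges n" using total_edges[OF n] by simp
  qed auto
  then show ?thesis by simp
qed

text \<open>Half the number of additional vertices of degree k; doubling it makes their total degree
  even, as pairings require.\<close>

definition tilt_extra :: "nat \<Rightarrow> nat \<Rightarrow> nat" where
  "tilt_extra n k = nat \<lfloor>real n * (xw k * beta p ^ k / 2)\<rfloor>"

definition conn_upper :: "nat \<Rightarrow> real" where
  "conn_upper M = (let X = (\<Sum>k=1..M. real k * (xw k * beta p ^ k)) in
     ((X + mean_pos p) * ln (X + mean_pos p) - X * ln X) / 2 - mean_pos p / 2
     + (\<Sum>k=1..M. p k * ln (1 - beta p ^ k)) + ln (beta p) * X)"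

lemma weight_conn_le:
  fixes n M :: nat
  assumes n: "n \<ge> 1"
  defines "Y \<equiv> \<Sum>k=1..M. k * tilt_extra n k"
  shows "wt n {1} * (\<Prod>k=1..M. (2 * tilt_extra n k + und n 1 k) choose und n 1 k) * odd_fact Y
    \<le> odd_fact (Y + edges n)"
proof -
  interpret exploration "{1..n}" "d n" by (rule exploration_interval)
  show ?thesis
  proof (rule weight_upper)
    show "(\<Sum>k = 1..M. k * (2 * tilt_extra n k)) = 2 * Y"
      unfolding Y_def sum_distrib_left by (intro sum.cong) auto
    show "state {1} {}" by (rule state_empty) (use n in simp)
    show "(\<Sum>v\<in>{1..n}. res {} v) = 2 * edges n" using total_edges[OF n] by simp
  qed auto
qed

text \<open>Since \<open>xw k\<close> is the sum of \<open>p k\<close> and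
  \<open>xw k * beta p ^ k\<close>, the entropy of each binomial coefficient splits into -
  \<open>p k\<close> ln (1 - beta^k) and a part that sums over k to a multiple of X.\<close>

lemma conn_upper_eq:
  fixes M :: nat
  defines "X \<equiv> \<Sum>k=1..M. real k * (xw k * beta p ^ k)"
  shows "((X / 2 + mean_pos p / 2) * ln (2 * (X / 2 + mean_pos p / 2)) - (X / 2 + mean_pos p / 2))
    - (X / 2 * ln (2 * (X / 2)) - X / 2)
    - (\<Sum>k=1..M. ((2 * (xw k * beta p ^ k / 2) + p k) * ln (2 * (xw k * beta p ^ k / 2) + p k) - (2 * (xw k * beta p ^ k / 2) + p k))
        - (2 * (xw k * beta p ^ k / 2) * ln (2 * (xw k * beta p ^ k / 2)) - 2 * (xw k * beta p ^ k / 2)) - (p k * ln (p k) - p k))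
    = conn_upper M"
proof -
  have "(2 * (xw k * beta p ^ k / 2) + p k) * ln (2 * (xw k * beta p ^ k / 2) + p k) - (2 * (xw k * beta p ^ k / 2) + p k)
        - (2 * (xw k * beta p ^ k / 2) * ln (2 * (xw k * beta p ^ k / 2)) - 2 * (xw k * beta p ^ k / 2)) - (p k * ln (p k) - p k)
    = - (p k * ln (1 - beta p ^ k)) - ln (beta p) * (real k * (xw k * beta p ^ k))" if "k \<in> {1..M}" for k
  proof (cases "p k = 0")
    case True
    then show ?thesis by (simp add: xw_def)
  next
    case False
    have k: "k \<ge> 1" using that by simp
    have pos: "0 < p k" "0 < 1 - beta p ^ k" "0 < beta p ^ k" "0 < xw k"
      using p_nonneg[OF k] False one_minus_power_pos[of "beta p" k] beta_props k by (auto simp: xw_def)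
    have sum: "xw k * beta p ^ k + p k = xw k" using xw_eq[OF k] by (simp add: algebra_simps)
    have "ln (xw k * beta p ^ k) = ln (xw k) + real k * ln (beta p)"
      using pos beta_props by (simp add: ln_mult ln_realpow)
    moreover have "ln (p k) = ln (xw k) + ln (1 - beta p ^ k)"
      using pos xw_eq[OF k] by (metis ln_mult_pos)
    moreover have "xw k * ln (xw k) = xw k * beta p ^ k * ln (xw k) + p k * ln (xw k)"
      using sum by (metis distrib_right)
    moreover have "2 * (xw k * beta p ^ k / 2) + p k = xw k" "2 * (xw k * beta p ^ k / 2) = xw k * beta p ^ k"
      using sum by simp_all
    moreover have "xw k = xw k * beta p ^ k + p k" using sum by simp
    moreover have "xw k * beta p ^ k * (real k * ln (beta p)) = ln (beta p) * (real k * (xw k * beta p ^ k))" by simp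
    ultimately show ?thesis by (simp only: distrib_left right_diff_distrib)
  qed
  then have "(\<Sum>k=1..M. (2 * (xw k * beta p ^ k / 2) + p k) * ln (2 * (xw k * beta p ^ k / 2) + p k) - (2 * (xw k * beta p ^ k / 2) + p k)
        - (2 * (xw k * beta p ^ k / 2) * ln (2 * (xw k * beta p ^ k / 2)) - 2 * (xw k * beta p ^ k / 2)) - (p k * ln (p k) - p k))
    = (\<Sum>k=1..M. - (p k * ln (1 - beta p ^ k)) - ln (beta p) * (real k * (xw k * beta p ^ k)))"
    by (intro sum.cong) auto
  also have "\<dots> = - (\<Sum>k=1..M. p k * ln (1 - beta p ^ k)) - ln (beta p) * X"
    by (simp add: sum_subtractf sum_negf sum_distrib_left X_def)
  finally have SUM: "(\<Sum>k=1..M. (2 * (xw k * beta p ^ k / 2) + p k) * ln (2 * (xw k * beta p ^ k / 2) + p k) - (2 * (xw k * beta p ^ k / 2) + p k)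
        - (2 * (xw k * beta p ^ k / 2) * ln (2 * (xw k * beta p ^ k / 2)) - 2 * (xw k * beta p ^ k / 2)) - (p k * ln (p k) - p k))
    = - (\<Sum>k=1..M. p k * ln (1 - beta p ^ k)) - ln (beta p) * X" .
  have two: "2 * (X / 2 + mean_pos p / 2) = X + mean_pos p" "2 * (X / 2) = X" by simp_all
  show ?thesis
    unfolding SUM two conn_upper_def Let_def X_def[symmetric]
    by (simp add: distrib_right add_divide_distrib diff_divide_distrib)
qed

text \<open>Here the equation for \<open>beta\<close> is used: in the limit X +
  \<open>mean_pos p\<close> = \<open>total_xw\<close> and ln X = 2 ln beta + ln
  \<open>total_xw\<close>, so all terms with ln beta cancel.\<close>

lemma conn_upper_lim: "conn_upper \<longlonglongrightarrow> limit_conn"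
proof -
  define X where "X M = (\<Sum>k=1..M. real k * (xw k * beta p ^ k))" for M
  define X0 where "X0 = (beta p)\<^sup>2 * total_xw"
  have "X \<longlonglongrightarrow> X0"
    unfolding X_def X0_def using has_sum_imp_LIMSEQ_from_1[OF has_sum_tail] by (simp add: mult.assoc)
  moreover have "0 < X0" using beta_props total_xw_pos by (simp add: X0_def)
  ultimately have "(\<lambda>M. ((X M + mean_pos p) * ln (X M + mean_pos p) - X M * ln (X M)) / 2 - mean_pos p / 2
     + (\<Sum>k=1..M. p k * ln (1 - beta p ^ k)) + ln (beta p) * X M) \<longlonglongrightarrow>
     ((X0 + mean_pos p) * ln (X0 + mean_pos p) - X0 * ln X0) / 2 - mean_pos p / 2 + log_surv + ln (beta p) * X0"
    using mean_gt_2 by (intro tendsto_intros has_sum_imp_LIMSEQ_from_1[OF has_sum_log_surv]) auto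
  moreover have "((X0 + mean_pos p) * ln (X0 + mean_pos p) - X0 * ln X0) / 2 - mean_pos p / 2 + log_surv + ln (beta p) * X0 = limit_conn"
  proof -
    have 1: "X0 + mean_pos p = total_xw" using mean_eq by (simp add: X0_def algebra_simps)
    have 2: "ln X0 = 2 * ln (beta p) + ln total_xw"
      using beta_props total_xw_pos by (simp add: X0_def ln_mult ln_realpow)
    have "total_xw * ln total_xw = X0 * ln total_xw + mean_pos p * ln total_xw"
      unfolding 1[symmetric] by (simp add: distrib_right)
    then show ?thesis unfolding 1 2 limit_conn_def by (simp add: distrib_left add_divide_distrib diff_divide_distrib)
  qed
  ultimately show ?thesis by (simp add: conn_upper_def[abs_def] Let_def X_def)
qed

text \<open>The premise on \<open>wt n {1}\<close> excludes ln 0, for which comparing logarithms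
  says nothing; the lower bound later discharges it for large n.\<close>

lemma norm_ln_conn_upper:
  assumes a: "limit_conn < a"
  shows "\<forall>\<^sub>F n in sequentially. wt n {1} > 0 \<longrightarrow> norm_ln (\<lambda>n. real (wt n {1})) edges n < a"
proof -
  obtain M where M: "conn_upper M < a"
    using order_tendstoD(2)[OF conn_upper_lim a] by (auto simp: eventually_sequentially)
  define Y where "Y n = (\<Sum>k=1..M. k * tilt_extra n k)" for n
  define X where "X = (\<Sum>k=1..M. real k * (xw k * beta p ^ k))"
  define e where "e k n = 2 * tilt_extra n k" for k n
  define u where "u k n = und n 1 k" for k n
  \<comment> \<open>Normalised logarithm of the bound on the weight in
    \<open>weight_conn_le\<close>. The coefficients of ln n combine to (Y + edges) - Y - sum ((e +
    u) - e - u) = edges.\<close>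
  define g where "g n = norm_ln (\<lambda>n. odd_fact (Y n + edges n)) (\<lambda>n. Y n + edges n) n - norm_ln (\<lambda>n. odd_fact (Y n)) Y n
    - (\<Sum>k=1..M. norm_ln (\<lambda>n. fact (e k n + u k n)) (\<lambda>n. e k n + u k n) n - norm_ln (\<lambda>n. fact (e k n)) (e k) n
        - norm_ln (\<lambda>n. fact (u k n)) (u k) n)" for n
  have lim_t: "(\<lambda>n. real (tilt_extra n k) / real n) \<longlonglongrightarrow> xw k * beta p ^ k / 2" if "k \<ge> 1" for k
    unfolding tilt_extra_def using xw_nonneg[OF that] beta_props by (intro nat_floor_lim) auto
  have lim_Y: "(\<lambda>n. real (Y n) / real n) \<longlonglongrightarrow> X / 2"
  proof -
    have "(\<lambda>n. \<Sum>k=1..M. real k * (real (tilt_extra n k) / real n)) \<longlonglongrightarrow> (\<Sum>k=1..M. real k * (xw k * beta p ^ k / 2))"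
      using lim_t by (intro tendsto_sum tendsto_mult tendsto_const) auto
    then show ?thesis by (simp add: Y_def X_def sum_divide_distrib)
  qed
  have lim_Ys: "(\<lambda>n. real (Y n + edges n) / real n) \<longlonglongrightarrow> X / 2 + mean_pos p / 2"
    using tendsto_add[OF lim_Y lim_edges] by (simp add: add_divide_distrib)
  have lim_e: "(\<lambda>n. real (e k n) / real n) \<longlonglongrightarrow> 2 * (xw k * beta p ^ k / 2)" if "k \<ge> 1" for k
    using tendsto_mult[OF tendsto_const[of 2] lim_t[OF that]] by (simp add: e_def)
  have lim_u: "(\<lambda>n. real (u k n) / real n) \<longlonglongrightarrow> p k" if "k \<ge> 1" for k
    unfolding u_def using lim_und[OF that, of "\<lambda>_. 1"] .
  have lim_eu: "(\<lambda>n. real (e k n + u k n) / real n) \<longlonglongrightarrow> 2 * (xw k * beta p ^ k / 2) + p k" if "k \<ge> 1" for k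
    using tendsto_add[OF lim_e[OF that] lim_u[OF that]] by (simp add: add_divide_distrib)
  have "g \<longlonglongrightarrow> conn_upper M"
    unfolding g_def conn_upper_eq[symmetric] X_def[symmetric]
    by (intro tendsto_diff tendsto_sum norm_ln_fact norm_ln_odd_fact lim_Y lim_Ys lim_e lim_u lim_eu) auto
  then have "\<forall>\<^sub>F n in sequentially. g n < a" using M by (rule order_tendstoD)
  then show ?thesis using eventually_ge_at_top[of 1]
  proof eventually_elim
    case (elim n)
    show ?case
    proof
      assume w: "wt n {1} > 0"
      define Bn where "Bn = (\<Prod>k=1..M. real ((e k n + u k n) choose u k n))"
      have Bn: "0 < Bn" unfolding Bn_def by (intro prod_pos) simp
      have "real (wt n {1} * (\<Prod>k=1..M. (2 * tilt_extra n k + und n 1 k) choose und n 1 k) * odd_fact (Y n))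
          \<le> real (odd_fact (Y n + edges n))"
        using weight_conn_le[OF elim(2), of M] unfolding Y_def by (rule of_nat_mono)
      then have le: "real (wt n {1}) * Bn * real (odd_fact (Y n)) \<le> real (odd_fact (Y n + edges n))"
        by (simp add: Bn_def e_def u_def)
      have "ln (real (wt n {1}) * Bn * real (odd_fact (Y n))) \<le> ln (real (odd_fact (Y n + edges n)))"
        using le w Bn odd_fact_pos by (subst ln_le_cancel_iff) auto
      moreover have "ln (real (wt n {1}) * Bn * real (odd_fact (Y n))) =
          ln (real (wt n {1})) + ln Bn + ln (real (odd_fact (Y n)))"
        using w Bn odd_fact_pos[of "Y n"] by (simp add: ln_mult)
      moreover have "ln Bn = (\<Sum>k=1..M. ln (fact (e k n + u k n)) - ln (fact (e k n)) - ln (fact (u k n)))"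
        unfolding Bn_def by (subst ln_prod) (auto simp: ln_binomial_fact)
      ultimately have "ln (real (wt n {1})) \<le> ln (real (odd_fact (Y n + edges n))) - ln (real (odd_fact (Y n)))
        - (\<Sum>k=1..M. ln (fact (e k n + u k n)) - ln (fact (e k n)) - ln (fact (u k n)))" by simp
      then have "norm_ln (\<lambda>n. real (wt n {1})) edges n \<le> (ln (real (odd_fact (Y n + edges n))) - ln (real (odd_fact (Y n)))
        - (\<Sum>k=1..M. ln (fact (e k n + u k n)) - ln (fact (e k n)) - ln (fact (u k n))) - real (edges n) * ln (real n)) / real n"
        unfolding norm_ln_def by (intro divide_right_mono) auto
      also have "\<dots> = g n"
      proof -
        have "(\<Sum>k=1..M. norm_ln (\<lambda>n. fact (e k n + u k n)) (\<lambda>n. e k n + u k n) n - norm_ln (\<lambda>n. fact (e k n)) (e k) n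
          - norm_ln (\<lambda>n. fact (u k n)) (u k) n) =
          (\<Sum>k=1..M. ln (fact (e k n + u k n)) - ln (fact (e k n)) - ln (fact (u k n))) / real n"
          unfolding norm_ln_def sum_divide_distrib
          by (intro sum.cong) (auto simp: diff_divide_distrib[symmetric] algebra_simps)
        then show ?thesis unfolding g_def by (simp add: norm_ln_def diff_divide_distrib add_divide_distrib distrib_right)
      qed
      finally show "norm_ln (\<lambda>n. real (wt n {1})) edges n < a" using elim(1) by simp
    qed
  qed
qed

section \<open>Lower bound for all graphs\<close>

definition high_degree :: "nat \<Rightarrow> nat \<Rightarrow> nat" where
  "high_degree M n = (\<Sum>v\<in>{v\<in>{1..n}. d n v > M}. d n v)"

lemma high_degree_eq:
  assumes "n \<ge> 1"
  shows "high_degree M n + (\<Sum>k=1..M. k * degree_count n (d n) k) = 2 * edges n"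
proof -
  have "(\<Sum>v\<in>{1..n}. d n v) = high_degree M n + (\<Sum>v\<in>{v\<in>{1..n}. d n v \<le> M}. d n v)"
    unfolding high_degree_def
    by (subst sum.union_disjoint[symmetric]) (auto intro!: sum.cong)
  also have "(\<Sum>v\<in>{v\<in>{1..n}. d n v \<le> M}. d n v) =
      (\<Sum>k=1..M. \<Sum>v\<in>{v\<in>{v\<in>{1..n}. d n v \<le> M}. d n v = k}. d n v)"
    using degree_pos[OF assms] by (intro sum.group[symmetric]) auto
  also have "\<dots> = (\<Sum>k=1..M. k * degree_count n (d n) k)"
  proof (rule sum.cong)
    fix k assume "k \<in> {1..M}"
    then have "{v\<in>{v\<in>{1..n}. d n v \<le> M}. d n v = k} = {v\<in>{1..n}. d n v = k}" by auto
    then show "(\<Sum>v\<in>{v\<in>{v\<in>{1..n}. d n v \<le> M}. d n v = k}. d n v) = k * degree_count n (d n) k"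
      by (simp add: degree_count_def)
  qed simp
  finally show ?thesis using total_edges[OF assms] by simp
qed

text \<open>Convergence of the mean prevents half-edges from escaping to unbounded degrees: the
  limit is a tail of the mean and is small once \<open>M\<close> is large.\<close>

lemma lim_high_degree:
  "(\<lambda>n. real (high_degree M n) / real n) \<longlonglongrightarrow> mean_pos p - (\<Sum>k=1..M. real k * p k)"
proof -
  have "(\<lambda>n. 2 * (real (edges n) / real n) - (\<Sum>k=1..M. real k * (real (degree_count n (d n) k) / real n)))
      \<longlonglongrightarrow> 2 * (mean_pos p / 2) - (\<Sum>k=1..M. real k * p k)"
    by (intro tendsto_intros lim_edges cond_a) auto
  moreover have "\<forall>\<^sub>F n in sequentially. 2 * (real (edges n) / real n) - (\<Sum>k=1..M. real k * (real (degree_count n (d n) k) / real n))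
      = real (high_degree M n) / real n"
  proof (rule eventually_sequentiallyI[of 1])
    fix n :: nat assume "1 \<le> n"
    have "2 * real (edges n) = real (high_degree M n) + (\<Sum>k=1..M. real k * real (degree_count n (d n) k))"
      using arg_cong[OF high_degree_eq[OF \<open>1 \<le> n\<close>, of M], of real] by simp
    then show "2 * (real (edges n) / real n) - (\<Sum>k=1..M. real k * (real (degree_count n (d n) k) / real n))
      = real (high_degree M n) / real n"
      by (simp add: sum_divide_distrib[symmetric] add_divide_distrib)
  qed
  ultimately show ?thesis using Lim_transform_eventually by force
qed

text \<open>About x n leaves are reserved. As x -> 0 the resulting constant f x tends to
  \<open>limit_all\<close>; for fixed x, \<open>M\<close> is taken so large that fewer than x n
  half-edges belong to degrees above \<open>M\<close>.\<close>

lemma norm_ln_all_lower: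
  assumes a: "a < limit_all"
  shows "\<forall>\<^sub>F n in sequentially. wt n {1..n} > 0 \<and> a < norm_ln (\<lambda>n. real (wt n {1..n})) edges n"
proof -
  define f where "f x = (x * ln x - x) + (mean_pos p / 2 - x) * ln 2
    + ((mean_pos p / 2 - x) * ln (mean_pos p / 2 - x) - (mean_pos p / 2 - x))" for x :: real
  have mu: "mean_pos p / 2 > 0" using mean_gt_2 by simp
  have "((\<lambda>x. x) \<longlongrightarrow> (0::real)) (at_right 0)" by (rule tendsto_ident_at)
  then have x0: "((\<lambda>x. x * ln x) \<longlongrightarrow> 0 * ln (0::real)) (at_right 0)"
    by (rule tendsto_xlnx) (auto simp: eventually_at_right_less intro: eventually_mono[OF eventually_at_right_less])
  have "(f \<longlongrightarrow> (0 * ln 0 - 0) + (mean_pos p / 2 - 0) * ln 2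
    + ((mean_pos p / 2 - 0) * ln (mean_pos p / 2 - 0) - (mean_pos p / 2 - 0))) (at_right 0)"
    unfolding f_def using mu by (intro tendsto_intros x0) auto
  moreover have "(0 * ln 0 - 0) + (mean_pos p / 2 - 0) * ln 2
    + ((mean_pos p / 2 - 0) * ln (mean_pos p / 2 - 0) - (mean_pos p / 2 - 0)) = limit_all"
    using mu by (simp add: limit_all_def ln_div algebra_simps)
  ultimately have "(f \<longlongrightarrow> limit_all) (at_right 0)" by simp
  then have "\<forall>\<^sub>F x in at_right 0. a < f x" using a by (rule order_tendstoD)
  moreover have "\<forall>\<^sub>F x in at_right 0. x < min (p 1) (mean_pos p / 2)"
    using p1 mu by (intro eventually_at_right_less[THEN eventually_mono[rotated]] eventually_at_rightI[of 0 "min (p 1) (mean_pos p / 2)"]) auto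
  moreover have "\<forall>\<^sub>F x::real in at_right 0. 0 < x" by (rule eventually_at_right_less)
  ultimately have "\<forall>\<^sub>F x in at_right 0. a < f x \<and> x < min (p 1) (mean_pos p / 2) \<and> 0 < x" by eventually_elim auto
  then obtain x where x: "a < f x" "x < p 1" "x < mean_pos p / 2" "0 < x"
    using eventually_happens'[OF trivial_limit_at_right_real] by force
  have "(\<lambda>M. mean_pos p - (\<Sum>k=1..M. real k * p k)) \<longlonglongrightarrow> mean_pos p - mean_pos p"
    by (intro tendsto_diff tendsto_const has_sum_imp_LIMSEQ_from_1[OF has_sum_mean])
  then have "\<forall>\<^sub>F M in sequentially. mean_pos p - (\<Sum>k=1..M. real k * p k) < x"
    using x by (intro order_tendstoD) auto
  then have "\<forall>\<^sub>F M in sequentially. M \<ge> 1 \<and> mean_pos p - (\<Sum>k=1..M. real k * p k) < x"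
    using eventually_ge_at_top[of 1] by eventually_elim auto
  then obtain M where M: "M \<ge> 1" "mean_pos p - (\<Sum>k=1..M. real k * p k) < x"
    by (auto simp: eventually_sequentially)
  define C where "C = M + M * M"
  define t where "t n = nat \<lfloor>real n * x\<rfloor>" for n
  define b where "b n = edges n - t n" for n
  have lim_t: "(\<lambda>n. real (t n) / real n) \<longlonglongrightarrow> x" unfolding t_def using x by (intro nat_floor_lim) auto
  have "\<forall>\<^sub>F n in sequentially. real (high_degree M n) / real n + real C * (1 / real n) < real (t n) / real n"
    by (rule eventually_less_of_lim[OF tendsto_add[OF lim_high_degree[of M] tendsto_mult[OF tendsto_const lim_1_over_n]] lim_t])
      (use M in simp)
  moreover have "\<forall>\<^sub>F n in sequentially. real (t n) / real n < real (edges n) / real n"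
    by (rule eventually_less_of_lim[OF lim_t lim_edges]) (use x in simp)
  moreover have "\<forall>\<^sub>F n in sequentially. real (t n) / real n < real (degree_count n (d n) 1) / real n"
    by (rule eventually_less_of_lim[OF lim_t cond_a[of 1]]) (use x in simp_all)
  ultimately have ev: "\<forall>\<^sub>F n in sequentially. n \<ge> 1 \<and> high_degree M n + C \<le> t n \<and> t n \<le> edges n \<and> t n \<le> degree_count n (d n) 1"
    using eventually_ge_at_top[of 1]
  proof eventually_elim
    case (elim n)
    then have "real (high_degree M n) + real C < real (t n)" "real (t n) < real (edges n)"
      "real (t n) < real (degree_count n (d n) 1)"
      by (simp_all add: add_divide_distrib[symmetric] divide_less_cancel split: if_splits)
    then show ?case using elim(4) by linarith
  qed
  have low: "fact (t n) * 2 ^ b n * fact (b n) \<le> wt n {1..n}"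
    if n: "n \<ge> 1" "high_degree M n + C \<le> t n" "t n \<le> edges n" "t n \<le> degree_count n (d n) 1" for n
  proof -
    interpret exploration "{1..n}" "d n" by (rule exploration_interval)
    obtain T where T: "T \<subseteq> {j \<in> {1..n}. d n j = 1}" "card T = t n"
      using obtain_subset_with_card_n[of "t n" "{j \<in> {1..n}. d n j = 1}"] n(4) by (auto simp: degree_count_def)
    have "fact (card T) * 2 ^ b n * fact (b n) \<le> weight {1..n} {}"
    proof (rule weight_all_lower[where M = M and C = C and H = "high_degree M n"])
      show "(\<Sum>v\<in>{1..n}. d n v) = 2 * (b n + card T)"
        using total_edges[OF n(1)] T(2) n(3) by (simp add: b_def)
    qed (use T n M in \<open>auto simp: high_degree_def C_def\<close>)
    then show ?thesis using T(2) by simp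
  qed
  define g where "g n = norm_ln (\<lambda>n. fact (t n)) t n + real (b n) / real n * ln 2 + norm_ln (\<lambda>n. fact (b n)) b n" for n
  have lim_b: "(\<lambda>n. real (b n) / real n) \<longlonglongrightarrow> mean_pos p / 2 - x"
  proof -
    have "(\<lambda>n. real (edges n) / real n - real (t n) / real n) \<longlonglongrightarrow> mean_pos p / 2 - x"
      by (intro tendsto_diff lim_edges lim_t)
    moreover have "\<forall>\<^sub>F n in sequentially. real (edges n) / real n - real (t n) / real n = real (b n) / real n"
      using ev by eventually_elim (simp add: b_def of_nat_diff diff_divide_distrib)
    ultimately show ?thesis by (rule Lim_transform_eventually)
  qed
  have "g \<longlonglongrightarrow> f x"
    unfolding g_def f_def by (intro tendsto_add tendsto_mult tendsto_const norm_ln_fact lim_t lim_b)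
  moreover have le: "\<forall>\<^sub>F n in sequentially. wt n {1..n} > 0 \<and> g n \<le> norm_ln (\<lambda>n. real (wt n {1..n})) edges n"
    using ev
  proof eventually_elim
    case (elim n)
    have le: "fact (t n) * 2 ^ b n * fact (b n) \<le> wt n {1..n}" using low elim by simp
    moreover have "0 < (fact (t n) * 2 ^ b n * fact (b n) :: nat)" by simp
    ultimately have w: "wt n {1..n} > 0" by linarith
    have "real (fact (t n) * 2 ^ b n * fact (b n)) \<le> real (wt n {1..n})" using le by (rule of_nat_mono)
    then have "fact (t n) * 2 ^ b n * fact (b n) \<le> real (wt n {1..n})" by simp
    then have "ln (fact (t n) * 2 ^ b n * fact (b n)) \<le> ln (real (wt n {1..n}))"
      using w by (subst ln_le_cancel_iff) auto
    then have "ln (fact (t n)) + real (b n) * ln 2 + ln (fact (b n)) \<le> ln (real (wt n {1..n}))"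
      by (simp add: ln_mult ln_realpow)
    then have "(ln (fact (t n)) + real (b n) * ln 2 + ln (fact (b n)) - real (edges n) * ln (real n)) / real n
      \<le> norm_ln (\<lambda>n. real (wt n {1..n})) edges n"
      unfolding norm_ln_def by (intro divide_right_mono) auto
    moreover have "real (edges n) = real (t n) + real (b n)" using elim by (simp add: b_def of_nat_diff)
    then have "(ln (fact (t n)) + real (b n) * ln 2 + ln (fact (b n)) - real (edges n) * ln (real n)) / real n = g n"
      by (simp add: g_def norm_ln_def diff_divide_distrib add_divide_distrib distrib_right)
    ultimately show ?case using w by simp
  qed
  ultimately have "\<forall>\<^sub>F n in sequentially. a < norm_ln (\<lambda>n. real (wt n {1..n})) edges n"
    using x(1) by (intro eventually_gt_of_lim[of g]) (auto elim: eventually_mono)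
  with le show ?thesis by eventually_elim auto
qed

end

section \<open>Lower bound for connected graphs\<close>

context exploration
begin

lemma weight_connected_schedule:
  fixes c :: "nat \<Rightarrow> nat \<Rightarrow> nat" and b a N :: "nat \<Rightarrow> nat"
  assumes x: "x \<in> U" "d x = k0" and k0: "3 \<le> k0" "k0 \<le> M" and pos: "\<forall>v\<in>U. 1 \<le> d v"
    and C: "C = M + M * M"
    and h: "h = card {v\<in>U. d v > M}" and Hq: "(\<Sum>v\<in>{v\<in>U. d v > M}. d v) \<le> q"
    and q: "q \<le> undisc {x} k0"
    and s: "(\<Sum>v\<in>U. d v) = 2 * (s + h + q)"
    and u': "u' = (undisc {x})(k0 := undisc {x} k0 - q)"
    and N: "\<And>j. N j = (\<Sum>k=1..M. c j k) + b j"
    and cu: "\<And>k. k \<in> {1..M} \<Longrightarrow> (\<Sum>j<J. c j k) \<le> u' k"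
    and tot: "(\<Sum>k=1..M. k * u' k) + 1 \<le> 2 * s"
    and b': "s = (\<Sum>k=1..M. u' k) + (\<Sum>j<J. b j) + b'"
    and L: "C + (\<Sum>j<J. c j 1) \<le> u' 1"
    and cond: "\<And>j. j < J \<Longrightarrow> real (2 * N j + C + a j) \<le>
      2 * real s - (\<Sum>k=1..M. real k * real (u' k))
      + (\<Sum>k=2..M. (real k - 2) * (real (u' k) - (\<Sum>i<J. real (c i k))))
      + (\<Sum>i<j. (\<Sum>k=1..M. real k * real (c i k)) - 2 * real (N i))"
  shows "fact h * (\<Prod>k=1..M. k ^ undisc {x} k * fact (undisc {x} k)) *
      ((\<Prod>j<J. fact (N j) * a j ^ b j) * (2 ^ b' * fact b'))
    \<le> (\<Prod>j<J. (\<Prod>k=1..M. fact (c j k)) * fact (b j)) * weight {x} {}"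
proof -
  \<comment> \<open>The balance of half-edges determines how many are active when the schedule
    starts.\<close>
  define A where "A = 2 * s - (\<Sum>k=1..M. k * u' k)"
  have A: "A + (\<Sum>k=1..M. k * u' k) = 2 * s" "1 \<le> A" using tot by (simp_all add: A_def)
  have rA: "real A = 2 * real s - (\<Sum>k=1..M. real k * real (u' k))"
    using arg_cong[OF A(1), of real] by simp
  define p1 where "p1 = (\<Prod>j<J. fact (N j) * a j ^ b j) * (2 ^ b' * fact b')"
  define p2 where "p2 = (\<Prod>j<J. (\<Prod>k=1..M. fact (c j k)) * fact (b j) :: nat)"
  define p3 where "p3 = fact h * (\<Prod>k=1..M. k ^ undisc {x} k * fact (undisc {x} k))"
  have 1: "p1 \<le> p2 * path_weight M C s A u'"
    unfolding p1_def p2_def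
    by (rule path_weight_schedule) (use k0 C A N cu b' L cond in \<open>auto simp: rA\<close>)
  have 2: "p3 * path_weight M C s A u' \<le> weight {x} {}"
    unfolding p3_def by (rule weight_connected_lower[OF x k0 pos C h Hq q s u' A(1)])
  have "p3 * p1 \<le> p3 * (p2 * path_weight M C s A u')" using 1 by (rule mult_left_mono) simp
  also have "\<dots> = p2 * (p3 * path_weight M C s A u')" by simp
  also have "\<dots> \<le> p2 * weight {x} {}" using 2 by (rule mult_left_mono) simp
  finally show ?thesis by (simp only: p1_def p2_def p3_def)
qed

end

context limit_distribution
begin

definition mass :: "nat \<Rightarrow> real" where "mass M = (\<Sum>k=1..M. p k)"

lemma mass_le: "mass M \<le> 1"
  unfolding mass_def using p_nonneg by (intro sum_le_has_sum_from_1[OF has_sum_p]) auto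

lemma mass_lim: "mass \<longlonglongrightarrow> 1"
  unfolding mass_def by (rule has_sum_imp_LIMSEQ_from_1[OF has_sum_p])

lemma sum_bck:
  assumes "J > 0"
  shows "(\<Sum>j<J. bck M (real j * (tau / real J)) (tau / real J)) = mean_pos p / 2 - mass M"
proof -
  have "(\<Sum>j<J. \<Sum>k=1..M. gam k (real j * (tau / real J)) (tau / real J)) = mass M"
    unfolding mass_def using sum_gam[OF assms] by (subst sum.swap) auto
  then show ?thesis using sum_sig[OF assms] by (simp add: bck_def sum_subtractf)
qed

text \<open>Rescaled number of cycles closed after the blocks. A connected graph closes edges - n +
  1 cycles in all; the blocks account for the fraction 1 - eta of those on the trajectory.\<close>

definition final_back :: "real \<Rightarrow> nat \<Rightarrow> real" where
  "final_back \<eta> M = mean_pos p / 2 - 1 - (1 - \<eta>) * (mean_pos p / 2 - mass M)"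

text \<open>Limit of the normalised logarithm of the bound in
  \<open>weight_connected_schedule\<close>. The terms stand for the vertices of large degree, the
  choice of vertices and half-edges, the blocks, and the final cycles.\<close>

definition conn_lower :: "real \<Rightarrow> nat \<Rightarrow> nat \<Rightarrow> real" where
  "conn_lower \<eta> M J = (let D = tau / real J; r = 1 - \<eta>; y = final_back \<eta> M in
    ((1 - mass M) * ln (1 - mass M) - (1 - mass M))
    + (\<Sum>k=1..M. p k * ln (real k) + (p k * ln (p k) - p k))
    + (\<Sum>j<J. (r * sig (real j * D) D * ln (r * sig (real j * D) D) - r * sig (real j * D) D)
        + r * bck M (real j * D) D * ln (r * (alpha M (real j * D) + D * second_moment M))
        - (\<Sum>k=1..M. r * gam k (real j * D) D * ln (r * gam k (real j * D) D) - r * gam k (real j * D) D)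
        - (r * bck M (real j * D) D * ln (r * bck M (real j * D) D) - r * bck M (real j * D) D))
    + y * ln 2 + (y * ln y - y))"

lemma scaled_xlnx: "0 < r \<Longrightarrow> 0 \<le> z \<Longrightarrow> r * z * ln (r * z) = r * ln r * z + r * (z * ln (z::real))"
  by (cases "z = 0") (auto simp: ln_mult algebra_simps)

text \<open>Scaling a block by r adds r ln r times its masses to the entropies. These additions
  cancel because \<open>sig\<close> splits into \<open>gam\<close> and \<open>bck\<close>, except
  for the one from the choices of closed cycles. The blocks compensate the entropy of
  \<open>p\<close> only to the fraction 1 - eta; the rest is bounded by B.\<close>

lemma conn_lower_bound:
  assumes \<eta>: "0 < \<eta>" "\<eta> < 1" and M: "M \<ge> 1" and J: "J > 0"
    and B: "\<And>M. - B \<le> (\<Sum>k=1..M. p k * ln (real k) + p k * ln (p k))"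
  defines "y \<equiv> final_back \<eta> M"
  shows "(1 - mass M) * ln (1 - mass M) - (1 - mass M) - \<eta> * (B + 1)
      + (1 - \<eta>) * (mean_pos p / 2 * ln total_xw - mean_pos p / 2 + (\<Sum>k=1..M. p k * ln (1 - beta p ^ k)))
      - tau / real J * (tau * second_moment M + mean_pos p)
      + (1 - \<eta>) * ln (1 - \<eta>) * (mean_pos p / 2 - mass M)
      + y * ln 2 + (y * ln y - y)
    \<le> conn_lower \<eta> M J"
proof -
  define D where "D = tau / real J"
  define r where "r = 1 - \<eta>"
  have r: "0 < r" "r \<le> 1" using \<eta> by (simp_all add: r_def)
  have D: "0 < D" using J tau_pos by (simp add: D_def)
  have JD: "real J * D = tau" using J by (simp add: D_def)
  define t where "t j = real j * D" for j
  have t0: "0 \<le> t j" for j using D by (simp add: t_def)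
  have tle: "t j + D \<le> tau" if "j < J" for j
  proof -
    have "real (Suc j) * D \<le> real J * D" using that D by (intro mult_right_mono) auto
    then show ?thesis unfolding JD by (simp add: t_def algebra_simps)
  qed
  define X where "X j = sig (t j) D * ln (sig (t j) D) - (\<Sum>k=1..M. gam k (t j) D * ln (gam k (t j) D))
        - bck M (t j) D * ln (bck M (t j) D) + bck M (t j) D * ln (alpha M (t j) + D * second_moment M)" for j
  have block: "(r * sig (t j) D * ln (r * sig (t j) D) - r * sig (t j) D)
        + r * bck M (t j) D * ln (r * (alpha M (t j) + D * second_moment M))
        - (\<Sum>k=1..M. r * gam k (t j) D * ln (r * gam k (t j) D) - r * gam k (t j) D)
        - (r * bck M (t j) D * ln (r * bck M (t j) D) - r * bck M (t j) D)
      = r * X j + r * ln r * bck M (t j) D" if j: "j < J" for j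
  proof -
    have sp: "0 \<le> sig (t j) D"
    proof -
      have "0 < D * (total_xw * exp (- (2 * (t j + D))))" using D total_xw_pos by simp
      then show ?thesis using sig_lower[of D "t j"] by linarith
    qed
    have bp: "0 \<le> bck M (t j) D" using t0 tle[OF j] D by (intro bck_nonneg) auto
    have Bp: "0 < alpha M (t j) + D * second_moment M"
      using alpha_nonneg[of "t j" M] second_moment_pos[OF M] t0[of j] tle[OF j] D by (simp add: add_nonneg_pos)
    have "(\<Sum>k=1..M. r * gam k (t j) D * ln (r * gam k (t j) D) - r * gam k (t j) D) =
      (\<Sum>k=1..M. r * ln r * gam k (t j) D + r * (gam k (t j) D * ln (gam k (t j) D)) - r * gam k (t j) D)"
    proof (rule sum.cong)
      fix k assume "k \<in> {1..M}"
      then have "0 \<le> gam k (t j) D" using D by (intro gam_nonneg) auto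
      then show "r * gam k (t j) D * ln (r * gam k (t j) D) - r * gam k (t j) D =
        r * ln r * gam k (t j) D + r * (gam k (t j) D * ln (gam k (t j) D)) - r * gam k (t j) D"
        using scaled_xlnx[OF r(1)] by simp
    qed simp
    also have "\<dots> = r * ln r * (\<Sum>k=1..M. gam k (t j) D) + r * (\<Sum>k=1..M. gam k (t j) D * ln (gam k (t j) D))
        - r * (\<Sum>k=1..M. gam k (t j) D)"
      by (simp only: sum.distrib sum_subtractf sum_distrib_left)
    finally have G: "(\<Sum>k=1..M. r * gam k (t j) D * ln (r * gam k (t j) D) - r * gam k (t j) D) = \<dots>" .
    have S: "sig (t j) D = (\<Sum>k=1..M. gam k (t j) D) + bck M (t j) D" by (simp add: bck_def)
    have lnB: "ln (r * (alpha M (t j) + D * second_moment M)) = ln r + ln (alpha M (t j) + D * second_moment M)"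
      using r Bp by (simp add: ln_mult)
    show ?thesis
      unfolding G lnB scaled_xlnx[OF r(1) sp] scaled_xlnx[OF r(1) bp] X_def
      using S by (simp add: algebra_simps)
  qed
  have bs: "(\<Sum>j<J. bck M (t j) D) = mean_pos p / 2 - mass M"
    using sum_bck[OF J, of M] by (simp add: t_def D_def)
  have Xs: "mean_pos p / 2 * ln total_xw - (\<Sum>k=1..M. p k * ln (real k * xw k)) - mean_pos p / 2 + mass M
      - D * (tau * second_moment M + mean_pos p) \<le> (\<Sum>j<J. X j)"
    using total_entropy[OF J M] by (simp add: X_def t_def D_def mass_def)
  define Q where "Q = (\<Sum>k=1..M. p k * ln (real k) + p k * ln (p k))"
  define R where "R = (\<Sum>k=1..M. p k * ln (1 - beta p ^ k))"
  have QR: "(\<Sum>k=1..M. p k * ln (real k * xw k)) = Q - R"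
    unfolding Q_def R_def sum_subtractf[symmetric] by (intro sum.cong) (auto simp: p_ln_xw)
  have PQ: "(\<Sum>k=1..M. p k * ln (real k) + (p k * ln (p k) - p k)) = Q - mass M"
    unfolding Q_def mass_def sum_subtractf[symmetric] by (intro sum.cong) auto
  have cl: "conn_lower \<eta> M J = ((1 - mass M) * ln (1 - mass M) - (1 - mass M)) + (Q - mass M)
    + (r * (\<Sum>j<J. X j) + r * ln r * (mean_pos p / 2 - mass M)) + y * ln 2 + (y * ln y - y)"
  proof -
    have "(\<Sum>j<J. (r * sig (t j) D * ln (r * sig (t j) D) - r * sig (t j) D)
        + r * bck M (t j) D * ln (r * (alpha M (t j) + D * second_moment M))
        - (\<Sum>k=1..M. r * gam k (t j) D * ln (r * gam k (t j) D) - r * gam k (t j) D)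
        - (r * bck M (t j) D * ln (r * bck M (t j) D) - r * bck M (t j) D))
      = (\<Sum>j<J. r * X j + r * ln r * bck M (t j) D)"
      using block by (intro sum.cong) auto
    also have "\<dots> = r * (\<Sum>j<J. X j) + r * ln r * (mean_pos p / 2 - mass M)"
      by (simp only: sum.distrib sum_distrib_left[symmetric] bs)
    finally show ?thesis
      unfolding conn_lower_def Let_def PQ D_def[symmetric] r_def[symmetric] y_def[symmetric] t_def[symmetric] by simp
  qed
  define W where "W = mean_pos p / 2 * ln total_xw - mean_pos p / 2 + R"
  define E where "E = D * (tau * second_moment M + mean_pos p)"
  have E: "0 \<le> E" unfolding E_def
    using D tau_pos second_moment_pos[OF M] mean_gt_2 by (intro mult_nonneg_nonneg add_nonneg_nonneg) auto
  have "r * (W - Q + mass M - E) \<le> r * (\<Sum>j<J. X j)"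
  proof (rule mult_left_mono)
    show "W - Q + mass M - E \<le> (\<Sum>j<J. X j)" using Xs unfolding QR W_def E_def by linarith
  qed (use r in simp)
  moreover have "r * E \<le> 1 * E" using r E by (intro mult_right_mono) auto
  moreover have "\<eta> * (- B) \<le> \<eta> * Q" using B[of M] \<eta> by (intro mult_left_mono) (auto simp: Q_def)
  moreover have "\<eta> * mass M \<le> \<eta> * 1" using mass_le \<eta> by (intro mult_left_mono) auto
  moreover have "r * (W - Q + mass M - E) = r * W - Q + \<eta> * Q + mass M - \<eta> * mass M - r * E"
    by (simp add: r_def algebra_simps)
  ultimately have "r * W - \<eta> * (B + 1) - E \<le> (Q - mass M) + r * (\<Sum>j<J. X j)"
    by (simp add: distrib_left)
  then show ?thesis unfolding cl r_def[symmetric] D_def[symmetric] W_def[symmetric, unfolded R_def] E_def[symmetric]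
    by (simp add: W_def R_def)
qed

text \<open>The order of choice matters. For small eta the bound of \<open>conn_lower_bound\<close>,
  in the limit of M and J, exceeds a; then M makes the tails small against eta * p k0 / 2, and
  finally J does so for the mesh tau / J, whose error involves the second moment up to M.\<close>

lemma conn_lower_params:
  assumes a: "a < limit_conn"
  obtains \<eta> k0 M J where "0 < \<eta>" "\<eta> < 1" "3 \<le> k0" "k0 \<le> M" "0 < p k0" "0 < J"
    "mean_pos p - (\<Sum>k=1..M. real k * p k) < \<eta> * p k0 / 2"
    "2 * (1 - mass M) + (total_xw - (\<Sum>k=1..M. real k * xw k)) + tau / real J * (2 * total_xw + second_moment M)
      < \<eta> * p k0 / 2"
    "0 < final_back \<eta> M" "a < conn_lower \<eta> M J"
proof -
  obtain B where B: "\<And>M. - B \<le> (\<Sum>k=1..M. p k * ln (real k) + p k * ln (p k))"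
    using entropy_bound by blast
  obtain k0 where k0: "3 \<le> k0" "0 < p k0" using ex_degree_ge_3 by auto
  define m where "m = mean_pos p / 2 - 1"
  have m: "0 < m" using mean_gt_2 by (simp add: m_def)
  define f where "f \<eta> = 0 - 0 - \<eta> * (B + 1) + (1 - \<eta>) * limit_conn - 0 + (1 - \<eta>) * ln (1 - \<eta>) * (mean_pos p / 2 - 1)
      + \<eta> * m * ln 2 + (\<eta> * m * ln (\<eta> * m) - \<eta> * m)" for \<eta> :: real
  have id: "((\<lambda>\<eta>. \<eta>) \<longlongrightarrow> (0::real)) (at_right 0)" by (rule tendsto_ident_at)
  have "((\<lambda>\<eta>. \<eta> * m) \<longlongrightarrow> 0 * m) (at_right 0)" by (intro tendsto_intros id)
  then have x0: "((\<lambda>\<eta>. \<eta> * m * ln (\<eta> * m)) \<longlongrightarrow> (0 * m) * ln (0 * m)) (at_right 0)"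
    by (rule tendsto_xlnx) (use m in \<open>auto intro: eventually_mono[OF eventually_at_right_less]\<close>)
  have "(f \<longlongrightarrow> 0 - 0 - 0 * (B + 1) + (1 - 0) * limit_conn - 0 + (1 - 0) * ln (1 - 0) * (mean_pos p / 2 - 1)
      + 0 * m * ln 2 + (0 * m * ln (0 * m) - 0 * m)) (at_right 0)"
    unfolding f_def by (intro tendsto_intros x0) auto
  then have "(f \<longlongrightarrow> limit_conn) (at_right 0)" by simp
  then have "\<forall>\<^sub>F x in at_right 0. a < f x" using a by (rule order_tendstoD)
  moreover have "\<forall>\<^sub>F x::real in at_right 0. x < 1"
    by (intro eventually_at_rightI[of 0 1]) auto
  moreover have "\<forall>\<^sub>F x::real in at_right 0. 0 < x" by (rule eventually_at_right_less)
  ultimately have "\<forall>\<^sub>F x in at_right 0. a < f x \<and> x < 1 \<and> 0 < x" by eventually_elim auto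
  then obtain \<eta> where \<eta>: "a < f \<eta>" "\<eta> < 1" "0 < \<eta>"
    using eventually_happens'[OF trivial_limit_at_right_real] by force
  \<comment> \<open>The surplus of degree \<open>k0\<close> has density
    \<open>\<eta> * p k0\<close>. Half of it is attached at the start; the other half leaves room
    for strict inequalities.\<close>
  define \<delta> where "\<delta> = \<eta> * p k0 / 2"
  have \<delta>: "0 < \<delta>" using \<eta> k0 by (simp add: \<delta>_def)
  have "(\<lambda>M. final_back \<eta> M) \<longlonglongrightarrow> mean_pos p / 2 - 1 - (1 - \<eta>) * (mean_pos p / 2 - 1)"
    unfolding final_back_def by (intro tendsto_intros mass_lim)
  moreover have "mean_pos p / 2 - 1 - (1 - \<eta>) * (mean_pos p / 2 - 1) = \<eta> * m"
    by (simp add: m_def field_simps)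
  ultimately have lim_y: "(\<lambda>M. final_back \<eta> M) \<longlonglongrightarrow> \<eta> * m" by simp
  have y_pos: "\<forall>\<^sub>F M in sequentially. 0 < final_back \<eta> M"
    by (rule order_tendstoD(1)[OF lim_y]) (use m \<eta> in simp)
  then have y_nonneg: "\<forall>\<^sub>F M in sequentially. 0 \<le> final_back \<eta> M" by eventually_elim auto
  have lim_theta: "(\<lambda>M. 1 - mass M) \<longlonglongrightarrow> 0"
    using tendsto_diff[OF tendsto_const[of 1] mass_lim] by simp
  define F where "F M = (1 - mass M) * ln (1 - mass M) - (1 - mass M) - \<eta> * (B + 1)
      + (1 - \<eta>) * (mean_pos p / 2 * ln total_xw - mean_pos p / 2 + (\<Sum>k=1..M. p k * ln (1 - beta p ^ k)))
      - 0 + (1 - \<eta>) * ln (1 - \<eta>) * (mean_pos p / 2 - mass M)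
      + final_back \<eta> M * ln 2 + (final_back \<eta> M * ln (final_back \<eta> M) - final_back \<eta> M)" for M
  have theta_ln: "(\<lambda>M. (1 - mass M) * ln (1 - mass M)) \<longlonglongrightarrow> 0"
    using tendsto_xlnx[OF lim_theta] mass_le by simp
  have y_ln: "(\<lambda>M. final_back \<eta> M * ln (final_back \<eta> M)) \<longlonglongrightarrow> \<eta> * m * ln (\<eta> * m)"
    by (rule tendsto_xlnx[OF lim_y y_nonneg]) (use m \<eta> in simp)
  have "F \<longlonglongrightarrow> f \<eta>"
    unfolding F_def f_def limit_conn_def
    by (intro tendsto_add tendsto_diff tendsto_mult tendsto_const theta_ln y_ln lim_y lim_theta mass_lim
        has_sum_imp_LIMSEQ_from_1[OF has_sum_log_surv])
  then have "\<forall>\<^sub>F M in sequentially. a < F M" using \<eta> by (intro order_tendstoD)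
  moreover have "\<forall>\<^sub>F M in sequentially. mean_pos p - (\<Sum>k=1..M. real k * p k) < \<delta>"
  proof -
    have "(\<lambda>M. mean_pos p - (\<Sum>k=1..M. real k * p k)) \<longlonglongrightarrow> mean_pos p - mean_pos p"
      by (intro tendsto_diff tendsto_const has_sum_imp_LIMSEQ_from_1[OF has_sum_mean])
    then show ?thesis using \<delta> by (intro order_tendstoD) auto
  qed
  moreover have "\<forall>\<^sub>F M in sequentially. 2 * (1 - mass M) + (total_xw - (\<Sum>k=1..M. real k * xw k)) < \<delta>"
  proof -
    have "(\<lambda>M. 2 * (1 - mass M) + (total_xw - (\<Sum>k=1..M. real k * xw k))) \<longlonglongrightarrow> 2 * (1 - 1) + (total_xw - total_xw)"
      by (intro tendsto_add tendsto_mult tendsto_diff tendsto_const mass_lim has_sum_imp_LIMSEQ_from_1[OF has_sum_total_xw])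
    then show ?thesis using \<delta> by (intro order_tendstoD) auto
  qed
  moreover note y_pos eventually_ge_at_top[of k0]
  ultimately have "\<forall>\<^sub>F M in sequentially. a < F M \<and> mean_pos p - (\<Sum>k=1..M. real k * p k) < \<delta>
    \<and> 2 * (1 - mass M) + (total_xw - (\<Sum>k=1..M. real k * xw k)) < \<delta> \<and> 0 < final_back \<eta> M \<and> k0 \<le> M"
    by eventually_elim auto
  then obtain M where M: "a < F M" "mean_pos p - (\<Sum>k=1..M. real k * p k) < \<delta>"
    "2 * (1 - mass M) + (total_xw - (\<Sum>k=1..M. real k * xw k)) < \<delta>" "0 < final_back \<eta> M" "k0 \<le> M"
    by (auto simp: eventually_sequentially)
  have lim_D: "(\<lambda>J. tau / real J * z) \<longlonglongrightarrow> 0" for z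
    using tendsto_mult[OF tendsto_mult[OF tendsto_const[of tau] lim_1_over_n] tendsto_const[of z]] by simp
  have "\<forall>\<^sub>F J in sequentially. tau / real J * (2 * total_xw + second_moment M) <
      \<delta> - (2 * (1 - mass M) + (total_xw - (\<Sum>k=1..M. real k * xw k)))"
    using M by (intro order_tendstoD(2)[OF lim_D]) auto
  moreover have "\<forall>\<^sub>F J in sequentially. tau / real J * (tau * second_moment M + mean_pos p) < F M - a"
    using M by (intro order_tendstoD(2)[OF lim_D]) auto
  ultimately have "\<forall>\<^sub>F J in sequentially. tau / real J * (2 * total_xw + second_moment M) <
      \<delta> - (2 * (1 - mass M) + (total_xw - (\<Sum>k=1..M. real k * xw k))) \<and>
      tau / real J * (tau * second_moment M + mean_pos p) < F M - a \<and> 0 < J"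
    using eventually_gt_at_top[of 0] by eventually_elim auto
  then obtain J where J: "tau / real J * (2 * total_xw + second_moment M) <
      \<delta> - (2 * (1 - mass M) + (total_xw - (\<Sum>k=1..M. real k * xw k)))"
    "tau / real J * (tau * second_moment M + mean_pos p) < F M - a" "0 < J"
    by (auto simp: eventually_sequentially)
  have "a < conn_lower \<eta> M J"
    using conn_lower_bound[OF \<eta>(3,2) _ J(3) B, of M] J(2) M(5) k0(1) by (simp add: F_def)
  moreover have "2 * (1 - mass M) + (total_xw - (\<Sum>k=1..M. real k * xw k))
      + tau / real J * (2 * total_xw + second_moment M) < \<eta> * p k0 / 2"
    using J(1) unfolding \<delta>_def by linarith
  ultimately show ?thesis
    by (rule that[OF \<eta>(3,2) k0(1) M(5) k0(2) J(3) M(2)[unfolded \<delta>_def] _ M(4), rotated])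
qed

end

text \<open>A calculus of linear growth rates: inequalities between counts for all large n are
  reduced to strict inequalities between limits.\<close>

definition scaled_lim :: "(nat \<Rightarrow> real) \<Rightarrow> real \<Rightarrow> bool" where
  "scaled_lim f l \<longleftrightarrow> (\<lambda>n. f n / real n) \<longlonglongrightarrow> l"

lemma scaled_lim_add: "scaled_lim f l \<Longrightarrow> scaled_lim g m \<Longrightarrow> scaled_lim (\<lambda>n. f n + g n) (l + m)"
  unfolding scaled_lim_def add_divide_distrib by (rule tendsto_add)

lemma scaled_lim_diff: "scaled_lim f l \<Longrightarrow> scaled_lim g m \<Longrightarrow> scaled_lim (\<lambda>n. f n - g n) (l - m)"
  unfolding scaled_lim_def diff_divide_distrib by (rule tendsto_diff)

lemma scaled_lim_cmult: "scaled_lim f l \<Longrightarrow> scaled_lim (\<lambda>n. c * f n) (c * l)"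
  unfolding scaled_lim_def times_divide_eq_right[symmetric] by (rule tendsto_mult_left)

lemma scaled_lim_sum: "(\<And>i. i \<in> I \<Longrightarrow> scaled_lim (f i) (l i)) \<Longrightarrow> scaled_lim (\<lambda>n. \<Sum>i\<in>I. f i n) (\<Sum>i\<in>I. l i)"
  unfolding scaled_lim_def sum_divide_distrib by (rule tendsto_sum)

lemma scaled_lim_const: "scaled_lim (\<lambda>n. c) 0"
  unfolding scaled_lim_def using tendsto_mult[OF tendsto_const[of c] lim_1_over_n] by simp

lemma scaled_lim_cong:
  assumes "scaled_lim f l" "\<forall>\<^sub>F n in sequentially. f n = g n"
  shows "scaled_lim g l"
proof -
  have "\<forall>\<^sub>F n in sequentially. f n / real n = g n / real n"
    using assms(2) by eventually_elim simp
  with assms(1) show ?thesis unfolding scaled_lim_def by (rule Lim_transform_eventually)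
qed

lemma scaled_lim_less:
  assumes "scaled_lim f l" "scaled_lim g m" "l < m"
  shows "\<forall>\<^sub>F n in sequentially. f n < g n"
  using eventually_less_of_lim[OF assms(1,2)[unfolded scaled_lim_def] assms(3)] eventually_gt_at_top[of 0]
  by eventually_elim (auto simp: divide_less_cancel)

lemmas scaled_lim_intros = scaled_lim_add scaled_lim_diff scaled_lim_cmult scaled_lim_sum

context degree_sequences
begin

definition high_count :: "nat \<Rightarrow> nat \<Rightarrow> nat" where
  "high_count M n = card {v\<in>{1..n}. d n v > M}"

lemma high_count_eq:
  assumes "n \<ge> 1"
  shows "high_count M n + (\<Sum>k=1..M. degree_count n (d n) k) = n"
proof -
  have "{1..n} = {v\<in>{1..n}. d n v > M} \<union> {v\<in>{1..n}. d n v \<le> M}" by auto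
  then have "n = card ({v\<in>{1..n}. d n v > M} \<union> {v\<in>{1..n}. d n v \<le> M})"
    by (metis card_atLeastAtMost diff_Suc_1)
  also have "\<dots> = high_count M n + card {v\<in>{1..n}. d n v \<le> M}"
    unfolding high_count_def by (rule card_Un_disjoint) auto
  also have "card {v\<in>{1..n}. d n v \<le> M} = (\<Sum>v\<in>{v\<in>{1..n}. d n v \<le> M}. 1)" by simp
  also have "\<dots> = (\<Sum>k=1..M. \<Sum>v\<in>{v\<in>{v\<in>{1..n}. d n v \<le> M}. d n v = k}. 1)"
    using degree_pos[OF assms] by (intro sum.group[symmetric]) auto
  also have "\<dots> = (\<Sum>k=1..M. degree_count n (d n) k)"
  proof (rule sum.cong)
    fix k assume "k \<in> {1..M}"
    then have "{v\<in>{v\<in>{1..n}. d n v \<le> M}. d n v = k} = {v\<in>{1..n}. d n v = k}" by auto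
    then show "(\<Sum>v\<in>{v\<in>{v\<in>{1..n}. d n v \<le> M}. d n v = k}. 1) = degree_count n (d n) k"
      by (simp add: degree_count_def)
  qed simp
  finally show ?thesis by simp
qed

lemma scaled_lim_high_count: "scaled_lim (\<lambda>n. real (high_count M n)) (1 - mass M)"
proof -
  have "scaled_lim (\<lambda>n. real n) 1"
    unfolding scaled_lim_def
    by (rule tendsto_eventually) (auto intro!: eventually_sequentiallyI[of 1])
  moreover have "scaled_lim (\<lambda>n. \<Sum>k=1..M. real (degree_count n (d n) k)) (mass M)"
    unfolding mass_def by (rule scaled_lim_sum) (use cond_a in \<open>auto simp: scaled_lim_def\<close>)
  ultimately have "scaled_lim (\<lambda>n. real n - (\<Sum>k=1..M. real (degree_count n (d n) k))) (1 - mass M)"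
    by (rule scaled_lim_diff)
  then show ?thesis
  proof (rule scaled_lim_cong)
    show "\<forall>\<^sub>F n in sequentially. real n - (\<Sum>k=1..M. real (degree_count n (d n) k)) = real (high_count M n)"
    proof (rule eventually_sequentiallyI[of 1])
      fix n :: nat assume n: "1 \<le> n"
      show "real n - (\<Sum>k=1..M. real (degree_count n (d n) k)) = real (high_count M n)"
        using arg_cong[OF high_count_eq[OF n, of M], of real] by simp
    qed
  qed
qed

text \<open>With all parameters but n fixed, the rounded trajectory is fed into
  \<open>weight_connected_schedule\<close>; the inequalities required there follow from comparisons
  of growth rates.\<close>

lemma norm_ln_conn_lower:
  assumes a: "a < limit_conn"
  shows "\<forall>\<^sub>F n in sequentially. wt n {1} > 0 \<and> a < norm_ln (\<lambda>n. real (wt n {1})) edges n"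
proof -
  obtain \<eta> k0 M J where \<eta>: "0 < \<eta>" "\<eta> < 1" and k0: "3 \<le> k0" "k0 \<le> M" "0 < p k0" and J: "0 < J"
    and c1: "mean_pos p - (\<Sum>k=1..M. real k * p k) < \<eta> * p k0 / 2"
    and c2: "2 * (1 - mass M) + (total_xw - (\<Sum>k=1..M. real k * xw k)) + tau / real J * (2 * total_xw + second_moment M)
      < \<eta> * p k0 / 2"
    and c3: "0 < final_back \<eta> M" and c4: "a < conn_lower \<eta> M J"
    by (rule conn_lower_params[OF a])
  define r where "r = 1 - \<eta>"
  have r: "0 < r" "r < 1" using \<eta> by (simp_all add: r_def)
  define D where "D = tau / real J"
  have D: "0 < D" using J tau_pos by (simp add: D_def)
  have JD: "real J * D = tau" using J by (simp add: D_def)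
  define t where "t j = real j * D" for j
  have t0: "0 \<le> t j" for j using D by (simp add: t_def)
  have tS: "t j + D = t (Suc j)" for j by (simp add: t_def algebra_simps)
  have tle: "t j \<le> tau" "t j + D \<le> tau" if "j < J" for j
  proof -
    have "real (Suc j) * D \<le> real J * D" using that D by (intro mult_right_mono) auto
    then show "t j + D \<le> tau" unfolding JD by (simp add: t_def algebra_simps)
    then show "t j \<le> tau" using D by simp
  qed
  define \<delta> where "\<delta> = \<eta> * p k0 / 2"
  have \<delta>: "0 < \<delta>" "2 * \<delta> = \<eta> * p k0" "\<delta> < p k0" using \<eta> k0 by (simp_all add: \<delta>_def)
  have M1: "1 \<le> M" using k0 by simp
  define Bj where "Bj j = alpha M (t j) + D * second_moment M" for j
  have Bj: "0 < Bj j" if "j < J" for j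
    using alpha_nonneg[of "t j" M] second_moment_pos[OF M1] t0[of j] tle[OF that] D by (simp add: Bj_def add_nonneg_pos)
  have bckp: "0 \<le> bck M (t j) D" if "j < J" for j using t0 tle[OF that] D by (intro bck_nonneg) auto
  have gamp: "0 \<le> gam k (t j) D" if "k \<ge> 1" for k j using D that by (intro gam_nonneg) auto
  define C where "C = M + M * M"
  define q where "q n = nat \<lfloor>real n * \<delta>\<rfloor>" for n
  define c where "c n j k = nat \<lfloor>real n * (r * gam k (t j) D)\<rfloor>" for n j k
  define b where "b n j = nat \<lfloor>real n * (r * bck M (t j) D)\<rfloor>" for n j
  define aa where "aa n j = nat \<lfloor>real n * (r * Bj j)\<rfloor>" for n j
  define N where "N n j = (\<Sum>k=1..M. c n j k) + b n j" for n j
  define x where "x n = (SOME v. v \<in> {1..n} \<and> d n v = k0)" for n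
  define u where "u n k = und n (x n) k" for n k
  define u' where "u' n = (u n)(k0 := u n k0 - q n)" for n
  define h where "h n = high_count M n" for n
  define s where "s n = edges n - h n - q n" for n
  define b' where "b' n = s n - (\<Sum>k=1..M. u' n k) - (\<Sum>j<J. b n j)" for n
  \<comment> \<open>Density withdrawn from degree k when the initial phase uses up \<open>q\<close>
    vertices of degree \<open>k0\<close>.\<close>
  define I where "I k = (if k = k0 then \<delta> else 0)" for k
  have Lq: "scaled_lim (\<lambda>n. real (q n)) \<delta>"
    unfolding scaled_lim_def q_def using \<delta> by (intro nat_floor_lim) simp
  have Lc: "scaled_lim (\<lambda>n. real (c n j k)) (r * gam k (t j) D)" if "k \<ge> 1" for j k
    unfolding scaled_lim_def c_def using r gamp[OF that] by (intro nat_floor_lim) simp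
  have Lb: "scaled_lim (\<lambda>n. real (b n j)) (r * bck M (t j) D)" if "j < J" for j
    unfolding scaled_lim_def b_def using r bckp[OF that] by (intro nat_floor_lim) simp
  have La: "scaled_lim (\<lambda>n. real (aa n j)) (r * Bj j)" if "j < J" for j
    unfolding scaled_lim_def aa_def using r Bj[OF that] by (intro nat_floor_lim) simp
  have LN: "scaled_lim (\<lambda>n. real (N n j)) (r * sig (t j) D)" if "j < J" for j
  proof -
    have "scaled_lim (\<lambda>n. (\<Sum>k=1..M. real (c n j k)) + real (b n j)) ((\<Sum>k=1..M. r * gam k (t j) D) + r * bck M (t j) D)"
      using that by (intro scaled_lim_add scaled_lim_sum Lc Lb) auto
    moreover have "(\<Sum>k=1..M. r * gam k (t j) D) + r * bck M (t j) D = r * sig (t j) D"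
      by (simp add: bck_def sum_distrib_left[symmetric] algebra_simps)
    ultimately show ?thesis by (simp add: N_def)
  qed
  have Lu: "scaled_lim (\<lambda>n. real (u n k)) (p k)" if "k \<ge> 1" for k
    unfolding scaled_lim_def u_def using lim_und[OF that, of x] .
  have Lh: "scaled_lim (\<lambda>n. real (h n)) (1 - mass M)"
    unfolding h_def by (rule scaled_lim_high_count)
  have Le: "scaled_lim (\<lambda>n. real (edges n)) (mean_pos p / 2)"
    unfolding scaled_lim_def by (rule lim_edges)
  have ev_q: "\<forall>\<^sub>F n in sequentially. real (q n) < real (u n k0)"
    using k0 by (intro scaled_lim_less[OF Lq Lu \<delta>(3)]) simp
  have Lu': "scaled_lim (\<lambda>n. real (u' n k)) (p k - I k)" if "k \<ge> 1" for k
  proof (cases "k = k0")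
    case True
    have "scaled_lim (\<lambda>n. real (u n k) - real (q n)) (p k - \<delta>)" by (intro scaled_lim_diff Lu Lq that)
    moreover have "\<forall>\<^sub>F n in sequentially. real (u n k) - real (q n) = real (u' n k)"
      using ev_q by eventually_elim (simp add: u'_def True of_nat_diff)
    ultimately show ?thesis using True by (simp add: I_def scaled_lim_cong)
  next
    case False
    then show ?thesis using Lu[OF that] by (simp add: u'_def I_def)
  qed
  have sumI: "(\<Sum>k=1..M. f k * I k) = f k0 * \<delta>" for f
  proof -
    have "(\<Sum>k=1..M. f k * I k) = (\<Sum>k\<in>{k0}. f k * I k)"
      using k0 by (intro sum.mono_neutral_right) (auto simp: I_def)
    then show ?thesis by (simp add: I_def)
  qed
  have sumu': "(\<Sum>k=1..M. p k - I k) = mass M - \<delta>"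
    using sumI[of "\<lambda>_. 1"] by (simp add: sum_subtractf mass_def)
  have summ: "(\<Sum>k=1..M. real k * p k) \<le> mean_pos p"
    using p_nonneg by (intro sum_le_has_sum_from_1[OF has_sum_mean]) auto
  have two_mass: "2 * (1 - mass M) < \<delta>" and small: "2 * (1 - mass M) + alpha M 0 + D * (2 * total_xw + second_moment M) < \<delta>"
    and a00: "0 \<le> alpha M 0"
  proof -
    have a0: "alpha M 0 = total_xw - (\<Sum>k=1..M. real k * xw k)" by (simp add: alpha_def)
    show "2 * (1 - mass M) + alpha M 0 + D * (2 * total_xw + second_moment M) < \<delta>"
      using c2 by (simp add: a0 D_def \<delta>_def)
    moreover show "0 \<le> alpha M 0" using tau_pos by (intro alpha_nonneg) auto
    moreover have "0 \<le> D * (2 * total_xw + second_moment M)"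
      using D total_xw_pos second_moment_pos[OF M1] by simp
    ultimately show "2 * (1 - mass M) < \<delta>" by linarith
  qed
  have dm: "\<delta> < mass M"
  proof -
    have "p k0 \<le> mass M" unfolding mass_def using k0 p_nonneg by (intro member_le_sum) auto
    then show ?thesis using \<delta> by simp
  qed
  have ev_e: "\<forall>\<^sub>F n in sequentially. real (h n) + real (q n) < real (edges n)"
    by (rule scaled_lim_less[OF scaled_lim_add[OF Lh Lq] Le]) (use mean_gt_2 dm in linarith)
  have Ls: "scaled_lim (\<lambda>n. real (s n)) (mean_pos p / 2 - (1 - mass M) - \<delta>)"
  proof (rule scaled_lim_cong)
    show "scaled_lim (\<lambda>n. real (edges n) - real (h n) - real (q n)) (mean_pos p / 2 - (1 - mass M) - \<delta>)"
      by (intro scaled_lim_diff Le Lh Lq)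
    show "\<forall>\<^sub>F n in sequentially. real (edges n) - real (h n) - real (q n) = real (s n)"
      using ev_e by eventually_elim (auto simp: s_def)
  qed
  have sumb: "(\<Sum>j<J. r * bck M (t j) D) = r * (mean_pos p / 2 - mass M)"
    using sum_bck[OF J, of M] by (simp add: sum_distrib_left[symmetric] t_def D_def)
  have Lub: "scaled_lim (\<lambda>n. (\<Sum>k=1..M. real (u' n k)) + (\<Sum>j<J. real (b n j)))
      ((mass M - \<delta>) + r * (mean_pos p / 2 - mass M))"
    unfolding sumu'[symmetric] sumb[symmetric] by (intro scaled_lim_add scaled_lim_sum Lu' Lb) auto
  have fb: "mean_pos p / 2 - (1 - mass M) - \<delta> - ((mass M - \<delta>) + r * (mean_pos p / 2 - mass M)) = final_back \<eta> M"
    by (simp add: final_back_def r_def)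
  have ev_b': "\<forall>\<^sub>F n in sequentially. (\<Sum>k=1..M. real (u' n k)) + (\<Sum>j<J. real (b n j)) < real (s n)"
    by (rule scaled_lim_less[OF Lub Ls]) (use c3 fb in linarith)
  have Lb': "scaled_lim (\<lambda>n. real (b' n)) (final_back \<eta> M)"
  proof (rule scaled_lim_cong)
    show "scaled_lim (\<lambda>n. real (s n) - ((\<Sum>k=1..M. real (u' n k)) + (\<Sum>j<J. real (b n j)))) (final_back \<eta> M)"
      unfolding fb[symmetric] by (intro scaled_lim_diff Ls Lub)
    show "\<forall>\<^sub>F n in sequentially. real (s n) - ((\<Sum>k=1..M. real (u' n k)) + (\<Sum>j<J. real (b n j))) = real (b' n)"
      using ev_b'
    proof eventually_elim
      case (elim n)
      have "real ((\<Sum>k=1..M. u' n k) + (\<Sum>j<J. b n j)) < real (s n)" using elim by simp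
      then have "(\<Sum>k=1..M. u' n k) + (\<Sum>j<J. b n j) < s n" by (simp only: of_nat_less_iff)
      then have "b' n + ((\<Sum>k=1..M. u' n k) + (\<Sum>j<J. b n j)) = s n" by (simp add: b'_def)
      from arg_cong[OF this, of real]
      have "real (b' n) + ((\<Sum>k=1..M. real (u' n k)) + (\<Sum>j<J. real (b n j))) = real (s n)" by simp
      then show ?case by linarith
    qed
  qed
  have ev_x: "\<forall>\<^sub>F n in sequentially. x n \<in> {1..n} \<and> d n (x n) = k0"
  proof -
    have "scaled_lim (\<lambda>n. real (degree_count n (d n) k0)) (p k0)"
      unfolding scaled_lim_def using k0 by (intro cond_a) simp
    from scaled_lim_less[OF scaled_lim_const[of 0] this k0(3)] show ?thesis
    proof eventually_elim
      case (elim n)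
      then have "{v \<in> {1..n}. d n v = k0} \<noteq> {}" unfolding degree_count_def by (metis card.empty less_irrefl of_nat_0)
      then have "\<exists>v. v \<in> {1..n} \<and> d n v = k0" by auto
      then show ?case unfolding x_def by (rule someI_ex)
    qed
  qed
  have ev_high: "\<forall>\<^sub>F n in sequentially. real (high_degree M n) < real (q n)"
    using lim_high_degree[of M, folded scaled_lim_def] Lq by (rule scaled_lim_less) (use c1 in \<open>simp add: \<delta>_def\<close>)
  have sumc: "(\<Sum>j<J. r * gam k (t j) D) = r * p k" if "k \<ge> 1" for k
    using sum_gam[OF J that] by (simp add: sum_distrib_left[symmetric] t_def D_def)
  have Lsc: "scaled_lim (\<lambda>n. \<Sum>j<J. real (c n j k)) (r * p k)" if "k \<ge> 1" for k
    unfolding sumc[OF that, symmetric] by (intro scaled_lim_sum Lc that)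
  \<comment> \<open>That delta is only half of the surplus is used here: r * p k0 + delta < p
    k0.\<close>
  have I_less: "r * p k < p k - I k" if "k \<ge> 1" "p k > 0" for k
    using \<delta> \<eta> that k0 by (auto simp: I_def r_def algebra_simps)
  have ev_c: "\<forall>\<^sub>F n in sequentially. \<forall>k\<in>{1..M}. (\<Sum>j<J. c n j k) \<le> u' n k"
  proof (rule eventually_ball_finite)
    show "\<forall>k\<in>{1..M}. \<forall>\<^sub>F n in sequentially. (\<Sum>j<J. c n j k) \<le> u' n k"
    proof
      fix k assume "k \<in> {1..M}"
      then have k: "k \<ge> 1" by simp
      show "\<forall>\<^sub>F n in sequentially. (\<Sum>j<J. c n j k) \<le> u' n k"
      proof (cases "p k = 0")
        case True
        \<comment> \<open>Both limits are 0 and a strict comparison fails, but then no block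
          contains a vertex of degree k.\<close>
        then show ?thesis by (simp add: c_def gam_def xw_def)
      next
        case False
        then have "\<forall>\<^sub>F n in sequentially. (\<Sum>j<J. real (c n j k)) < real (u' n k)"
          using p_nonneg[OF k] by (intro scaled_lim_less[OF Lsc[OF k] Lu'[OF k]] I_less k) auto
        then show ?thesis
        proof eventually_elim
          case (elim n)
          then have "real (\<Sum>j<J. c n j k) < real (u' n k)" by simp
          then show ?case by (simp only: of_nat_less_iff less_imp_le)
        qed
      qed
    qed
  qed simp
  have ev_L: "\<forall>\<^sub>F n in sequentially. real C + (\<Sum>j<J. real (c n j 1)) < real (u' n 1)"
    by (rule scaled_lim_less[OF scaled_lim_add[OF scaled_lim_const Lsc] Lu']) (use I_less[of 1] p1 in simp_all)
  have lim_w: "(\<Sum>k=1..M. real k * (p k - I k)) = (\<Sum>k=1..M. real k * p k) - real k0 * \<delta>"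
    unfolding sumI[of real, symmetric] by (simp add: sum_subtractf right_diff_distrib)
  have k0d: "3 * \<delta> \<le> real k0 * \<delta>" using k0 \<delta> by (intro mult_right_mono) auto
  have arith1: "S - kd + 0 < 2 * (m / 2 - w - dl)"
    if "S \<le> m" "2 * w < dl" "3 * dl \<le> kd" for S m w dl kd :: real
    using that by (simp add: field_simps)
  \<comment> \<open>Each of the \<open>q\<close> vertices adds at least one active half-edge net, so
    the initial phases leave a density of at least delta - 2 (1 - mass M). This must pay for the
    reserve of two half-edges per step, the value \<open>alpha M 0\<close> and the mesh
    error.\<close>
  have arith2: "A + 0 + (Al + E) < 2 * (m / 2 - w - dl) - (S - kd) + p' + (Al - a0)"
    if "A + a0 + E < dl - 2 * w" "0 \<le> p'" "S \<le> m" "3 * dl \<le> kd" for A Al E m w dl S kd p' a0 :: real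
    using that by (simp add: field_simps)
  have ev_tot: "\<forall>\<^sub>F n in sequentially. (\<Sum>k=1..M. real k * real (u' n k)) + 1 < 2 * real (s n)"
  proof (rule scaled_lim_less)
    show "scaled_lim (\<lambda>n. (\<Sum>k=1..M. real k * real (u' n k)) + 1) ((\<Sum>k=1..M. real k * (p k - I k)) + 0)"
      by (intro scaled_lim_add scaled_lim_sum scaled_lim_cmult Lu' scaled_lim_const) auto
    show "scaled_lim (\<lambda>n. 2 * real (s n)) (2 * (mean_pos p / 2 - (1 - mass M) - \<delta>))"
      by (intro scaled_lim_cmult Ls)
    show "(\<Sum>k=1..M. real k * (p k - I k)) + 0 < 2 * (mean_pos p / 2 - (1 - mass M) - \<delta>)"
      unfolding lim_w by (rule arith1[OF summ two_mass k0d])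
  qed
  define rhs where "rhs n j = 2 * real (s n) - (\<Sum>k=1..M. real k * real (u' n k))
      + (\<Sum>k=2..M. (real k - 2) * (real (u' n k) - (\<Sum>i<J. real (c n i k))))
      + (\<Sum>i<j. (\<Sum>k=1..M. real k * real (c n i k)) - 2 * real (N n i))" for n j
  have ev_cond: "\<forall>\<^sub>F n in sequentially. \<forall>j\<in>{..<J}. 2 * real (N n j) + real C + real (aa n j) < rhs n j"
  proof (rule eventually_ball_finite)
    show "\<forall>j\<in>{..<J}. \<forall>\<^sub>F n in sequentially. 2 * real (N n j) + real C + real (aa n j) < rhs n j"
    proof
      fix j assume "j \<in> {..<J}"
      then have j: "j < J" by simp
      show "\<forall>\<^sub>F n in sequentially. 2 * real (N n j) + real C + real (aa n j) < rhs n j"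
      proof (rule scaled_lim_less)
        show "scaled_lim (\<lambda>n. 2 * real (N n j) + real C + real (aa n j)) (2 * (r * sig (t j) D) + 0 + r * Bj j)"
          by (intro scaled_lim_add scaled_lim_cmult LN La scaled_lim_const j)
        show "scaled_lim (\<lambda>n. rhs n j) (2 * (mean_pos p / 2 - (1 - mass M) - \<delta>) - (\<Sum>k=1..M. real k * (p k - I k))
          + (\<Sum>k=2..M. (real k - 2) * ((p k - I k) - r * p k))
          + (\<Sum>i<j. (\<Sum>k=1..M. real k * (r * gam k (t i) D)) - 2 * (r * sig (t i) D)))"
          unfolding rhs_def using j by (intro scaled_lim_intros Ls Lu' Lsc Lc LN) auto
        have pos: "0 \<le> (\<Sum>k=2..M. (real k - 2) * ((p k - I k) - r * p k))"
        proof (rule sum_nonneg)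
          fix k assume k: "k \<in> {2..M}"
          have "r * p k \<le> p k - I k"
          proof (cases "p k = 0")
            case True
            then have "k \<noteq> k0" using k0 by auto
            then show ?thesis using True by (simp add: I_def)
          next
            case False
            then show ?thesis using I_less[of k] p_nonneg[of k] k by simp
          qed
          then show "0 \<le> (real k - 2) * ((p k - I k) - r * p k)" using k by simp
        qed
        have "(\<Sum>i<j. (\<Sum>k=1..M. real k * (r * gam k (t i) D)) - 2 * (r * sig (t i) D))
            = (\<Sum>i<j. r * (alpha M (t (Suc i)) - alpha M (t i)))"
        proof (rule sum.cong)
          fix i
          have pull: "(\<Sum>k=1..M. real k * (r * gam k (t i) D)) = r * (\<Sum>k=1..M. real k * gam k (t i) D)"
            unfolding sum_distrib_left by (rule sum.cong) auto
          have step: "alpha M (t (Suc i)) - alpha M (t i) = (\<Sum>k=1..M. real k * gam k (t i) D) - 2 * sig (t i) D"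
            using alpha_step[of M "t i" D] unfolding tS by simp
          show "(\<Sum>k=1..M. real k * (r * gam k (t i) D)) - 2 * (r * sig (t i) D) = r * (alpha M (t (Suc i)) - alpha M (t i))"
            unfolding pull step by (simp add: right_diff_distrib)
        qed simp
        also have "\<dots> = r * (alpha M (t j) - alpha M (t 0))"
          unfolding sum_distrib_left[symmetric] by (subst sum_lessThan_telescope) simp
        \<comment> \<open>The blocks change the balance by differences of \<open>alpha\<close>; its
          value at time 0 need not vanish for finite \<open>M\<close> and is charged to
          delta.\<close>
        finally have tele: "(\<Sum>i<j. (\<Sum>k=1..M. real k * (r * gam k (t i) D)) - 2 * (r * sig (t i) D))
            = r * alpha M (t j) - r * alpha M 0" by (simp add: t_def right_diff_distrib)
        have "sig (t j) D \<le> D * total_xw"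
        proof -
          have "D * (total_xw * exp (- (2 * t j))) \<le> D * (total_xw * 1)"
            using D total_xw_pos t0[of j] by (intro mult_left_mono) auto
          then show ?thesis using sig_upper[of "t j" D] by simp
        qed
        then have "r * (2 * sig (t j) D + alpha M 0 + D * second_moment M) \<le> r * (2 * (D * total_xw) + alpha M 0 + D * second_moment M)"
          using r by (intro mult_left_mono) auto
        also have "\<dots> \<le> 1 * (2 * (D * total_xw) + alpha M 0 + D * second_moment M)"
          using r a00 D total_xw_pos second_moment_pos[OF M1] by (intro mult_right_mono) auto
        also have "\<dots> < \<delta> - 2 * (1 - mass M)" using small by (simp add: algebra_simps)
        finally have "r * (2 * sig (t j) D + alpha M 0 + D * second_moment M) < \<delta> - 2 * (1 - mass M)" .
        then have "2 * (r * sig (t j) D) + r * alpha M 0 + r * (D * second_moment M) < \<delta> - 2 * (1 - mass M)"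
          by (simp add: algebra_simps)
        moreover have BB: "r * Bj j = r * alpha M (t j) + r * (D * second_moment M)" by (simp add: Bj_def algebra_simps)
        ultimately show "2 * (r * sig (t j) D) + 0 + r * Bj j <
          2 * (mean_pos p / 2 - (1 - mass M) - \<delta>) - (\<Sum>k=1..M. real k * (p k - I k))
          + (\<Sum>k=2..M. (real k - 2) * ((p k - I k) - r * p k))
          + (\<Sum>i<j. (\<Sum>k=1..M. real k * (r * gam k (t i) D)) - 2 * (r * sig (t i) D))"
          unfolding tele lim_w BB using pos summ k0d by (intro arith2)
      qed
    qed
  qed simp
  have ev_a: "\<forall>\<^sub>F n in sequentially. \<forall>j\<in>{..<J}. 0 < aa n j"
  proof (rule eventually_ball_finite)
    show "\<forall>j\<in>{..<J}. \<forall>\<^sub>F n in sequentially. 0 < aa n j"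
    proof
      fix j assume "j \<in> {..<J}"
      then have "\<forall>\<^sub>F n in sequentially. 0 < real (aa n j)"
        using r Bj by (intro scaled_lim_less[OF scaled_lim_const La]) auto
      then show "\<forall>\<^sub>F n in sequentially. 0 < aa n j" by simp
    qed
  qed simp
  \<comment> \<open>Normalised logarithm of the lower bound for the weight that
    \<open>weight_connected_schedule\<close> gives after division by the block factorials.\<close>
  define g where "g n = norm_ln (\<lambda>n. fact (h n)) h n
    + (\<Sum>k=1..M. real (u n k) / real n * ln (real k) + norm_ln (\<lambda>n. fact (u n k)) (\<lambda>n. u n k) n)
    + (\<Sum>j<J. norm_ln (\<lambda>n. fact (N n j)) (\<lambda>n. N n j) n + real (b n j) / real n * ln (real (aa n j) / real n)
        - (\<Sum>k=1..M. norm_ln (\<lambda>n. fact (c n j k)) (\<lambda>n. c n j k) n) - norm_ln (\<lambda>n. fact (b n j)) (\<lambda>n. b n j) n)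
    + real (b' n) / real n * ln 2 + norm_ln (\<lambda>n. fact (b' n)) b' n" for n
  have "g \<longlonglongrightarrow> ((1 - mass M) * ln (1 - mass M) - (1 - mass M))
    + (\<Sum>k=1..M. p k * ln (real k) + (p k * ln (p k) - p k))
    + (\<Sum>j<J. (r * sig (t j) D * ln (r * sig (t j) D) - r * sig (t j) D)
        + r * bck M (t j) D * ln (r * Bj j)
        - (\<Sum>k=1..M. r * gam k (t j) D * ln (r * gam k (t j) D) - r * gam k (t j) D)
        - (r * bck M (t j) D * ln (r * bck M (t j) D) - r * bck M (t j) D))
    + final_back \<eta> M * ln 2 + (final_back \<eta> M * ln (final_back \<eta> M) - final_back \<eta> M)"
    unfolding g_def
    by (intro tendsto_add tendsto_diff tendsto_sum tendsto_mult tendsto_const tendsto_ln norm_ln_fact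
        Lh[unfolded scaled_lim_def] Lu[unfolded scaled_lim_def] LN[unfolded scaled_lim_def] Lb[unfolded scaled_lim_def]
        La[unfolded scaled_lim_def] Lc[unfolded scaled_lim_def] Lb'[unfolded scaled_lim_def])
      (use r Bj in \<open>auto simp: less_imp_neq[symmetric]\<close>)
  then have g_lim: "g \<longlonglongrightarrow> conn_lower \<eta> M J"
    unfolding conn_lower_def Let_def D_def[symmetric] r_def[symmetric] t_def Bj_def .
  have main: "\<forall>\<^sub>F n in sequentially. wt n {1} > 0 \<and> g n \<le> norm_ln (\<lambda>n. real (wt n {1})) edges n"
    using ev_q ev_e ev_b' ev_x ev_high ev_c ev_L ev_tot ev_cond ev_a eventually_ge_at_top[of 1]
  proof eventually_elim
    case (elim n)
    have n: "n \<ge> 1" using elim by simp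
    interpret exploration "{1..n}" "d n" by (rule exploration_interval)
    have wx: "wt n {x n} = wt n {1}"
      using weight_connected_graphs[of "x n" n "d n"] weight_connected_graphs[of 1 n "d n"] elim(4) n by simp
    have q_le: "q n \<le> u n k0" using elim(1) by simp
    have s_eq: "edges n = s n + h n + q n" using elim(2) by (simp add: s_def)
    have "real ((\<Sum>k=1..M. u' n k) + (\<Sum>j<J. b n j)) < real (s n)" using elim(3) by simp
    then have "(\<Sum>k=1..M. u' n k) + (\<Sum>j<J. b n j) < s n" by (simp only: of_nat_less_iff)
    then have b'_eq: "s n = (\<Sum>k=1..M. u' n k) + (\<Sum>j<J. b n j) + b' n" by (simp add: b'_def)
    have fin_ineq: "fact (h n) * (\<Prod>k=1..M. k ^ undisc {x n} k * fact (undisc {x n} k)) *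
        ((\<Prod>j<J. fact (N n j) * aa n j ^ b n j) * (2 ^ b' n * fact (b' n)))
      \<le> (\<Prod>j<J. (\<Prod>k=1..M. fact (c n j k)) * fact (b n j)) * weight {x n} {}"
    proof (rule weight_connected_schedule[where q = "q n" and C = C and s = "s n" and u' = "u' n"])
      show "x n \<in> {1..n}" "d n (x n) = k0" using elim(4) by auto
      show "3 \<le> k0" "k0 \<le> M" using k0 by auto
      show "\<forall>v\<in>{1..n}. 1 \<le> d n v" by (rule degree_pos[OF n])
      show "C = M + M * M" by (rule C_def)
      show "h n = card {v \<in> {1..n}. M < d n v}" by (simp add: h_def high_count_def)
      show "(\<Sum>v\<in>{v \<in> {1..n}. M < d n v}. d n v) \<le> q n"
      proof -
        have "high_degree M n < q n" using elim(5) by (simp only: of_nat_less_iff)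
        then show ?thesis by (simp add: high_degree_def)
      qed
      show "q n \<le> undisc {x n} k0" using q_le by (simp add: u_def)
      show "(\<Sum>v\<in>{1..n}. d n v) = 2 * (s n + h n + q n)" using total_edges[OF n] s_eq by simp
      show "u' n = (undisc {x n})(k0 := undisc {x n} k0 - q n)" by (auto simp: u'_def u_def)
      show "N n j = (\<Sum>k = 1..M. c n j k) + b n j" for j by (rule N_def)
      show "(\<Sum>j<J. c n j k) \<le> u' n k" if "k \<in> {1..M}" for k using elim(6) that by blast
      show "(\<Sum>k = 1..M. k * u' n k) + 1 \<le> 2 * s n"
      proof -
        have "real ((\<Sum>k = 1..M. k * u' n k) + 1) < real (2 * s n)" using elim(8) by simp
        then show ?thesis by (simp only: of_nat_less_iff less_imp_le)
      qed
      show "s n = (\<Sum>k = 1..M. u' n k) + (\<Sum>j<J. b n j) + b' n" by (rule b'_eq)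
      show "C + (\<Sum>j<J. c n j 1) \<le> u' n 1"
      proof -
        have "real (C + (\<Sum>j<J. c n j 1)) < real (u' n 1)" using elim(7) by simp
        then show ?thesis by (simp only: of_nat_less_iff less_imp_le)
      qed
      show "real (2 * N n j + C + aa n j) \<le> 2 * real (s n) - (\<Sum>k = 1..M. real k * real (u' n k)) +
          (\<Sum>k = 2..M. (real k - 2) * (real (u' n k) - (\<Sum>i<J. real (c n i k)))) +
          (\<Sum>i<j. (\<Sum>k = 1..M. real k * real (c n i k)) - 2 * real (N n i))" if "j < J" for j
      proof -
        have "2 * real (N n j) + real C + real (aa n j) < rhs n j" using elim(9) that by blast
        then show ?thesis unfolding rhs_def[symmetric] by simp
      qed
    qed
    define W where "W = wt n {1}"
    define P1 where "P1 = (\<Prod>k=1..M. real k ^ u n k * fact (u n k))"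
    define P2 where "P2 = (\<Prod>j<J. fact (N n j) * real (aa n j) ^ b n j)"
    define P3 where "P3 = (\<Prod>j<J. (\<Prod>k=1..M. fact (c n j k)) * fact (b n j) :: real)"
    have "real (fact (h n) * (\<Prod>k=1..M. k ^ undisc {x n} k * fact (undisc {x n} k)) *
        ((\<Prod>j<J. fact (N n j) * aa n j ^ b n j) * (2 ^ b' n * fact (b' n))))
      \<le> real ((\<Prod>j<J. (\<Prod>k=1..M. fact (c n j k)) * fact (b n j)) * weight {x n} {})"
      using fin_ineq by (rule of_nat_mono)
    then have ineq: "fact (h n) * P1 * (P2 * (2 ^ b' n * fact (b' n))) \<le> P3 * real W"
      unfolding P1_def P2_def P3_def W_def wx[symmetric] u_def by simp
    have P1: "0 < P1" unfolding P1_def by (intro prod_pos) auto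
    have P2: "0 < P2" unfolding P2_def using elim(10) by (intro prod_pos) auto
    have P3: "0 < P3" unfolding P3_def by (intro prod_pos mult_pos_pos) auto
    have lhs: "0 < fact (h n) * P1 * (P2 * (2 ^ b' n * fact (b' n)))" using P1 P2 by simp
    have W: "0 < W"
    proof (rule ccontr)
      assume "\<not> 0 < W"
      then show False using ineq lhs by simp
    qed
    have lnP1: "ln P1 = (\<Sum>k=1..M. real (u n k) * ln (real k) + ln (fact (u n k)))"
      unfolding P1_def by (subst ln_prod) (auto simp: ln_mult ln_realpow intro!: sum.cong)
    have lnP2: "ln P2 = (\<Sum>j<J. ln (fact (N n j)) + real (b n j) * ln (real (aa n j)))"
      unfolding P2_def using elim(10) by (subst ln_prod) (auto simp: ln_mult ln_realpow intro!: sum.cong)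
    have lnP3: "ln P3 = (\<Sum>j<J. (\<Sum>k=1..M. ln (fact (c n j k))) + ln (fact (b n j)))"
    proof -
      have pc: "0 < (\<Prod>k=1..M. fact (c n j k) :: real)" for j by (intro prod_pos) auto
      have "ln P3 = (\<Sum>j<J. ln ((\<Prod>k=1..M. fact (c n j k)) * fact (b n j)))"
        unfolding P3_def using pc by (intro ln_prod) (auto simp: less_imp_neq[symmetric])
      also have "\<dots> = (\<Sum>j<J. (\<Sum>k=1..M. ln (fact (c n j k))) + ln (fact (b n j)))"
      proof (rule sum.cong)
        fix j
        have "ln ((\<Prod>k=1..M. fact (c n j k)) * fact (b n j)) = ln (\<Prod>k=1..M. fact (c n j k)) + ln (fact (b n j) :: real)"
          using pc[of j] by (intro ln_mult_pos) auto
        also have "ln (\<Prod>k=1..M. fact (c n j k) :: real) = (\<Sum>k=1..M. ln (fact (c n j k)))"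
          by (rule ln_prod) auto
        finally show "ln ((\<Prod>k=1..M. fact (c n j k)) * fact (b n j)) = (\<Sum>k=1..M. ln (fact (c n j k))) + ln (fact (b n j) :: real)" .
      qed simp
      finally show ?thesis .
    qed
    have "ln (fact (h n) * P1 * (P2 * (2 ^ b' n * fact (b' n)))) \<le> ln (P3 * real W)"
      using ineq lhs P3 W by (subst ln_le_cancel_iff) auto
    then have le: "ln (fact (h n)) + ln P1 + (ln P2 + (real (b' n) * ln 2 + ln (fact (b' n)))) \<le> ln P3 + ln (real W)"
      using P1 P2 P3 W by (simp add: ln_mult_pos ln_realpow)
    define l where "l = ln (real n)"
    have un: "(\<Sum>k=1..M. u n k) = (\<Sum>k=1..M. u' n k) + q n"
    proof -
      have k0M: "k0 \<in> {1..M}" using k0 by simp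
      have "(\<Sum>k\<in>{1..M}-{k0}. u n k) = (\<Sum>k\<in>{1..M}-{k0}. u' n k)" by (intro sum.cong) (auto simp: u'_def)
      moreover have "u n k0 = u' n k0 + q n" using q_le by (simp add: u'_def)
      ultimately show ?thesis
        using sum.remove[OF finite_atLeastAtMost k0M, of "u n"] sum.remove[OF finite_atLeastAtMost k0M, of "u' n"] by simp
    qed
    \<comment> \<open>Every edge is revealed by exactly one step, a discovery or the closing of a
      cycle; hence the coefficients of ln n add up to \<open>edges n\<close>.\<close>
    have "edges n = h n + (\<Sum>k=1..M. u n k) + (\<Sum>j<J. b n j) + b' n"
      unfolding un using s_eq b'_eq by simp
    from arg_cong[OF this, of real]
    have edges_eq: "real (edges n) = real (h n) + (\<Sum>k=1..M. real (u n k)) + (\<Sum>j<J. real (b n j)) + real (b' n)" by simp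
    have g1: "(\<Sum>k=1..M. real (u n k) / real n * ln (real k) + norm_ln (\<lambda>n. fact (u n k)) (\<lambda>n. u n k) n)
      = (ln P1 - (\<Sum>k=1..M. real (u n k)) * l) / real n"
      unfolding lnP1 norm_ln_def l_def[symmetric] sum_distrib_right sum_subtractf[symmetric] sum_divide_distrib
      by (intro sum.cong) (auto simp: add_divide_distrib diff_divide_distrib)
    have g2: "(\<Sum>j<J. norm_ln (\<lambda>n. fact (N n j)) (\<lambda>n. N n j) n + real (b n j) / real n * ln (real (aa n j) / real n)
        - (\<Sum>k=1..M. norm_ln (\<lambda>n. fact (c n j k)) (\<lambda>n. c n j k) n) - norm_ln (\<lambda>n. fact (b n j)) (\<lambda>n. b n j) n)
      = (ln P2 - ln P3 - (\<Sum>j<J. real (b n j)) * l) / real n"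
    proof -
      have "norm_ln (\<lambda>n. fact (N n j)) (\<lambda>n. N n j) n + real (b n j) / real n * ln (real (aa n j) / real n)
        - (\<Sum>k=1..M. norm_ln (\<lambda>n. fact (c n j k)) (\<lambda>n. c n j k) n) - norm_ln (\<lambda>n. fact (b n j)) (\<lambda>n. b n j) n
        = (ln (fact (N n j)) + real (b n j) * ln (real (aa n j)) - ((\<Sum>k=1..M. ln (fact (c n j k))) + ln (fact (b n j)))
          - real (b n j) * l) / real n" if "j \<in> {..<J}" for j
      proof -
        have c_sum: "(\<Sum>k=1..M. norm_ln (\<lambda>n. fact (c n j k)) (\<lambda>n. c n j k) n) =
            ((\<Sum>k=1..M. ln (fact (c n j k))) - (\<Sum>k=1..M. real (c n j k)) * l) / real n"
          unfolding norm_ln_def l_def[symmetric] sum_distrib_right sum_subtractf[symmetric] sum_divide_distrib ..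
        have Nr: "real (N n j) = (\<Sum>k=1..M. real (c n j k)) + real (b n j)" by (simp add: N_def)
        have la: "ln (real (aa n j) / real n) = ln (real (aa n j)) - l"
          using elim(10) that n by (simp add: ln_div l_def)
        show ?thesis
          unfolding c_sum la unfolding norm_ln_def l_def[symmetric] Nr
          by (simp add: add_divide_distrib diff_divide_distrib distrib_right right_diff_distrib mult.commute[of l])
      qed
      then show ?thesis
        unfolding lnP2 lnP3 sum_distrib_right sum_subtractf[symmetric] sum_divide_distrib
        by (intro sum.cong) auto
    qed
    have "g n = (ln (fact (h n)) + ln P1 + (ln P2 + (real (b' n) * ln 2 + ln (fact (b' n)))) - ln P3 - real (edges n) * l) / real n"
      unfolding g_def unfolding g1 g2 unfolding edges_eq norm_ln_def l_def[symmetric]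
      by (simp add: add_divide_distrib diff_divide_distrib distrib_right)
    also have "\<dots> \<le> (ln (real W) - real (edges n) * l) / real n"
      using le by (intro divide_right_mono) auto
    finally have "g n \<le> norm_ln (\<lambda>n. real (wt n {1})) edges n" by (simp add: norm_ln_def W_def l_def)
    then show ?case using W by (simp add: W_def)
  qed
  have "\<forall>\<^sub>F n in sequentially. a < norm_ln (\<lambda>n. real (wt n {1})) edges n"
    using main by (intro eventually_gt_of_lim[OF g_lim c4]) (auto elim: eventually_mono)
  with main show ?thesis by eventually_elim auto
qed

end

text \<open>The error term is (ln a - ln b) / n + K; eventual positivity lets the exponential
  recover a from b.\<close>

lemma exp_equivI:
  assumes "\<forall>\<^sub>F n in sequentially. 0 < a n \<and> 0 < b n"
    and "(\<lambda>n. (ln (a n) - ln (b n)) / real n) \<longlonglongrightarrow> - K"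
  shows "exp_equiv K a b"
  unfolding exp_equiv_def
proof (intro exI conjI)
  have "(\<lambda>n. (ln (a n) - ln (b n)) / real n + K) \<longlonglongrightarrow> - K + K"
    by (intro tendsto_add assms(2) tendsto_const)
  then show "(\<lambda>n. (ln (a n) - ln (b n)) / real n + K) \<longlonglongrightarrow> 0" by simp
  show "\<forall>\<^sub>F n in sequentially. a n = exp (- K * real n + ((ln (a n) - ln (b n)) / real n + K) * real n) * b n"
    using assms(1) eventually_gt_at_top[of 0]
  proof eventually_elim
    case (elim n)
    then have "- K * real n + ((ln (a n) - ln (b n)) / real n + K) * real n = ln (a n) - ln (b n)"
      by (simp add: distrib_right)
    then show ?case using elim by (simp add: exp_diff)
  qed
qed

section \<open>Limits of the normalised counts and the two equivalences\<close>

context degree_sequences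
begin

lemma eventually_conn_pos: "\<forall>\<^sub>F n in sequentially. 0 < wt n {1}"
proof -
  have "limit_conn - 1 < limit_conn" by simp
  from norm_ln_conn_lower[OF this] show ?thesis by eventually_elim blast
qed

lemma eventually_all_pos: "\<forall>\<^sub>F n in sequentially. 0 < wt n {1..n}"
proof -
  have "limit_all - 1 < limit_all" by simp
  from norm_ln_all_lower[OF this] show ?thesis by eventually_elim blast
qed

lemma norm_ln_conn: "norm_ln (\<lambda>n. real (wt n {1})) edges \<longlonglongrightarrow> limit_conn"
proof (rule order_tendstoI)
  fix a assume "a < limit_conn"
  from norm_ln_conn_lower[OF this] show "\<forall>\<^sub>F n in sequentially. a < norm_ln (\<lambda>n. real (wt n {1})) edges n"
    by eventually_elim auto
next
  fix a assume "limit_conn < a"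
  from norm_ln_conn_upper[OF this] eventually_conn_pos
  show "\<forall>\<^sub>F n in sequentially. norm_ln (\<lambda>n. real (wt n {1})) edges n < a"
    by eventually_elim blast
qed

lemma norm_ln_odd_fact_edges: "norm_ln (\<lambda>n. real (odd_fact (edges n))) edges \<longlonglongrightarrow> limit_all"
  using norm_ln_odd_fact[OF lim_edges] by (simp add: limit_all_def)

text \<open>Lower and upper bound meet because the pairings themselves already have the limit
  \<open>limit_all\<close>; so passing from pairings to simple graphs costs only exp (o(n)).\<close>

lemma norm_ln_all: "norm_ln (\<lambda>n. real (wt n {1..n})) edges \<longlonglongrightarrow> limit_all"
proof (rule order_tendstoI)
  fix a assume "a < limit_all"
  from norm_ln_all_lower[OF this] show "\<forall>\<^sub>F n in sequentially. a < norm_ln (\<lambda>n. real (wt n {1..n})) edges n"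
    by eventually_elim auto
next
  fix a assume a: "limit_all < a"
  from order_tendstoD(2)[OF norm_ln_odd_fact_edges a] eventually_all_pos eventually_ge_at_top[of 1]
  show "\<forall>\<^sub>F n in sequentially. norm_ln (\<lambda>n. real (wt n {1..n})) edges n < a"
  proof eventually_elim
    case (elim n)
    have "ln (real (wt n {1..n})) \<le> ln (real (odd_fact (edges n)))"
      using elim(2) weight_all_le[OF elim(3)] odd_fact_pos[of "edges n"] by (subst ln_le_cancel_iff) auto
    then have "norm_ln (\<lambda>n. real (wt n {1..n})) edges n \<le> norm_ln (\<lambda>n. real (odd_fact (edges n))) edges n"
      unfolding norm_ln_def by (intro divide_right_mono) auto
    then show ?case using elim(1) by simp
  qed
qed

definition fact_prod :: "nat \<Rightarrow> real" where "fact_prod n = (\<Prod>i=1..n. fact (d n i))"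

lemma fact_prod_pos: "0 < fact_prod n"
  unfolding fact_prod_def by (intro prod_pos) auto

lemma wt_conn: "n \<ge> 1 \<Longrightarrow> real (wt n {1}) = real (card (connected_graphs_with_degrees n (d n))) * fact_prod n"
  using weight_connected_graphs[of 1 n "d n"] by (simp add: fact_prod_def)

lemma wt_all: "real (wt n {1..n}) = real (card (graphs_with_degrees n (d n))) * fact_prod n"
  using weight_graphs[of n "d n"] by (simp add: fact_prod_def)

text \<open>Both graph counts are weights divided by the same \<open>fact_prod n\<close>, which
  therefore drops out of differences of logarithms.\<close>

lemma ln_scaled:
  assumes "real w = x * fact_prod n" "0 < w"
  shows "0 < x" "ln x = ln (real w) - ln (fact_prod n)"
proof -
  show x: "0 < x" using assms fact_prod_pos[of n] by (metis of_nat_0_less_iff zero_less_mult_pos2)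
  show "ln x = ln (real w) - ln (fact_prod n)"
    unfolding assms(1) using x fact_prod_pos[of n] by (simp add: ln_mult)
qed

lemma exp_equiv_conn_all:
  "exp_equiv (K_rate p) (\<lambda>n. real (card (connected_graphs_with_degrees n (d n))))
    (\<lambda>n. real (card (graphs_with_degrees n (d n))))"
proof (rule exp_equivI)
  have ev: "\<forall>\<^sub>F n in sequentially. 0 < wt n {1} \<and> 0 < wt n {1..n} \<and> n \<ge> 1"
    using eventually_conn_pos eventually_all_pos eventually_ge_at_top[of 1] by eventually_elim blast
  then show "\<forall>\<^sub>F n in sequentially. 0 < real (card (connected_graphs_with_degrees n (d n))) \<and>
      0 < real (card (graphs_with_degrees n (d n)))"
    by eventually_elim (use ln_scaled(1)[OF wt_conn] ln_scaled(1)[OF wt_all] in blast)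
  have lim: "(\<lambda>n. norm_ln (\<lambda>n. real (wt n {1})) edges n - norm_ln (\<lambda>n. real (wt n {1..n})) edges n) \<longlonglongrightarrow> limit_conn - limit_all"
    by (intro tendsto_diff norm_ln_conn norm_ln_all)
  have diff: "limit_conn - limit_all = - K_rate p" using limit_diff by simp
  have eq: "\<forall>\<^sub>F n in sequentially. norm_ln (\<lambda>n. real (wt n {1})) edges n - norm_ln (\<lambda>n. real (wt n {1..n})) edges n =
      (ln (real (card (connected_graphs_with_degrees n (d n)))) - ln (real (card (graphs_with_degrees n (d n))))) / real n"
    using ev
  proof eventually_elim
    case (elim n)
    show ?case
      using ln_scaled(2)[OF wt_conn] ln_scaled(2)[OF wt_all] elim
      by (simp add: norm_ln_def diff_divide_distrib)
  qed
  show "(\<lambda>n. (ln (real (card (connected_graphs_with_degrees n (d n)))) -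
      ln (real (card (graphs_with_degrees n (d n))))) / real n) \<longlonglongrightarrow> - K_rate p"
    using Lim_transform_eventually[OF lim eq] unfolding diff .
qed

lemma double_fact_total: "n \<ge> 1 \<Longrightarrow> double_fact (total_degree n (d n) - 1) = odd_fact (edges n)"
proof -
  assume n: "n \<ge> 1"
  have tot: "total_degree n (d n) = 2 * edges n" using total_edges[OF n] by (simp add: total_degree_def)
  have "d n 1 \<le> (\<Sum>v\<in>{1..n}. d n v)" using n by (intro member_le_sum) auto
  moreover have "1 \<le> d n 1" using degree_pos[OF n] n by auto
  ultimately have "edges n \<ge> 1" using total_edges[OF n] by simp
  then show ?thesis unfolding tot by (rule double_fact_odd)
qed

lemma exp_equiv_conn_pairings:
  "exp_equiv (K_rate p) (\<lambda>n. real (card (connected_graphs_with_degrees n (d n))))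
    (\<lambda>n. real (double_fact (total_degree n (d n) - 1)) / (\<Prod>i=1..n. fact (d n i)))"
proof (rule exp_equivI)
  have ev: "\<forall>\<^sub>F n in sequentially. 0 < wt n {1} \<and> n \<ge> 1"
    using eventually_conn_pos eventually_ge_at_top[of 1] by eventually_elim blast
  then show "\<forall>\<^sub>F n in sequentially. 0 < real (card (connected_graphs_with_degrees n (d n))) \<and>
      0 < real (double_fact (total_degree n (d n) - 1)) / (\<Prod>i=1..n. fact (d n i))"
  proof eventually_elim
    case (elim n)
    then show ?case
      using ln_scaled(1)[OF wt_conn] double_fact_total odd_fact_pos fact_prod_pos[of n, unfolded fact_prod_def] by simp
  qed
  have lim: "(\<lambda>n. norm_ln (\<lambda>n. real (wt n {1})) edges n - norm_ln (\<lambda>n. real (odd_fact (edges n))) edges n) \<longlonglongrightarrow> limit_conn - limit_all"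
    by (intro tendsto_diff norm_ln_conn norm_ln_odd_fact_edges)
  have diff: "limit_conn - limit_all = - K_rate p" using limit_diff by simp
  have eq: "\<forall>\<^sub>F n in sequentially. norm_ln (\<lambda>n. real (wt n {1})) edges n - norm_ln (\<lambda>n. real (odd_fact (edges n))) edges n =
      (ln (real (card (connected_graphs_with_degrees n (d n)))) -
        ln (real (double_fact (total_degree n (d n) - 1)) / (\<Prod>i=1..n. fact (d n i)))) / real n"
    using ev
  proof eventually_elim
    case (elim n)
    have "ln (real (double_fact (total_degree n (d n) - 1)) / fact_prod n) = ln (real (odd_fact (edges n))) - ln (fact_prod n)"
      using double_fact_total elim odd_fact_pos[of "edges n"] fact_prod_pos[of n] by (simp add: ln_div)
    then show ?case
      unfolding fact_prod_def[symmetric] using ln_scaled(2)[OF wt_conn] elim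
      by (simp add: norm_ln_def diff_divide_distrib)
  qed
  show "(\<lambda>n. (ln (real (card (connected_graphs_with_degrees n (d n)))) -
      ln (real (double_fact (total_degree n (d n) - 1)) / (\<Prod>i=1..n. fact (d n i)))) / real n) \<longlonglongrightarrow> - K_rate p"
    using Lim_transform_eventually[OF lim eq] unfolding diff .
qed

end

theorem theorem1p3:
  fixes d :: "nat \<Rightarrow> nat \<Rightarrow> nat" and p :: "nat \<Rightarrow> real"
  assumes deg_seq: "\<And>n. n \<ge> 1 \<Longrightarrow> degree_sequence n (d n)"
    and n0: "\<And>n. n \<ge> 1 \<Longrightarrow> degree_count n (d n) 0 = 0"
    and p_dist: "prob_dist_pos p"
    and cond_a: "\<And>i. i \<ge> 1 \<Longrightarrow> (\<lambda>n. real (degree_count n (d n) i) / real n) \<longlonglongrightarrow> p i"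
    and mean_finite: "(\<lambda>i. real i * p i) summable_on {1..}"
    and cond_b: "(\<lambda>n. real (total_degree n (d n)) / real n) \<longlonglongrightarrow> mean_pos p"
    and p1: "p 1 > 0"
    and mean_gt_2: "mean_pos p > 2"
  shows "exp_equiv (K_rate p)
           (\<lambda>n. real (card (connected_graphs_with_degrees n (d n))))
           (\<lambda>n. real (card (graphs_with_degrees n (d n))))
       \<and> exp_equiv (K_rate p)
           (\<lambda>n. real (card (connected_graphs_with_degrees n (d n))))
           (\<lambda>n. real (double_fact (total_degree n (d n) - 1)) / (\<Prod>i=1..n. fact (d n i)))"
proof -
  interpret degree_sequences p d
    by unfold_locales (use assms in auto)
  show ?thesis using exp_equiv_conn_all exp_equiv_conn_pairings by blast
qed

end
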